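(* Let $\tilde{\mathbb{E}}[\cdot]$ be a nonlinear expectation dominated by a sublinear expectation $\hat{\mathbb{E}}[\cdot]$ on $(\Omega,\mathcal{H})$, and let $\{(X_{n,i},Y_{n,i}):n\in\mathbb{N},\ i=1,\ldots,n\}$ be a family of $2d$-dimensional random vectors ($X_{n,i}$ and $Y_{n,i}$ each $d$-dimensional) such that, under $\tilde{\mathbb{E}}[\cdot]$ and also under $\hat{\mathbb{E}}[\cdot]$, $(X_{n,i},Y_{n,i})\overset{d}{=}(X_{n,1},Y_{n,1})$ and $(X_{n,i},Y_{n,i})$ is independent of $(X_{n,1},\ldots,X_{n,i-1},Y_{n,1},\ldots,Y_{n,i-1})$ for all $n\in\mathbb{N}$, $i=2,\ldots,n$. Suppose that $$\hat{\mathbb{E}}[X_{n,1}]=\hat{\mathbb{E}}[-X_{n,1}]=0\ \text{ for } n\in\mathbb{N},\qquad \lim_{N\to\infty}\sup_{n\ge 1}\hat{\mathbb{E}}\left[(n|X_{n,1}|^{2}-N)^{+}+(n|Y_{n,1}|-N)^{+}\right]=0,$$ and that for each $(A,p)\in\mathbb{S}_d\times\mathbb{R}^d$ the limit $\lim_{n\to\infty}n\,\tilde{\mathbb{E}}\left[\tfrac12\langle AX_{n,1},X_{n,1}\rangle+\langle p,Y_{n,1}\rangle\right]$ exists. For $k\le n$ put $S^X_{n,k}=\sum_{i=1}^kX_{n,i}$ and $S^Y_{n,k}=\sum_{i=1}^kY_{n,i}$. Then for each $(A,p)\in\mathbb{S}_d\times\mathbb{R}^d$, each $N>0$, and all $n\in\mathbb{N}$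 and $1\le k\le n$, $$\hat{\mathbb{E}}\left[\tfrac12\langle AS^X_{n,k},S^X_{n,k}\rangle+\langle p,S^Y_{n,k}\rangle\right]=k\,\hat{\mathbb{E}}\left[\tfrac12\langle AX_{n,1},X_{n,1}\rangle+\langle p,Y_{n,1}\rangle\right],$$ $$\tilde{\mathbb{E}}\left[\tfrac12\langle AS^X_{n,k},S^X_{n,k}\rangle+\langle p,S^Y_{n,k}\rangle\right]=k\,\tilde{\mathbb{E}}\left[\tfrac12\langle AX_{n,1},X_{n,1}\rangle+\langle p,Y_{n,1}\rangle\right],$$ $$\hat{\mathbb{E}}\left[(|S^X_{n,k}|^2-N)^++(|S^Y_{n,k}|-N)^+\right]\le\hat{\mathbb{E}}\left[\left(k|X_{n,1}|^2-\tfrac N2\right)^++(k|Y_{n,1}|-N)^+\right]+\frac{4\left(k\,\hat{\mathbb{E}}[|X_{n,1}|^2]\right)^2}{N}.$$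
   Context: $C_{b.Lip}(\mathbb{R}^n)$ is the space of bounded Lipschitz functions on $\mathbb{R}^n$; $\mathbb{S}_d$ is the space of real symmetric $d\times d$ matrices; $\mathbb{N}=\{1,2,\ldots\}$; $a^+=\max(a,0)$. Let $\Omega$ be a nonempty set and $\mathcal{H}$ a linear space of real functions on $\Omega$ such that $|\xi|\in\mathcal{H}$ if $\xi\in\mathcal{H}$, and $\phi(\xi_1,\ldots,\xi_n)\in\mathcal{H}$ for all $n$, $\phi\in C_{b.Lip}(\mathbb{R}^n)$, $\xi_i\in\mathcal{H}$. A nonlinear expectation is a map $\tilde{\mathbb{E}}:\mathcal{H}\to\mathbb{R}$ with $\tilde{\mathbb{E}}[\xi_1]\ge\tilde{\mathbb{E}}[\xi_2]$ whenever $\xi_1\ge\xi_2$, and $\tilde{\mathbb{E}}[c]=c$ for $c\in\mathbb{R}$. A sublinear expectation is a nonlinear expectation $\hat{\mathbb{E}}$ with $\hat{\mathbb{E}}[\xi_1+\xi_2]\le\hat{\mathbb{E}}[\xi_1]+\hat{\mathbb{E}}[\xi_2]$ and $\hat{\mathbb{E}}[\lambda\xi]=\lambda\hat{\mathbb{E}}[\xi]$ for $\lambda\ge0$. $\tilde{\mathbb{E}}$ is dominated by $\hat{\mathbb{E}}$ if $\tilde{\mathbb{E}}[\xi_1]-\tilde{\mathbb{E}}[\xi_2]\le\hat{\mathbb{E}}[\xi_1-\xi_2]$ for all $\xi_1,\xi_2\in\mathcal{H}$. $L^1(\Omega)$ is the completion of $\mathcal{H}$ under $\|\xi\|=\hat{\mathbb{E}}[|\xi|]$;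 $\hat{\mathbb{E}}$ and every dominated $\tilde{\mathbb{E}}$ extend continuously to $L^1(\Omega)$ and domination still holds there. Random vectors have components in $L^1(\Omega)$, and the quantities appearing inside expectations (such as $|X|^2$, $|Y|$, $\langle AX,X\rangle$) are elements of $L^1(\Omega)$ (under the uniform integrability hypothesis they are the $L^1$-limits of the same expressions with $X,Y$ truncated). For a vector $X=(X^1,\ldots,X^d)^T$, $\hat{\mathbb{E}}[X]=(\hat{\mathbb{E}}[X^1],\ldots,\hat{\mathbb{E}}[X^d])^T$. Under $\tilde{\mathbb{E}}$ (and likewise under $\hat{\mathbb{E}}$): $X\overset{d}{=}Y$ means $\tilde{\mathbb{E}}[\phi(X)]=\tilde{\mathbb{E}}[\phi(Y)]$ for all bounded Lipschitz $\phi$; a vector $Y$ is independent of a vector $X$ if $\tilde{\mathbb{E}}[\phi(X,Y)]=\tilde{\mathbb{E}}\big[\tilde{\mathbb{E}}[\phi(x,Y)]_{x=X}\big]$ for all bounded Lipschitz $\phi$. *)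

theory Defs
  imports "HOL-Analysis.Analysis"
begin

text \<open>Bounded Lipschitz functions on \<open>\<real>\<^sup>I\<close> for a finite index set \<open>I\<close>. The points are
  functions on the whole index type; the Lipschitz bound is with respect to the Euclidean
  distance of the coordinates in \<open>I\<close>, so it also says that the value depends on these
  coordinates only.\<close>

definition bLip :: "'i set \<Rightarrow> (('i \<Rightarrow> real) \<Rightarrow> real) \<Rightarrow> bool" where
  "bLip I \<phi> \<longleftrightarrow>
     (\<exists>C. \<forall>x. \<bar>\<phi> x\<bar> \<le> C) \<and>
     (\<exists>L. \<forall>x y. \<bar>\<phi> x - \<phi> y\<bar> \<le> L * L2_set (\<lambda>i. x i - y i) I)"

definition rv_space :: "('w \<Rightarrow> real) set \<Rightarrow> bool" where
  "rv_space H \<longleftrightarrow>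
     (\<lambda>w. 0) \<in> H \<and>
     (\<forall>\<xi>\<in>H. \<forall>\<eta>\<in>H. (\<lambda>w. \<xi> w + \<eta> w) \<in> H) \<and>
     (\<forall>c. \<forall>\<xi>\<in>H. (\<lambda>w. c * \<xi> w) \<in> H) \<and>
     (\<forall>\<xi>\<in>H. (\<lambda>w. \<bar>\<xi> w\<bar>) \<in> H) \<and>
     (\<forall>(n::nat) \<phi> \<xi>. bLip {..<n} \<phi> \<longrightarrow> (\<forall>i<n. \<xi> i \<in> H) \<longrightarrow> (\<lambda>w. \<phi> (\<lambda>i. \<xi> i w)) \<in> H)"

definition nonlinear_expectation :: "('w \<Rightarrow> real) set \<Rightarrow> (('w \<Rightarrow> real) \<Rightarrow> real) \<Rightarrow> bool" where
  "nonlinear_expectation H E \<longleftrightarrow>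
     (\<forall>\<xi>\<in>H. \<forall>\<eta>\<in>H. (\<forall>w. \<eta> w \<le> \<xi> w) \<longrightarrow> E \<eta> \<le> E \<xi>) \<and>
     (\<forall>c. E (\<lambda>w. c) = c)"

definition sublinear_expectation :: "('w \<Rightarrow> real) set \<Rightarrow> (('w \<Rightarrow> real) \<Rightarrow> real) \<Rightarrow> bool" where
  "sublinear_expectation H E \<longleftrightarrow>
     nonlinear_expectation H E \<and>
     (\<forall>\<xi>\<in>H. \<forall>\<eta>\<in>H. E (\<lambda>w. \<xi> w + \<eta> w) \<le> E \<xi> + E \<eta>) \<and>
     (\<forall>c\<ge>0. \<forall>\<xi>\<in>H. E (\<lambda>w. c * \<xi> w) = c * E \<xi>)"

definition dominated_by ::
  "('w \<Rightarrow> real) set \<Rightarrow> (('w \<Rightarrow> real) \<Rightarrow> real) \<Rightarrow> (('w \<Rightarrow> real) \<Rightarrow> real) \<Rightarrow> bool" where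
  "dominated_by H Et Eh \<longleftrightarrow> (\<forall>\<xi>\<in>H. \<forall>\<eta>\<in>H. Et \<xi> - Et \<eta> \<le> Eh (\<lambda>w. \<xi> w - \<eta> w))"

text \<open>The completion of \<open>H\<close> under the seminorm \<open>Eh \<bar>\<xi>\<bar>\<close> is given by a linear isometric
  map \<open>j\<close> of \<open>H\<close> into a Banach space: the space \<open>L1 H j\<close>, the closure of the image, is complete
  and contains the image of \<open>H\<close> as a dense subspace, and up to a linear isometry every
  completion is of this form. (A closure is used, rather than a Banach space type that equals
  the completion, so that one and the same type can serve for all \<open>H\<close> and \<open>Eh\<close> over \<open>'w\<close>.)\<close>

definition completion_map ::
  "('w \<Rightarrow> real) set \<Rightarrow> (('w \<Rightarrow> real) \<Rightarrow> real) \<Rightarrow> (('w \<Rightarrow> real) \<Rightarrow> 'l::banach) \<Rightarrow> bool" where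
  "completion_map H Eh j \<longleftrightarrow>
     (\<forall>\<xi>\<in>H. \<forall>\<eta>\<in>H. j (\<lambda>w. \<xi> w + \<eta> w) = j \<xi> + j \<eta>) \<and>
     (\<forall>c. \<forall>\<xi>\<in>H. j (\<lambda>w. c * \<xi> w) = c *\<^sub>R j \<xi>) \<and>
     (\<forall>\<xi>\<in>H. norm (j \<xi>) = Eh (\<lambda>w. \<bar>\<xi> w\<bar>))"

definition L1 :: "('w \<Rightarrow> real) set \<Rightarrow> (('w \<Rightarrow> real) \<Rightarrow> 'l::banach) \<Rightarrow> 'l set" where
  "L1 H j = closure (j ` H)"

text \<open>The continuous extension of \<open>E\<close> from \<open>H\<close> to \<open>L1 H j\<close>.\<close>

definition L1_exp ::
  "('w \<Rightarrow> real) set \<Rightarrow> (('w \<Rightarrow> real) \<Rightarrow> 'l::banach) \<Rightarrow> (('w \<Rightarrow> real) \<Rightarrow> real) \<Rightarrow> 'l \<Rightarrow> real" where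
  "L1_exp H j E z =
     (THE v. \<forall>\<xi>. (\<forall>k. \<xi> k \<in> H) \<and> (\<lambda>k. j (\<xi> k)) \<longlonglongrightarrow> z \<longrightarrow> (\<lambda>k. E (\<xi> k)) \<longlonglongrightarrow> v)"

text \<open>\<open>\<phi>(Z)\<close> for \<open>bLip I \<phi>\<close> and a family \<open>Z\<close> in \<open>L1 H j\<close> indexed by the finite set \<open>I\<close>: the
  continuous extension of \<open>\<xi> \<mapsto> \<phi>(\<xi>)\<close> from families in \<open>H\<close>.\<close>

definition L1_blip ::
  "('w \<Rightarrow> real) set \<Rightarrow> (('w \<Rightarrow> real) \<Rightarrow> 'l::banach) \<Rightarrow> 'i set \<Rightarrow> (('i \<Rightarrow> real) \<Rightarrow> real) \<Rightarrow>
   ('i \<Rightarrow> 'l) \<Rightarrow> 'l" where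
  "L1_blip H j I \<phi> Z =
     (THE y. \<forall>\<xi>. (\<forall>k. \<forall>i\<in>I. \<xi> k i \<in> H) \<and> (\<forall>i\<in>I. (\<lambda>k. j (\<xi> k i)) \<longlonglongrightarrow> Z i) \<longrightarrow>
        (\<lambda>k. j (\<lambda>w. \<phi> (\<lambda>i. \<xi> k i w))) \<longlonglongrightarrow> y)"

definition same_law ::
  "('w \<Rightarrow> real) set \<Rightarrow> (('w \<Rightarrow> real) \<Rightarrow> 'l::banach) \<Rightarrow> (('w \<Rightarrow> real) \<Rightarrow> real) \<Rightarrow> 'i set \<Rightarrow>
   ('i \<Rightarrow> 'l) \<Rightarrow> ('i \<Rightarrow> 'l) \<Rightarrow> bool" where
  "same_law H j E I Z W \<longleftrightarrow>
     (\<forall>\<phi>. bLip I \<phi> \<longrightarrow> L1_exp H j E (L1_blip H j I \<phi> Z) = L1_exp H j E (L1_blip H j I \<phi> W))"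

text \<open>\<open>indep_of H j E J W I Z\<close>: the vector \<open>W\<close> (indexed by \<open>J\<close>) is independent of the vector
  \<open>Z\<close> (indexed by \<open>I\<close>); the order matters.\<close>

definition indep_of ::
  "('w \<Rightarrow> real) set \<Rightarrow> (('w \<Rightarrow> real) \<Rightarrow> 'l::banach) \<Rightarrow> (('w \<Rightarrow> real) \<Rightarrow> real) \<Rightarrow>
   'b set \<Rightarrow> ('b \<Rightarrow> 'l) \<Rightarrow> 'a set \<Rightarrow> ('a \<Rightarrow> 'l) \<Rightarrow> bool" where
  "indep_of H j E J W I Z \<longleftrightarrow>
     (\<forall>\<phi>. bLip (I <+> J) \<phi> \<longrightarrow>
        L1_exp H j E (L1_blip H j (I <+> J) \<phi> (case_sum Z W)) =
        L1_exp H j E (L1_blip H j I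
          (\<lambda>x. L1_exp H j E (L1_blip H j J (\<lambda>y. \<phi> (case_sum x y)) W)) Z))"

text \<open>Unbounded, locally Lipschitz \<open>\<psi>\<close> such as \<open>\<bar>x\<bar>\<^sup>2\<close>: \<open>\<psi>(X)\<close> is the \<open>L1\<close> limit of \<open>\<psi>\<close> applied
  to the truncations of \<open>X\<close>. The truncations of \<open>X\<close> themselves are required to converge to
  \<open>X\<close>. This is not automatic in the absence of uniform integrability, and without it the
  limit need not have anything to do with \<open>X\<close>.\<close>

definition trunc :: "nat \<Rightarrow> real \<Rightarrow> real" where
  "trunc M t = max (- real M) (min (real M) t)"

definition has_L1_val ::
  "('w \<Rightarrow> real) set \<Rightarrow> (('w \<Rightarrow> real) \<Rightarrow> 'l::banach) \<Rightarrow> (real ^ 'm \<Rightarrow> real) \<Rightarrow> 'l ^ 'm \<Rightarrow> 'l \<Rightarrow> bool"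
  where
  "has_L1_val H j \<psi> X y \<longleftrightarrow>
     (\<forall>i. (\<lambda>M. L1_blip H j UNIV (\<lambda>x. trunc M (x i)) (\<lambda>i. X $ i)) \<longlonglongrightarrow> X $ i) \<and>
     (\<lambda>M. L1_blip H j UNIV (\<lambda>x. \<psi> (\<chi> i. trunc M (x i))) (\<lambda>i. X $ i)) \<longlonglongrightarrow> y"

definition in_L1 ::
  "('w \<Rightarrow> real) set \<Rightarrow> (('w \<Rightarrow> real) \<Rightarrow> 'l::banach) \<Rightarrow> (real ^ 'm \<Rightarrow> real) \<Rightarrow> 'l ^ 'm \<Rightarrow> bool" where
  "in_L1 H j \<psi> X \<longleftrightarrow> (\<exists>y. has_L1_val H j \<psi> X y)"

definition L1_val ::
  "('w \<Rightarrow> real) set \<Rightarrow> (('w \<Rightarrow> real) \<Rightarrow> 'l::banach) \<Rightarrow> (real ^ 'm \<Rightarrow> real) \<Rightarrow> 'l ^ 'm \<Rightarrow> 'l" where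
  "L1_val H j \<psi> X = (THE y. has_L1_val H j \<psi> X y)"

text \<open>\<open>\<langle>AX,X\<rangle>/2 + \<langle>p,Y\<rangle>\<close> as an element of \<open>L1\<close>.\<close>

definition quad_lin ::
  "('w \<Rightarrow> real) set \<Rightarrow> (('w \<Rightarrow> real) \<Rightarrow> 'l::banach) \<Rightarrow> real ^ 'd ^ 'd \<Rightarrow> real ^ 'd \<Rightarrow>
   'l ^ 'd \<Rightarrow> 'l ^ 'd \<Rightarrow> 'l" where
  "quad_lin H j A p X Y =
     L1_val H j (\<lambda>x. 1/2 * ((A *v x) \<bullet> x)) X + (\<Sum>i\<in>UNIV. p $ i *\<^sub>R Y $ i)"

text \<open>\<open>(c\<bar>X\<bar>\<^sup>2 - M)\<^sup>+ + (c\<bar>Y\<bar> - N)\<^sup>+\<close> as an element of \<open>L1\<close>.\<close>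

definition excess ::
  "('w \<Rightarrow> real) set \<Rightarrow> (('w \<Rightarrow> real) \<Rightarrow> 'l::banach) \<Rightarrow> real \<Rightarrow> real \<Rightarrow> real \<Rightarrow>
   'l ^ 'd \<Rightarrow> 'l ^ 'd \<Rightarrow> 'l" where
  "excess H j c M N X Y =
     L1_val H j (\<lambda>x. max (c * (norm x)\<^sup>2 - M) 0) X + L1_val H j (\<lambda>y. max (c * norm y - N) 0) Y"

text \<open>The \<open>2d\<close>-dimensional vector \<open>(X,Y)\<close> as a family of components.\<close>

definition joint :: "'l ^ 'd \<Rightarrow> 'l ^ 'd \<Rightarrow> 'd + 'd \<Rightarrow> 'l" where
  "joint X Y = case_sum (\<lambda>i. X $ i) (\<lambda>i. Y $ i)"

end

theory Submission imports Defs begin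

text \<open>
  All three statements concern finitely many components \<open>Z\<close> of \<open>L1\<close>, and everything in them is
  expressed through the functional \<open>\<phi> \<mapsto> E[\<phi>(Z)]\<close> on functions of finitely many real variables,
  where \<open>E\<close> is the sublinear expectation or one that it dominates. For bounded Lipschitz \<open>\<phi>\<close> this
  functional is given. Square integrability of the \<open>X\<close>-components in the sense of \<open>in_L1\<close>, and
  integrability of the \<open>Y\<close>-components, imply uniform integrability of the truncations. Hence
  the functional extends to all locally Lipschitz \<open>\<phi>\<close> that grow at most quadratically in the
  former and linearly in the latter variables: \<open>\<phi>\<close> applied to the truncated family converges
  (\<open>val_tendsto\<close>), and the limit does not depend on the way in which one truncates (\<open>val_eqI\<close>), so
  that truncating a sum agrees in the limit with summing truncations (\<open>val_sums\<close>). Independence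
  extends to this class in the form of two comparison statements (\<open>indep_ev\<close>): if
  \<open>E[\<phi>(x, W)] \<le> g(x)\<close> for all \<open>x\<close>, then \<open>E[\<phi>(Z, W)] \<le> E[g(Z)]\<close>, and likewise for \<open>\<ge>\<close>.

  Write \<open>q(x, y) = \<langle>Ax, x\<rangle>/2 + \<langle>p, y\<rangle>\<close>. For symmetric \<open>A\<close>,
  \<open>q(s + x, t + y) = q(s, t) + \<langle>As, x\<rangle> + q(x, y)\<close>. As \<open>X\<close> is centred under the sublinear
  expectation in both directions, adding \<open>\<langle>As, X\<rangle>\<close> changes no dominated expectation, and adding the
  constant \<open>q(s, t)\<close> shifts it. Conditioning on the past therefore adds \<open>E[q(X\<^sub>1, Y\<^sub>1)]\<close> in each step,
  which gives both equalities by induction.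

  For the inequality let \<open>E\<close> be the sublinear expectation, and let \<open>M\<^sub>k = \<bar>S\<^sub>k\<bar>\<^sup>2 - \<Sum>\<bar>X\<^sub>i\<bar>\<^sup>2\<close> be the
  off-diagonal part of \<open>\<bar>S\<^sub>k\<bar>\<^sup>2\<close>. Then \<open>(\<bar>S\<^sub>k\<bar>\<^sup>2 - N)\<^sup>+ \<le> (\<Sum>\<bar>X\<^sub>i\<bar>\<^sup>2 - N/2)\<^sup>+ + (M\<^sub>k - N/2)\<^sup>+\<close>, and by
  convexity the first summand, like \<open>(\<bar>T\<^sub>k\<bar> - N)\<^sup>+\<close> for the sum \<open>T\<^sub>k\<close> of the \<open>Y\<^sub>i\<close>, is at most the
  average over \<open>i\<close> of \<open>(k\<bar>X\<^sub>i\<bar>\<^sup>2 - N/2)\<^sup>+\<close>, respectively \<open>(k\<bar>Y\<^sub>i\<bar> - N)\<^sup>+\<close>. The second summand is at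
  most \<open>f(M\<^sub>k)\<close> with \<open>f(m) = sqrt (N\<^sup>2/4 + m\<^sup>2) - N/2\<close>. Now \<open>f'' \<le> 2/N\<close> and
  \<open>M\<^sub>k\<^sub>+\<^sub>1 = M\<^sub>k + 2\<langle>S\<^sub>k, X\<^sub>k\<^sub>+\<^sub>1\<rangle>\<close>, where the first-order term has expectation zero. Conditioning
  therefore gives \<open>E[f(M\<^sub>k\<^sub>+\<^sub>1)] \<le> E[f(M\<^sub>k)] + (4/N) \<sigma>\<^sup>2 E[\<bar>S\<^sub>k\<bar>\<^sup>2]\<close> with \<open>\<sigma>\<^sup>2 = E[\<bar>X\<^sub>1\<bar>\<^sup>2]\<close>. By the
  first equality \<open>E[\<bar>S\<^sub>k\<bar>\<^sup>2] = k\<sigma>\<^sup>2\<close>, and summation yields \<open>E[f(M\<^sub>k)] \<le> 2(k\<sigma>\<^sup>2)\<^sup>2/N\<close>. Using \<open>f(M\<^sub>k)\<close>,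
  which grows quadratically in the \<open>X\<^sub>i\<close>, instead of \<open>M\<^sub>k\<^sup>2\<close> avoids any question of fourth moments.\<close>

section \<open>Bounded Lipschitz functions of finitely many coordinates\<close>

text \<open>Estimates are more convenient with the \<open>\<ell>\<^sup>1\<close> distance of the coordinates in \<open>I\<close> than with the
  Euclidean one; for finite \<open>I\<close> the two give the same class.\<close>

lemma bLip_iff_sum:
  assumes "finite I"
  shows "bLip I \<phi> \<longleftrightarrow> (\<exists>C. \<forall>x. \<bar>\<phi> x\<bar> \<le> C) \<and>
    (\<exists>L\<ge>0. \<forall>x y. \<bar>\<phi> x - \<phi> y\<bar> \<le> L * (\<Sum>i\<in>I. \<bar>x i - y i\<bar>))"
proof -
  have 1: "\<exists>L\<ge>0. \<forall>x y. \<bar>\<phi> x - \<phi> y\<bar> \<le> L * (\<Sum>i\<in>I. \<bar>x i - y i\<bar>)"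
    if "\<forall>x y. \<bar>\<phi> x - \<phi> y\<bar> \<le> L * L2_set (\<lambda>i. x i - y i) I" for L
  proof (intro exI[of _ "\<bar>L\<bar>"] conjI allI)
    fix x y
    have "\<bar>\<phi> x - \<phi> y\<bar> \<le> L * L2_set (\<lambda>i. x i - y i) I" using that by blast
    also have "\<dots> \<le> \<bar>L\<bar> * (\<Sum>i\<in>I. \<bar>x i - y i\<bar>)"
      by (intro mult_mono L2_set_le_sum_abs) (auto simp: L2_set_nonneg)
    finally show "\<bar>\<phi> x - \<phi> y\<bar> \<le> \<bar>L\<bar> * (\<Sum>i\<in>I. \<bar>x i - y i\<bar>)" .
  qed auto
  have 2: "\<exists>L. \<forall>x y. \<bar>\<phi> x - \<phi> y\<bar> \<le> L * L2_set (\<lambda>i. x i - y i) I"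
    if L: "L \<ge> 0" "\<forall>x y. \<bar>\<phi> x - \<phi> y\<bar> \<le> L * (\<Sum>i\<in>I. \<bar>x i - y i\<bar>)" for L
  proof (intro exI[of _ "L * card I"] allI)
    fix x y
    have "\<bar>x i - y i\<bar> \<le> L2_set (\<lambda>i. x i - y i) I" if "i \<in> I" for i
    proof -
      have "\<bar>x i - y i\<bar> \<le> L2_set (\<lambda>i. \<bar>x i - y i\<bar>) I"
        by (rule member_le_L2_set[OF assms that])
      then show ?thesis by (simp add: L2_set_def)
    qed
    then have s: "(\<Sum>i\<in>I. \<bar>x i - y i\<bar>) \<le> card I * L2_set (\<lambda>i. x i - y i) I"
      by (intro sum_bounded_above)
    have "\<bar>\<phi> x - \<phi> y\<bar> \<le> L * (\<Sum>i\<in>I. \<bar>x i - y i\<bar>)" using L by blast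
    also have "\<dots> \<le> L * (card I * L2_set (\<lambda>i. x i - y i) I)"
      by (intro mult_left_mono s L)
    finally show "\<bar>\<phi> x - \<phi> y\<bar> \<le> L * card I * L2_set (\<lambda>i. x i - y i) I" by (simp add: mult.assoc)
  qed
  show ?thesis unfolding bLip_def using 1 2 by blast
qed

lemma bLipI:
  assumes "finite I" "\<And>x. \<bar>\<phi> x\<bar> \<le> C" "\<And>x y. \<bar>\<phi> x - \<phi> y\<bar> \<le> L * (\<Sum>i\<in>I. \<bar>x i - y i\<bar>)"
  shows "bLip I \<phi>"
proof -
  have "\<bar>\<phi> x - \<phi> y\<bar> \<le> \<bar>L\<bar> * (\<Sum>i\<in>I. \<bar>x i - y i\<bar>)" for x y
    by (rule order_trans[OF assms(3)]) (auto intro!: mult_right_mono sum_nonneg)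
  then show ?thesis unfolding bLip_iff_sum[OF assms(1)] using assms(2) abs_ge_zero by blast
qed

lemma bLipE:
  assumes "finite I" "bLip I \<phi>"
  obtains C L where "C \<ge> 0" "L \<ge> 0" "\<And>x. \<bar>\<phi> x\<bar> \<le> C"
    "\<And>x y. \<bar>\<phi> x - \<phi> y\<bar> \<le> L * (\<Sum>i\<in>I. \<bar>x i - y i\<bar>)"
proof -
  obtain C L where CL: "\<And>x. \<bar>\<phi> x\<bar> \<le> C" "L \<ge> 0"
    "\<And>x y. \<bar>\<phi> x - \<phi> y\<bar> \<le> L * (\<Sum>i\<in>I. \<bar>x i - y i\<bar>)"
    using assms(2) unfolding bLip_iff_sum[OF assms(1)] by blast
  have "C \<ge> 0" using CL(1)[of undefined] by linarith
  then show ?thesis using that CL by blast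
qed

lemma bLip_cong:
  assumes "finite I" "bLip I \<phi>" "\<And>i. i \<in> I \<Longrightarrow> x i = y i"
  shows "\<phi> x = \<phi> y"
proof -
  obtain C L where "C \<ge> 0" "L \<ge> 0" "\<And>x. \<bar>\<phi> x\<bar> \<le> C"
      and *: "\<And>x y. \<bar>\<phi> x - \<phi> y\<bar> \<le> L * (\<Sum>i\<in>I. \<bar>x i - y i\<bar>)"
    by (rule bLipE[OF assms(1,2)]) (rule that)
  from *[of x y] assms(3) show ?thesis by simp
qed

lemma bLip_const: "finite I \<Longrightarrow> bLip I (\<lambda>x. c)"
  by (rule bLipI[of _ _ "\<bar>c\<bar>" 0]) auto

lemma bLip_add:
  assumes "finite I" "bLip I \<phi>" "bLip I \<psi>"
  shows "bLip I (\<lambda>x. \<phi> x + \<psi> x)"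
proof -
  obtain C L where 1: "C \<ge> 0" "L \<ge> 0" "\<And>x. \<bar>\<phi> x\<bar> \<le> C" "\<And>x y. \<bar>\<phi> x - \<phi> y\<bar> \<le> L * (\<Sum>i\<in>I. \<bar>x i - y i\<bar>)"
    by (rule bLipE[OF assms(1,2)]) (rule that)
  obtain C' L' where 2: "C' \<ge> 0" "L' \<ge> 0" "\<And>x. \<bar>\<psi> x\<bar> \<le> C'"
      "\<And>x y. \<bar>\<psi> x - \<psi> y\<bar> \<le> L' * (\<Sum>i\<in>I. \<bar>x i - y i\<bar>)"
    by (rule bLipE[OF assms(1,3)]) (rule that)
  show ?thesis
  proof (rule bLipI[OF assms(1), of _ "C + C'" "L + L'"])
    show "\<bar>\<phi> x + \<psi> x\<bar> \<le> C + C'" for x using 1(3)[of x] 2(3)[of x] by linarith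
    show "\<bar>\<phi> x + \<psi> x - (\<phi> y + \<psi> y)\<bar> \<le> (L + L') * (\<Sum>i\<in>I. \<bar>x i - y i\<bar>)" for x y
      using 1(4)[of x y] 2(4)[of x y] by (simp add: distrib_right)
  qed
qed

lemma bLip_mult:
  assumes "finite I" "bLip I \<phi>" "bLip I \<psi>"
  shows "bLip I (\<lambda>x. \<phi> x * \<psi> x)"
proof -
  obtain C L where 1: "C \<ge> 0" "L \<ge> 0" "\<And>x. \<bar>\<phi> x\<bar> \<le> C" "\<And>x y. \<bar>\<phi> x - \<phi> y\<bar> \<le> L * (\<Sum>i\<in>I. \<bar>x i - y i\<bar>)"
    by (rule bLipE[OF assms(1,2)]) (rule that)
  obtain C' L' where 2: "C' \<ge> 0" "L' \<ge> 0" "\<And>x. \<bar>\<psi> x\<bar> \<le> C'"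
      "\<And>x y. \<bar>\<psi> x - \<psi> y\<bar> \<le> L' * (\<Sum>i\<in>I. \<bar>x i - y i\<bar>)"
    by (rule bLipE[OF assms(1,3)]) (rule that)
  show ?thesis
  proof (rule bLipI[OF assms(1), of _ "C * C'" "C * L' + C' * L"])
    show "\<bar>\<phi> x * \<psi> x\<bar> \<le> C * C'" for x
      unfolding abs_mult using 1 2 by (intro mult_mono) auto
    show "\<bar>\<phi> x * \<psi> x - \<phi> y * \<psi> y\<bar> \<le> (C * L' + C' * L) * (\<Sum>i\<in>I. \<bar>x i - y i\<bar>)" for x y
    proof -
      have "\<phi> x * \<psi> x - \<phi> y * \<psi> y = \<phi> x * (\<psi> x - \<psi> y) + \<psi> y * (\<phi> x - \<phi> y)"
        by (simp add: algebra_simps)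
      then have "\<bar>\<phi> x * \<psi> x - \<phi> y * \<psi> y\<bar> \<le> \<bar>\<phi> x\<bar> * \<bar>\<psi> x - \<psi> y\<bar> + \<bar>\<psi> y\<bar> * \<bar>\<phi> x - \<phi> y\<bar>"
        by (metis abs_mult abs_triangle_ineq)
      also have "\<dots> \<le> C * (L' * (\<Sum>i\<in>I. \<bar>x i - y i\<bar>)) + C' * (L * (\<Sum>i\<in>I. \<bar>x i - y i\<bar>))"
        using 1 2 by (intro add_mono mult_mono) auto
      finally show ?thesis by (simp add: algebra_simps)
    qed
  qed
qed

lemma bLip_cmult: "finite I \<Longrightarrow> bLip I \<phi> \<Longrightarrow> bLip I (\<lambda>x. c * \<phi> x)"
  by (intro bLip_mult bLip_const)

lemma bLip_diff:
  assumes "finite I" "bLip I \<phi>" "bLip I \<psi>"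
  shows "bLip I (\<lambda>x. \<phi> x - \<psi> x)"
  using bLip_add[OF assms(1,2) bLip_cmult[OF assms(1,3), of "-1"]] by simp

lemma bLip_sum:
  assumes "finite I" "\<And>a. a \<in> A \<Longrightarrow> bLip I (\<phi> a)"
  shows "bLip I (\<lambda>x. \<Sum>a\<in>A. \<phi> a x)"
  using assms(2) by (induction A rule: infinite_finite_induct) (simp_all add: assms(1) bLip_const
      bLip_add)

lemma bLip_power: "finite I \<Longrightarrow> bLip I \<phi> \<Longrightarrow> bLip I (\<lambda>x. \<phi> x ^ n)"
  by (induction n) (simp_all add: bLip_const bLip_mult)

text \<open>Post-composition with a Lipschitz function of one real variable.\<close>

lemma bLip_lip:
  fixes F :: "real \<Rightarrow> real"
  assumes "finite I" "bLip I \<phi>" "\<And>s t. \<bar>F s - F t\<bar> \<le> K * \<bar>s - t\<bar>"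
  shows "bLip I (\<lambda>x. F (\<phi> x))"
proof -
  obtain C L where 1: "C \<ge> 0" "L \<ge> 0" "\<And>x. \<bar>\<phi> x\<bar> \<le> C"
    "\<And>x y. \<bar>\<phi> x - \<phi> y\<bar> \<le> L * (\<Sum>i\<in>I. \<bar>x i - y i\<bar>)"
    by (rule bLipE[OF assms(1,2)]) (rule that)
  have K: "\<bar>F s - F t\<bar> \<le> \<bar>K\<bar> * \<bar>s - t\<bar>" for s t
    by (rule order_trans[OF assms(3)]) (auto intro: mult_right_mono)
  show ?thesis
  proof (rule bLipI[OF assms(1), of _ "\<bar>F 0\<bar> + \<bar>K\<bar> * C" "\<bar>K\<bar> * L"])
    fix x y
    have "\<bar>K\<bar> * \<bar>\<phi> x - 0\<bar> \<le> \<bar>K\<bar> * C" using 1 by (intro mult_left_mono) auto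
    then show "\<bar>F (\<phi> x)\<bar> \<le> \<bar>F 0\<bar> + \<bar>K\<bar> * C" using K[of "\<phi> x" 0] by linarith
    have "\<bar>K\<bar> * \<bar>\<phi> x - \<phi> y\<bar> \<le> \<bar>K\<bar> * (L * (\<Sum>i\<in>I. \<bar>x i - y i\<bar>))"
      using 1 by (intro mult_left_mono) auto
    then show "\<bar>F (\<phi> x) - F (\<phi> y)\<bar> \<le> \<bar>K\<bar> * L * (\<Sum>i\<in>I. \<bar>x i - y i\<bar>)"
      using K[of "\<phi> x" "\<phi> y"] by (simp add: mult.assoc)
  qed
qed

lemma bLip_abs: "finite I \<Longrightarrow> bLip I \<phi> \<Longrightarrow> bLip I (\<lambda>x. \<bar>\<phi> x\<bar>)"
  by (rule bLip_lip[where F = abs and K = 1]) auto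

lemma bLip_pospart: "finite I \<Longrightarrow> bLip I \<phi> \<Longrightarrow> bLip I (\<lambda>x. max (\<phi> x) 0)"
  by (rule bLip_lip[where F = "\<lambda>t. max t 0" and K = 1]) auto

lemma bLip_pospart_shift: "finite I \<Longrightarrow> bLip I \<phi> \<Longrightarrow> bLip I (\<lambda>x. max (\<phi> x - c) 0)"
  by (intro bLip_pospart bLip_diff bLip_const)

text \<open>Pre-composition with a Lipschitz map between coordinate spaces.\<close>

lemma bLip_pre:
  assumes "finite I" "finite J" "bLip J \<phi>"
    "\<And>x y c. c \<in> J \<Longrightarrow> \<bar>G x c - G y c\<bar> \<le> K * (\<Sum>i\<in>I. \<bar>x i - y i\<bar>)"
  shows "bLip I (\<lambda>x. \<phi> (G x))"
proof -
  obtain C L where 1: "C \<ge> 0" "L \<ge> 0" "\<And>x. \<bar>\<phi> x\<bar> \<le> C"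
    "\<And>x y. \<bar>\<phi> x - \<phi> y\<bar> \<le> L * (\<Sum>c\<in>J. \<bar>x c - y c\<bar>)"
    by (rule bLipE[OF assms(2,3)]) (rule that)
  show ?thesis
  proof (rule bLipI[OF assms(1), of _ C "L * (card J * K)"])
    fix x y
    have "(\<Sum>c\<in>J. \<bar>G x c - G y c\<bar>) \<le> card J * (K * (\<Sum>i\<in>I. \<bar>x i - y i\<bar>))"
      by (intro sum_bounded_above assms(4))
    then have "L * (\<Sum>c\<in>J. \<bar>G x c - G y c\<bar>) \<le> L * (card J * (K * (\<Sum>i\<in>I. \<bar>x i - y i\<bar>)))"
      using 1 by (intro mult_left_mono)
    then show "\<bar>\<phi> (G x) - \<phi> (G y)\<bar> \<le> L * (card J * K) * (\<Sum>i\<in>I. \<bar>x i - y i\<bar>)"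
      using 1(4)[of "G x" "G y"] by (simp add: mult.assoc)
  qed (rule 1)
qed

section \<open>Expectations on the completion\<close>

text \<open>A sublinear expectation \<open>Eh\<close> on a space \<open>H\<close> of random variables, together with a
  completion \<open>j\<close> of \<open>H\<close> under the seminorm \<open>Eh \<bar>\<xi>\<bar>\<close>.\<close>

locale sublin_completion =
  fixes H :: "('w \<Rightarrow> real) set" and Eh :: "('w \<Rightarrow> real) \<Rightarrow> real"
    and j :: "('w \<Rightarrow> real) \<Rightarrow> 'l::banach"
  assumes rv: "rv_space H"
    and sublin: "sublinear_expectation H Eh"
    and compl: "completion_map H Eh j"
begin

lemma H_add: "\<xi> \<in> H \<Longrightarrow> \<eta> \<in> H \<Longrightarrow> (\<lambda>w. \<xi> w + \<eta> w) \<in> H"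
  and H_cmult: "\<xi> \<in> H \<Longrightarrow> (\<lambda>w. c * \<xi> w) \<in> H"
  and H_abs: "\<xi> \<in> H \<Longrightarrow> (\<lambda>w. \<bar>\<xi> w\<bar>) \<in> H"
  and H_zero: "(\<lambda>w. 0) \<in> H"
  using rv unfolding rv_space_def by blast+

lemma H_diff: "\<xi> \<in> H \<Longrightarrow> \<eta> \<in> H \<Longrightarrow> (\<lambda>w. \<xi> w - \<eta> w) \<in> H"
  using H_add[of \<xi> "\<lambda>w. -1 * \<eta> w"] H_cmult[of \<eta> "-1"] by simp

lemma H_sum: "(\<And>a. a \<in> A \<Longrightarrow> \<xi> a \<in> H) \<Longrightarrow> (\<lambda>w. \<Sum>a\<in>A. \<xi> a w) \<in> H"
  by (induction A rule: infinite_finite_induct) (auto simp: H_zero H_add)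

lemma H_bLip:
  assumes fin: "finite I" and \<phi>: "bLip I \<phi>" and \<xi>: "\<And>i. i \<in> I \<Longrightarrow> \<xi> i \<in> H"
  shows "(\<lambda>w. \<phi> (\<lambda>i. \<xi> i w)) \<in> H"
proof -
  \<comment> \<open>Closure of \<open>H\<close> is assumed for coordinates indexed by an initial segment of the
    naturals.\<close>
  obtain g where g: "bij_betw g I {..<card I}"
    using fin ex_bij_betw_finite_nat[OF fin] by (auto simp: atLeast0LessThan)
  define h where "h = inv_into I g"
  have h: "h k \<in> I" if "k < card I" for k
    using g that unfolding h_def by (metis bij_betw_imp_surj_on inv_into_into lessThan_iff)
  have hg: "h (g i) = i" if "i \<in> I" for i
    using g that unfolding h_def by (meson bij_betw_imp_inj_on inv_into_f_f)
  have gm: "g i < card I" if "i \<in> I" for i using g that bij_betwE by fastforce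
  have "bLip {..<card I} (\<lambda>y. \<phi> (\<lambda>i. y (g i)))"
    by (rule bLip_pre[OF _ fin \<phi>, of _ "\<lambda>y i. y (g i)" 1])
      (auto intro!: member_le_sum[where f = "\<lambda>i. \<bar>_ i - _ i\<bar>"] gm)
  then have "(\<lambda>w. \<phi> (\<lambda>i. \<xi> (h (g i)) w)) \<in> H"
    using rv h \<xi> unfolding rv_space_def
    by (elim conjE) (drule spec, drule spec, drule spec[of _ "\<lambda>k. \<xi> (h k)"], auto)
  moreover have "(\<lambda>w. \<phi> (\<lambda>i. \<xi> (h (g i)) w)) = (\<lambda>w. \<phi> (\<lambda>i. \<xi> i w))"
    by (intro ext bLip_cong[OF fin \<phi>]) (simp add: hg)
  ultimately show ?thesis by simp
qed

lemma j_add: "\<xi> \<in> H \<Longrightarrow> \<eta> \<in> H \<Longrightarrow> j (\<lambda>w. \<xi> w + \<eta> w) = j \<xi> + j \<eta>"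
  and j_cmult: "\<xi> \<in> H \<Longrightarrow> j (\<lambda>w. c * \<xi> w) = c *\<^sub>R j \<xi>"
  and norm_j: "\<xi> \<in> H \<Longrightarrow> norm (j \<xi>) = Eh (\<lambda>w. \<bar>\<xi> w\<bar>)"
  using compl unfolding completion_map_def by blast+

lemma j_zero: "j (\<lambda>w. 0) = 0"
  using j_cmult[OF H_zero, of 0] by simp

lemma j_diff: "\<xi> \<in> H \<Longrightarrow> \<eta> \<in> H \<Longrightarrow> j (\<lambda>w. \<xi> w - \<eta> w) = j \<xi> - j \<eta>"
  using j_add[of \<xi> "\<lambda>w. -1 * \<eta> w"] H_cmult[of \<eta> "-1"] j_cmult[of \<eta> "-1"] by simp

lemma j_sum: "(\<And>a. a \<in> A \<Longrightarrow> \<xi> a \<in> H) \<Longrightarrow> j (\<lambda>w. \<Sum>a\<in>A. \<xi> a w) = (\<Sum>a\<in>A. j (\<xi> a))"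
  by (induction A rule: infinite_finite_induct) (auto simp: j_zero j_add H_sum)

lemma Eh_mono: "\<xi> \<in> H \<Longrightarrow> \<eta> \<in> H \<Longrightarrow> (\<And>w. \<xi> w \<le> \<eta> w) \<Longrightarrow> Eh \<xi> \<le> Eh \<eta>"
  and Eh_const: "Eh (\<lambda>w. c) = c"
  and Eh_add: "\<xi> \<in> H \<Longrightarrow> \<eta> \<in> H \<Longrightarrow> Eh (\<lambda>w. \<xi> w + \<eta> w) \<le> Eh \<xi> + Eh \<eta>"
  and Eh_cmult: "\<xi> \<in> H \<Longrightarrow> c \<ge> 0 \<Longrightarrow> Eh (\<lambda>w. c * \<xi> w) = c * Eh \<xi>"
  using sublin unfolding sublinear_expectation_def nonlinear_expectation_def by blast+

lemma Eh_sum: "finite A \<Longrightarrow> (\<And>a. a \<in> A \<Longrightarrow> \<xi> a \<in> H) \<Longrightarrow> Eh (\<lambda>w. \<Sum>a\<in>A. \<xi> a w) \<le> (\<Sum>a\<in>A. Eh (\<xi> a))"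
proof (induction A rule: finite_induct)
  case (insert a A)
  then have "Eh (\<lambda>w. \<xi> a w + (\<Sum>a\<in>A. \<xi> a w)) \<le> Eh (\<xi> a) + Eh (\<lambda>w. \<Sum>a\<in>A. \<xi> a w)"
    by (intro Eh_add H_sum) auto
  with insert show ?case by simp
qed (simp add: Eh_const)

text \<open>The functionals considered below are the expectations that the sublinear one dominates;
  the sublinear expectation is itself one of them.\<close>

definition dom_exp :: "(('w \<Rightarrow> real) \<Rightarrow> real) \<Rightarrow> bool" where
  "dom_exp E \<longleftrightarrow> nonlinear_expectation H E \<and> dominated_by H E Eh"

lemma dom_exp_Eh: "dom_exp Eh"
proof -
  have "Eh \<xi> - Eh \<eta> \<le> Eh (\<lambda>w. \<xi> w - \<eta> w)" if "\<xi> \<in> H" "\<eta> \<in> H" for \<xi> \<eta>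
    using Eh_add[OF H_diff[OF that] that(2)] by simp
  then show ?thesis
    using sublin unfolding dom_exp_def sublinear_expectation_def dominated_by_def by blast
qed

lemma dom_exp_mono: "dom_exp E \<Longrightarrow> \<xi> \<in> H \<Longrightarrow> \<eta> \<in> H \<Longrightarrow> (\<And>w. \<xi> w \<le> \<eta> w) \<Longrightarrow> E \<xi> \<le> E \<eta>"
  and dom_exp_const: "dom_exp E \<Longrightarrow> E (\<lambda>w. c) = c"
  and dom_exp_le: "dom_exp E \<Longrightarrow> \<xi> \<in> H \<Longrightarrow> \<eta> \<in> H \<Longrightarrow> E \<xi> - E \<eta> \<le> Eh (\<lambda>w. \<xi> w - \<eta> w)"
  unfolding dom_exp_def nonlinear_expectation_def dominated_by_def by blast+

lemma dom_exp_lipschitz: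
  assumes "dom_exp E" "\<xi> \<in> H" "\<eta> \<in> H"
  shows "\<bar>E \<xi> - E \<eta>\<bar> \<le> norm (j \<xi> - j \<eta>)"
proof -
  have *: "E \<xi> - E \<eta> \<le> norm (j \<xi> - j \<eta>)" if "\<xi> \<in> H" "\<eta> \<in> H" for \<xi> \<eta>
  proof -
    have "E \<xi> - E \<eta> \<le> Eh (\<lambda>w. \<xi> w - \<eta> w)" using dom_exp_le assms(1) that by blast
    also have "\<dots> \<le> Eh (\<lambda>w. \<bar>\<xi> w - \<eta> w\<bar>)" by (intro Eh_mono H_diff H_abs that) auto
    also have "\<dots> = norm (j \<xi> - j \<eta>)" using norm_j[OF H_diff[OF that]] j_diff[OF that] by simp
    finally show ?thesis .
  qed
  show ?thesis using *[OF assms(2,3)] *[OF assms(3,2)] by (simp add: norm_minus_commute abs_le_iff)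
qed

text \<open>Both extensions by continuity can be computed along any approximating sequence in \<open>H\<close>.\<close>

lemma L1_exp_tendsto:
  assumes E: "dom_exp E" and \<xi>: "\<And>k. \<xi> k \<in> H" "(\<lambda>k. j (\<xi> k)) \<longlonglongrightarrow> z"
  shows "(\<lambda>k. E (\<xi> k)) \<longlonglongrightarrow> L1_exp H j E z"
proof -
  have "Cauchy (\<lambda>k. E (\<xi> k))"
  proof (rule metric_CauchyI)
    fix \<epsilon> :: real assume "\<epsilon> > 0"
    then obtain M where M: "\<forall>m\<ge>M. \<forall>n\<ge>M. dist (j (\<xi> m)) (j (\<xi> n)) < \<epsilon>"
      using LIMSEQ_imp_Cauchy[OF \<xi>(2)] unfolding Cauchy_def by blast
    then show "\<exists>M. \<forall>m\<ge>M. \<forall>n\<ge>M. dist (E (\<xi> m)) (E (\<xi> n)) < \<epsilon>"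
      using dom_exp_lipschitz[OF E \<xi>(1) \<xi>(1)] by (metis dist_norm le_less_trans real_norm_def)
  qed
  then obtain v where v: "(\<lambda>k. E (\<xi> k)) \<longlonglongrightarrow> v" using Cauchy_convergent convergent_def by blast
  have all: "(\<lambda>k. E (\<eta> k)) \<longlonglongrightarrow> v" if "\<forall>k. \<eta> k \<in> H" "(\<lambda>k. j (\<eta> k)) \<longlonglongrightarrow> z" for \<eta>
  proof -
    have "(\<lambda>k. norm (j (\<eta> k) - j (\<xi> k))) \<longlonglongrightarrow> 0"
      using tendsto_norm[OF tendsto_diff[OF that(2) \<xi>(2)]] by simp
    then have "(\<lambda>k. E (\<eta> k) - E (\<xi> k)) \<longlonglongrightarrow> 0"
      by (rule Lim_null_comparison[rotated]) (use that \<xi> dom_exp_lipschitz[OF E] in auto)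
    from tendsto_add[OF this v] show ?thesis by simp
  qed
  have "L1_exp H j E z = v"
    unfolding L1_exp_def using all \<xi> v by (intro the_equality) (blast intro: LIMSEQ_unique)+
  with v show ?thesis by simp
qed

text \<open>A sequence of families in \<open>H\<close> that converges in \<open>L1\<close> to the family \<open>Z\<close>, componentwise
  over \<open>I\<close>.\<close>

definition approximates :: "'i set \<Rightarrow> (nat \<Rightarrow> 'i \<Rightarrow> 'w \<Rightarrow> real) \<Rightarrow> ('i \<Rightarrow> 'l) \<Rightarrow> bool" where
  "approximates I \<xi> Z \<longleftrightarrow> (\<forall>k. \<forall>i\<in>I. \<xi> k i \<in> H) \<and> (\<forall>i\<in>I. (\<lambda>k. j (\<xi> k i)) \<longlonglongrightarrow> Z i)"

lemma j_bLip_lipschitz: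
  assumes "finite I" "\<And>x y. \<bar>\<phi> x - \<phi> y\<bar> \<le> L * (\<Sum>i\<in>I. \<bar>x i - y i\<bar>)" "L \<ge> 0" "bLip I \<phi>"
    "\<And>i. i \<in> I \<Longrightarrow> \<xi> i \<in> H" "\<And>i. i \<in> I \<Longrightarrow> \<eta> i \<in> H"
  shows "norm (j (\<lambda>w. \<phi> (\<lambda>i. \<xi> i w)) - j (\<lambda>w. \<phi> (\<lambda>i. \<eta> i w)))
      \<le> L * (\<Sum>i\<in>I. norm (j (\<xi> i) - j (\<eta> i)))"
proof -
  note h = H_bLip[OF assms(1,4)]
  have "norm (j (\<lambda>w. \<phi> (\<lambda>i. \<xi> i w)) - j (\<lambda>w. \<phi> (\<lambda>i. \<eta> i w)))
      = Eh (\<lambda>w. \<bar>\<phi> (\<lambda>i. \<xi> i w) - \<phi> (\<lambda>i. \<eta> i w)\<bar>)"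
    using assms(5,6) by (simp add: norm_j H_diff h flip: j_diff)
  also have "\<dots> \<le> Eh (\<lambda>w. L * (\<Sum>i\<in>I. \<bar>\<xi> i w - \<eta> i w\<bar>))"
    using assms by (intro Eh_mono H_abs H_diff h H_cmult H_sum) auto
  also have "\<dots> = L * Eh (\<lambda>w. \<Sum>i\<in>I. \<bar>\<xi> i w - \<eta> i w\<bar>)"
    using assms by (intro Eh_cmult H_sum H_abs H_diff) auto
  also have "\<dots> \<le> L * (\<Sum>i\<in>I. Eh (\<lambda>w. \<bar>\<xi> i w - \<eta> i w\<bar>))"
    using assms by (intro mult_left_mono Eh_sum H_abs H_diff) auto
  also have "\<dots> = L * (\<Sum>i\<in>I. norm (j (\<xi> i) - j (\<eta> i)))"
    using assms(5,6) by (auto intro!: arg_cong2[where f = "(*)"] sum.cong simp: norm_j H_diff simp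
        flip: j_diff)
  finally show ?thesis .
qed

lemma L1_blip_tendsto:
  assumes fin: "finite I" and \<phi>: "bLip I \<phi>" and \<xi>: "approximates I \<xi> Z"
  shows "(\<lambda>k. j (\<lambda>w. \<phi> (\<lambda>i. \<xi> k i w))) \<longlonglongrightarrow> L1_blip H j I \<phi> Z"
proof -
  obtain C L where "C \<ge> 0" "\<And>x. \<bar>\<phi> x\<bar> \<le> C"
      and L: "L \<ge> 0" "\<And>x y. \<bar>\<phi> x - \<phi> y\<bar> \<le> L * (\<Sum>i\<in>I. \<bar>x i - y i\<bar>)"
    by (rule bLipE[OF fin \<phi>]) (rule that)
  note lip = j_bLip_lipschitz[OF fin L(2,1) \<phi>]
  have \<xi>': "\<And>k i. i \<in> I \<Longrightarrow> \<xi> k i \<in> H" "\<And>i. i \<in> I \<Longrightarrow> (\<lambda>k. j (\<xi> k i)) \<longlonglongrightarrow> Z i"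
    using \<xi> unfolding approximates_def by auto
  let ?f = "\<lambda>\<xi> k. j (\<lambda>w. \<phi> (\<lambda>i. \<xi> k i w))"
  \<comment> \<open>Two subsequences of one sequence give the Cauchy property, two sequences the
    independence of the choice.\<close>
  have diff: "(\<lambda>(k::nat). ?f \<xi> (s k) - ?f \<eta> (t k)) \<longlonglongrightarrow> 0"
    if "approximates I \<eta> Z" "filterlim s at_top sequentially" "filterlim t at_top sequentially"
    for \<eta> and s t :: "nat \<Rightarrow> nat"
  proof -
    have \<eta>: "\<And>k i. i \<in> I \<Longrightarrow> \<eta> k i \<in> H" "\<And>i. i \<in> I \<Longrightarrow> (\<lambda>k. j (\<eta> k i)) \<longlonglongrightarrow> Z i"
      using that unfolding approximates_def by auto
    have "(\<lambda>k. L * (\<Sum>i\<in>I. norm (j (\<xi> (s k) i) - j (\<eta> (t k) i)))) \<longlonglongrightarrow> L * (\<Sum>i\<in>I. norm (Z i - Z i))"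
      by (intro tendsto_intros filterlim_compose[OF \<xi>'(2) that(2)]
          filterlim_compose[OF \<eta>(2) that(3)])
    then have "(\<lambda>k. L * (\<Sum>i\<in>I. norm (j (\<xi> (s k) i) - j (\<eta> (t k) i)))) \<longlonglongrightarrow> 0" by simp
    then show ?thesis
      by (rule Lim_null_comparison[rotated]) (intro always_eventually allI lip \<xi>' \<eta>)
  qed
  have "Cauchy (?f \<xi>)"
  proof (rule ccontr)
    assume "\<not> Cauchy (?f \<xi>)"
    then obtain \<epsilon> where e: "\<epsilon> > 0" "\<And>M. \<exists>m\<ge>M. \<exists>n\<ge>M. dist (?f \<xi> m) (?f \<xi> n) \<ge> \<epsilon>"
      unfolding Cauchy_def by (meson not_le)
    then obtain s t where st: "\<And>M. s M \<ge> M" "\<And>M. t M \<ge> M" "\<And>M. dist (?f \<xi> (s M)) (?f \<xi> (t M)) \<ge> \<epsilon>"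
      by metis
    have "filterlim s at_top sequentially" "filterlim t at_top sequentially"
      by (rule filterlim_at_top_mono[OF filterlim_ident], use st(1,2) in simp)+
    from diff[OF \<xi> this] have "(\<lambda>k. dist (?f \<xi> (s k)) (?f \<xi> (t k))) \<longlonglongrightarrow> 0"
      by (simp add: dist_norm tendsto_norm_zero)
    then have "\<forall>\<^sub>F k in sequentially. dist (?f \<xi> (s k)) (?f \<xi> (t k)) < \<epsilon>"
      using e(1) order_tendstoD(2) by blast
    then show False using st(3) by (auto simp: eventually_sequentially not_less[symmetric])
  qed
  then obtain y where y: "?f \<xi> \<longlonglongrightarrow> y" using Cauchy_convergent convergent_def by blast
  have all: "?f \<eta> \<longlonglongrightarrow> y" if "approximates I \<eta> Z" for \<eta>
    using tendsto_diff[OF y diff[OF that filterlim_ident filterlim_ident]] by simp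
  have "L1_blip H j I \<phi> Z = y"
    unfolding L1_blip_def
  proof (rule the_equality)
    show "\<forall>\<xi>. (\<forall>k. \<forall>i\<in>I. \<xi> k i \<in> H) \<and> (\<forall>i\<in>I. (\<lambda>k. j (\<xi> k i)) \<longlonglongrightarrow> Z i) \<longrightarrow> ?f \<xi> \<longlonglongrightarrow> y"
      using all unfolding approximates_def by blast
    fix y' assume "\<forall>\<xi>. (\<forall>k. \<forall>i\<in>I. \<xi> k i \<in> H) \<and> (\<forall>i\<in>I. (\<lambda>k. j (\<xi> k i)) \<longlonglongrightarrow> Z i) \<longrightarrow> ?f \<xi> \<longlonglongrightarrow> y'"
    then have "?f \<xi> \<longlonglongrightarrow> y'" using \<xi> unfolding approximates_def by blast
    then show "y' = y" using y LIMSEQ_unique by blast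
  qed
  with y show ?thesis by simp
qed

text \<open>A finite family of elements of \<open>L1\<close>.\<close>

definition L1_family :: "'i set \<Rightarrow> ('i \<Rightarrow> 'l) \<Rightarrow> bool" where
  "L1_family I Z \<longleftrightarrow> finite I \<and> (\<forall>i\<in>I. Z i \<in> L1 H j)"

lemma L1_family_finite: "L1_family I Z \<Longrightarrow> finite I"
  by (simp add: L1_family_def)

lemma approximates_exists:
  assumes "L1_family I Z"
  obtains \<xi> where "approximates I \<xi> Z"
proof -
  have "\<exists>\<xi>. (\<forall>k. \<xi> k \<in> H) \<and> (\<lambda>k. j (\<xi> k)) \<longlonglongrightarrow> Z i" if "i \<in> I" for i
  proof -
    have "Z i \<in> closure (j ` H)" using assms that unfolding L1_family_def L1_def by blast
    then obtain u where "\<forall>k. u k \<in> j ` H" "u \<longlonglongrightarrow> Z i" unfolding closure_sequential by blast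
    moreover from this obtain \<xi> where \<xi>: "\<forall>k. \<xi> k \<in> H \<and> u k = j (\<xi> k)"
      unfolding image_iff by metis
    then have "u = (\<lambda>k. j (\<xi> k))" by blast
    ultimately show ?thesis using \<xi> by blast
  qed
  then obtain \<xi> where "\<And>i. i \<in> I \<Longrightarrow> (\<forall>k. \<xi> i k \<in> H) \<and> (\<lambda>k. j (\<xi> i k)) \<longlonglongrightarrow> Z i" by metis
  then have "approximates I (\<lambda>k i. \<xi> i k) Z" unfolding approximates_def by blast
  then show ?thesis using that by blast
qed

lemma L1_blip_in_L1:
  assumes "L1_family I Z" "bLip I \<phi>"
  shows "L1_blip H j I \<phi> Z \<in> L1 H j"
proof -
  obtain \<xi> where \<xi>: "approximates I \<xi> Z" using approximates_exists[OF assms(1)] .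
  note fin = L1_family_finite[OF assms(1)]
  show ?thesis unfolding L1_def closure_sequential
    using L1_blip_tendsto[OF fin assms(2) \<xi>] H_bLip[OF fin assms(2)] \<xi>
    unfolding approximates_def by (intro exI[of _ "\<lambda>k. j (\<lambda>w. \<phi> (\<lambda>i. \<xi> k i w))"]) auto
qed

text \<open>The distribution of the family \<open>Z\<close> under \<open>E\<close>, as a functional on the bounded Lipschitz
  functions.\<close>

definition law :: "(('w \<Rightarrow> real) \<Rightarrow> real) \<Rightarrow> 'i set \<Rightarrow> ('i \<Rightarrow> 'l) \<Rightarrow> (('i \<Rightarrow> real) \<Rightarrow> real) \<Rightarrow> real" where
  "law E I Z \<phi> = L1_exp H j E (L1_blip H j I \<phi> Z)"

lemma law_tendsto:
  assumes "dom_exp E" "finite I" "bLip I \<phi>" "approximates I \<xi> Z"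
  shows "(\<lambda>k. E (\<lambda>w. \<phi> (\<lambda>i. \<xi> k i w))) \<longlonglongrightarrow> law E I Z \<phi>"
  unfolding law_def
  by (rule L1_exp_tendsto[OF assms(1) _ L1_blip_tendsto[OF assms(2-4)]])
    (use assms(4) in \<open>auto simp: approximates_def intro!: H_bLip[OF assms(2,3)]\<close>)

lemma L1_exp_lipschitz:
  assumes "dom_exp E" "z \<in> L1 H j" "y \<in> L1 H j"
  shows "\<bar>L1_exp H j E z - L1_exp H j E y\<bar> \<le> norm (z - y)"
proof -
  have "L1_family {True, False} (\<lambda>b. if b then z else y)"
    using assms by (simp add: L1_family_def)
  then obtain \<xi> where \<xi>: "approximates {True, False} \<xi> (\<lambda>b. if b then z else y)"
    by (rule approximates_exists)
  then have h: "\<And>k. \<xi> k True \<in> H" "\<And>k. \<xi> k False \<in> H" "(\<lambda>k. j (\<xi> k True)) \<longlonglongrightarrow> z"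
      "(\<lambda>k. j (\<xi> k False)) \<longlonglongrightarrow> y"
    unfolding approximates_def by (auto dest: bspec)
  show ?thesis
    by (rule LIMSEQ_le[OF tendsto_rabs[OF tendsto_diff[OF L1_exp_tendsto[OF assms(1) h(1,3)]
          L1_exp_tendsto[OF assms(1) h(2,4)]]] tendsto_norm[OF tendsto_diff[OF h(3,4)]]])
      (auto intro!: dom_exp_lipschitz[OF assms(1)] h)
qed

lemma L1_exp_cont:
  assumes "dom_exp E" "\<And>k. u k \<in> L1 H j" "u \<longlonglongrightarrow> z"
  shows "(\<lambda>k. L1_exp H j E (u k)) \<longlonglongrightarrow> L1_exp H j E z"
proof -
  have z: "z \<in> L1 H j" using assms(2,3) unfolding L1_def
    by (meson closed_closure closed_sequentially)
  have "(\<lambda>k. norm (u k - z)) \<longlonglongrightarrow> 0" using assms(3) by (simp add: LIM_zero tendsto_norm_zero)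
  then have "(\<lambda>k. L1_exp H j E (u k) - L1_exp H j E z) \<longlonglongrightarrow> 0"
    by (rule Lim_null_comparison[rotated]) (auto intro!: always_eventually L1_exp_lipschitz assms z)
  then show ?thesis by (rule LIM_zero_cancel)
qed

context
  fixes I :: "'i set" and Z :: "'i \<Rightarrow> 'l"
  assumes fam: "L1_family I Z"
begin

lemma fin_I: "finite I" using fam by (rule L1_family_finite)

lemma H_comp:
  assumes "approximates I \<xi> Z" "bLip I \<phi>"
  shows "(\<lambda>w. \<phi> (\<lambda>i. \<xi> k i w)) \<in> H"
  using assms(1) by (intro H_bLip[OF fin_I assms(2), of "\<xi> k"]) (simp add: approximates_def)

lemma L1_blip_add:
  assumes "bLip I \<phi>" "bLip I \<psi>"
  shows "L1_blip H j I (\<lambda>x. \<phi> x + \<psi> x) Z = L1_blip H j I \<phi> Z + L1_blip H j I \<psi> Z"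
proof -
  obtain \<xi> where \<xi>: "approximates I \<xi> Z" using approximates_exists[OF fam] .
  note t = L1_blip_tendsto[OF fin_I _ \<xi>]
  have "(\<lambda>k. j (\<lambda>w. \<phi> (\<lambda>i. \<xi> k i w) + \<psi> (\<lambda>i. \<xi> k i w))) \<longlonglongrightarrow> L1_blip H j I \<phi> Z + L1_blip H j I \<psi> Z"
    using tendsto_add[OF t[OF assms(1)] t[OF assms(2)]]
    by (simp add: j_add H_comp[OF \<xi> assms(1)] H_comp[OF \<xi> assms(2)])
  with t[OF bLip_add[OF fin_I assms]] show ?thesis using LIMSEQ_unique by blast
qed

lemma L1_blip_cmult:
  assumes "bLip I \<phi>"
  shows "L1_blip H j I (\<lambda>x. c * \<phi> x) Z = c *\<^sub>R L1_blip H j I \<phi> Z"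
proof -
  obtain \<xi> where \<xi>: "approximates I \<xi> Z" using approximates_exists[OF fam] .
  note t = L1_blip_tendsto[OF fin_I _ \<xi>]
  have "(\<lambda>k. j (\<lambda>w. c * \<phi> (\<lambda>i. \<xi> k i w))) \<longlonglongrightarrow> c *\<^sub>R L1_blip H j I \<phi> Z"
    using tendsto_scaleR[OF tendsto_const t[OF assms(1)]]
    by (simp add: j_cmult H_comp[OF \<xi> assms(1)])
  with t[OF bLip_cmult[OF fin_I assms]] show ?thesis using LIMSEQ_unique by blast
qed

lemma L1_blip_diff:
  assumes "bLip I \<phi>" "bLip I \<psi>"
  shows "L1_blip H j I (\<lambda>x. \<phi> x - \<psi> x) Z = L1_blip H j I \<phi> Z - L1_blip H j I \<psi> Z"
  using L1_blip_add[OF assms(1) bLip_cmult[OF fin_I assms(2), of "-1"]] L1_blip_cmult[OF assms(2),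
      of "-1"]
  by simp

lemma norm_L1_blip:
  assumes "bLip I \<phi>"
  shows "norm (L1_blip H j I \<phi> Z) = law Eh I Z (\<lambda>x. \<bar>\<phi> x\<bar>)"
proof -
  obtain \<xi> where \<xi>: "approximates I \<xi> Z" using approximates_exists[OF fam] .
  have "(\<lambda>k. norm (j (\<lambda>w. \<phi> (\<lambda>i. \<xi> k i w)))) \<longlonglongrightarrow> norm (L1_blip H j I \<phi> Z)"
    by (intro tendsto_norm L1_blip_tendsto fin_I assms \<xi>)
  then have "(\<lambda>k. Eh (\<lambda>w. \<bar>\<phi> (\<lambda>i. \<xi> k i w)\<bar>)) \<longlonglongrightarrow> norm (L1_blip H j I \<phi> Z)"
    by (simp add: norm_j H_comp[OF \<xi> assms])
  with law_tendsto[OF dom_exp_Eh fin_I bLip_abs[OF fin_I assms] \<xi>] show ?thesis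
    using LIMSEQ_unique by blast
qed

lemma law_mono:
  assumes "dom_exp E" "bLip I \<phi>" "bLip I \<psi>" "\<And>x. \<phi> x \<le> \<psi> x"
  shows "law E I Z \<phi> \<le> law E I Z \<psi>"
proof -
  obtain \<xi> where \<xi>: "approximates I \<xi> Z" using approximates_exists[OF fam] .
  note t = law_tendsto[OF assms(1) fin_I _ \<xi>]
  show ?thesis
    by (rule LIMSEQ_le[OF t[OF assms(2)] t[OF assms(3)]])
      (intro exI allI impI dom_exp_mono[OF assms(1)] H_comp[OF \<xi> assms(2)] H_comp[OF \<xi> assms(3)]
          assms(4))
qed

lemma law_diff_le:
  assumes "dom_exp E" "bLip I \<phi>" "bLip I \<psi>"
  shows "law E I Z \<phi> - law E I Z \<psi> \<le> law Eh I Z (\<lambda>x. \<phi> x - \<psi> x)"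
proof -
  obtain \<xi> where \<xi>: "approximates I \<xi> Z" using approximates_exists[OF fam] .
  note t = law_tendsto[OF assms(1) fin_I _ \<xi>]
  show ?thesis
    by (rule LIMSEQ_le[OF tendsto_diff[OF t[OF assms(2)] t[OF assms(3)]]
         law_tendsto[OF dom_exp_Eh fin_I bLip_diff[OF fin_I assms(2,3)] \<xi>]])
      (intro exI allI impI dom_exp_le[OF assms(1)] H_comp[OF \<xi> assms(2)] H_comp[OF \<xi> assms(3)])
qed

lemma law_add_le:
  assumes "bLip I \<phi>" "bLip I \<psi>"
  shows "law Eh I Z (\<lambda>x. \<phi> x + \<psi> x) \<le> law Eh I Z \<phi> + law Eh I Z \<psi>"
  using law_diff_le[OF dom_exp_Eh bLip_add[OF fin_I assms] assms(2)] by simp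

lemma law_cmult:
  assumes "bLip I \<phi>" "c \<ge> 0"
  shows "law Eh I Z (\<lambda>x. c * \<phi> x) = c * law Eh I Z \<phi>"
proof -
  obtain \<xi> where \<xi>: "approximates I \<xi> Z" using approximates_exists[OF fam] .
  note t = law_tendsto[OF dom_exp_Eh fin_I _ \<xi>]
  have "(\<lambda>k. Eh (\<lambda>w. c * \<phi> (\<lambda>i. \<xi> k i w))) \<longlonglongrightarrow> c * law Eh I Z \<phi>"
    using tendsto_mult[OF tendsto_const t[OF assms(1)]]
    by (simp add: Eh_cmult H_comp[OF \<xi> assms(1)] assms(2))
  with t[OF bLip_cmult[OF fin_I assms(1)]] show ?thesis using LIMSEQ_unique by blast
qed

lemma law_const:
  assumes "dom_exp E"
  shows "law E I Z (\<lambda>x. c) = c"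
proof -
  obtain \<xi> where \<xi>: "approximates I \<xi> Z" using approximates_exists[OF fam] .
  from law_tendsto[OF assms fin_I bLip_const[OF fin_I] \<xi>, of c] show ?thesis
    by (simp add: dom_exp_const[OF assms] LIMSEQ_const_iff)
qed

lemma norm_L1_blip_le:
  assumes "bLip I \<phi>" "bLip I \<psi>" "\<And>x. \<bar>\<phi> x\<bar> \<le> \<psi> x"
  shows "norm (L1_blip H j I \<phi> Z) \<le> law Eh I Z \<psi>"
  unfolding norm_L1_blip[OF assms(1)]
  by (intro law_mono dom_exp_Eh bLip_abs fin_I assms)

end

text \<open>A change of variables: functions of partial sums of a family are functions of the family.
  With a single summand this is a mere re-indexing.\<close>

lemma L1_blip_sums:
  fixes I :: "'i set" and g :: "'m \<Rightarrow> 'c \<Rightarrow> 'i"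
  assumes "L1_family I Z" "finite J" "bLip J \<phi>" "\<And>m c. m \<in> A \<Longrightarrow> c \<in> J \<Longrightarrow> g m c \<in> I"
  shows "L1_blip H j J \<phi> (\<lambda>c. \<Sum>m\<in>A. Z (g m c)) = L1_blip H j I (\<lambda>x. \<phi> (\<lambda>c. \<Sum>m\<in>A. x (g m c))) Z"
    and "bLip I (\<lambda>x. \<phi> (\<lambda>c. \<Sum>m\<in>A. x (g m c)))"
proof -
  note fin = L1_family_finite[OF assms(1)]
  have le: "\<bar>x (g m c) - y (g m c)\<bar> \<le> (\<Sum>i\<in>I. \<bar>x i - y i\<bar>)" if "m \<in> A" "c \<in> J" for x y :: "'i \<Rightarrow> real"
      and m c
    by (rule member_le_sum[where f = "\<lambda>i. \<bar>x i - y i\<bar>"]) (auto simp: assms that fin)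
  show b: "bLip I (\<lambda>x. \<phi> (\<lambda>c. \<Sum>m\<in>A. x (g m c)))"
  proof (rule bLip_pre[OF fin assms(2,3)])
    fix x y :: "'i \<Rightarrow> real" and c assume c: "c \<in> J"
    have "\<bar>(\<Sum>m\<in>A. x (g m c)) - (\<Sum>m\<in>A. y (g m c))\<bar> \<le> (\<Sum>m\<in>A. \<bar>x (g m c) - y (g m c)\<bar>)"
      unfolding sum_subtractf[symmetric] by (rule sum_abs)
    also have "\<dots> \<le> card A * (\<Sum>i\<in>I. \<bar>x i - y i\<bar>)"
      by (intro sum_bounded_above le c)
    finally show "\<bar>(\<Sum>m\<in>A. x (g m c)) - (\<Sum>m\<in>A. y (g m c))\<bar> \<le> real (card A) * (\<Sum>i\<in>I. \<bar>x i - y i\<bar>)" .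
  qed
  obtain \<xi> where \<xi>: "approximates I \<xi> Z" using approximates_exists[OF assms(1)] .
  have "approximates J (\<lambda>k c w. \<Sum>m\<in>A. \<xi> k (g m c) w) (\<lambda>c. \<Sum>m\<in>A. Z (g m c))"
    unfolding approximates_def
  proof (intro conjI allI ballI)
    fix k c assume c: "c \<in> J"
    show "(\<lambda>w. \<Sum>m\<in>A. \<xi> k (g m c) w) \<in> H"
      using \<xi> assms(4) c by (auto simp: approximates_def intro!: H_sum)
    have "(\<lambda>k. \<Sum>m\<in>A. j (\<xi> k (g m c))) \<longlonglongrightarrow> (\<Sum>m\<in>A. Z (g m c))"
      using \<xi> assms(4) c by (intro tendsto_sum) (auto simp: approximates_def)
    moreover have "j (\<lambda>w. \<Sum>m\<in>A. \<xi> k (g m c) w) = (\<Sum>m\<in>A. j (\<xi> k (g m c)))" for k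
      using \<xi> assms(4) c by (intro j_sum) (auto simp: approximates_def)
    ultimately show "(\<lambda>k. j (\<lambda>w. \<Sum>m\<in>A. \<xi> k (g m c) w)) \<longlonglongrightarrow> (\<Sum>m\<in>A. Z (g m c))" by simp
  qed
  from L1_blip_tendsto[OF assms(2,3) this] L1_blip_tendsto[OF fin b \<xi>]
  show "L1_blip H j J \<phi> (\<lambda>c. \<Sum>m\<in>A. Z (g m c)) = L1_blip H j I (\<lambda>x. \<phi> (\<lambda>c. \<Sum>m\<in>A. x (g m c))) Z"
    using LIMSEQ_unique by blast
qed

end

section \<open>Truncation and functions of controlled growth\<close>

lemma abs_trunc_le: "\<bar>trunc M t\<bar> \<le> real M"
  and abs_trunc_le_abs: "\<bar>trunc M t\<bar> \<le> \<bar>t\<bar>"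
  and trunc_id: "\<bar>t\<bar> \<le> real M \<Longrightarrow> trunc M t = t"
  and abs_trunc_large: "\<bar>t\<bar> \<ge> real M \<Longrightarrow> \<bar>trunc M t\<bar> = real M"
  and trunc_lipschitz: "\<bar>trunc M s - trunc M t\<bar> \<le> \<bar>s - t\<bar>"
  and abs_trunc_mono: "M \<le> K \<Longrightarrow> \<bar>trunc M t\<bar> \<le> \<bar>trunc K t\<bar>"
  and trunc_trunc: "M \<le> K \<Longrightarrow> trunc K (trunc M t) = trunc M t"
  unfolding trunc_def by linarith+

text \<open>Truncation of each coordinate.\<close>

definition truncv :: "nat \<Rightarrow> ('i \<Rightarrow> real) \<Rightarrow> 'i \<Rightarrow> real" where
  "truncv M x = (\<lambda>i. trunc M (x i))"

text \<open>The reference function that controls growth. The exponent depends on the coordinate: below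
  it is 2 for the components of \<open>X\<close> and 1 for those of \<open>Y\<close>.\<close>

definition growth :: "'i set \<Rightarrow> ('i \<Rightarrow> nat) \<Rightarrow> ('i \<Rightarrow> real) \<Rightarrow> real" where
  "growth I e x = (\<Sum>i\<in>I. \<bar>x i\<bar> ^ e i)"

lemma growth_nonneg: "0 \<le> growth I e x"
  unfolding growth_def by (intro sum_nonneg) auto

lemma growth_truncv_le: "growth I e (truncv M x) \<le> growth I e x"
  unfolding growth_def truncv_def by (intro sum_mono power_mono abs_trunc_le_abs) auto

lemma growth_member: "finite I \<Longrightarrow> i \<in> I \<Longrightarrow> \<bar>x i\<bar> ^ e i \<le> growth I e x"
  unfolding growth_def by (rule member_le_sum[where f = "\<lambda>i. \<bar>x i\<bar> ^ e i"]) auto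

lemma growth_cong: "(\<And>i. i \<in> I \<Longrightarrow> x i = y i) \<Longrightarrow> growth I e x = growth I e y"
  unfolding growth_def by simp

lemma bLip_trunc_coord:
  assumes "finite I" "i \<in> I"
  shows "bLip I (\<lambda>x. trunc M (x i))"
proof (rule bLipI[OF assms(1), of _ "real M" 1])
  fix x y :: "'a \<Rightarrow> real"
  have "\<bar>x i - y i\<bar> \<le> (\<Sum>i\<in>I. \<bar>x i - y i\<bar>)"
    by (rule member_le_sum[where f = "\<lambda>i. \<bar>x i - y i\<bar>"]) (auto simp: assms)
  then show "\<bar>trunc M (x i) - trunc M (y i)\<bar> \<le> 1 * (\<Sum>i\<in>I. \<bar>x i - y i\<bar>)"
    using trunc_lipschitz[of M "x i" "y i"] by linarith
qed (rule abs_trunc_le)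

lemma bLip_growth: "finite I \<Longrightarrow> bLip I (\<lambda>x. growth I e (truncv M x))"
  unfolding growth_def truncv_def by (intro bLip_sum bLip_power bLip_abs bLip_trunc_coord)

text \<open>The class to which expectations are extended. Bounded Lipschitz continuity of all
  truncations is a convenient form of local Lipschitz continuity. If the
  index type is infinite, it does not force \<open>\<phi>\<close> itself to depend only on the coordinates in
  \<open>I\<close>, since a point that is unbounded outside \<open>I\<close> is not fixed by any truncation; this is
  harmless because only the truncations of \<open>\<phi>\<close> enter.\<close>

definition tame :: "'i set \<Rightarrow> ('i \<Rightarrow> nat) \<Rightarrow> (('i \<Rightarrow> real) \<Rightarrow> real) \<Rightarrow> bool" where
  "tame I e \<phi> \<longleftrightarrow> (\<forall>M. bLip I (\<lambda>x. \<phi> (truncv M x))) \<and> (\<exists>C. \<forall>x. \<bar>\<phi> x\<bar> \<le> C * (1 + growth I e x))"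

lemma tameI:
  assumes "\<And>M. bLip I (\<lambda>x. \<phi> (truncv M x))" "\<And>x. \<bar>\<phi> x\<bar> \<le> C * (1 + growth I e x)"
  shows "tame I e \<phi>"
  using assms unfolding tame_def by blast

lemma tame_bLip: "tame I e \<phi> \<Longrightarrow> bLip I (\<lambda>x. \<phi> (truncv M x))"
  unfolding tame_def by blast

lemma tame_bound:
  assumes "tame I e \<phi>"
  obtains C where "C > 0" "\<And>x. \<bar>\<phi> x\<bar> \<le> C * (1 + growth I e x)"
proof -
  obtain C where C: "\<And>x. \<bar>\<phi> x\<bar> \<le> C * (1 + growth I e x)" using assms unfolding tame_def by blast
  have "\<bar>\<phi> x\<bar> \<le> (\<bar>C\<bar> + 1) * (1 + growth I e x)" for x
    by (rule order_trans[OF C]) (intro mult_right_mono, use growth_nonneg[of I e x] in auto)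
  then show ?thesis using that[of "\<bar>C\<bar> + 1"] by auto
qed

lemma tame_const: "finite I \<Longrightarrow> tame I e (\<lambda>x. c)"
  by (rule tameI[of _ _ "\<bar>c\<bar>"]) (auto simp: bLip_const growth_nonneg algebra_simps)

lemma tame_add:
  assumes "finite I" "tame I e \<phi>" "tame I e \<psi>"
  shows "tame I e (\<lambda>x. \<phi> x + \<psi> x)"
proof -
  obtain C where C: "C > 0" "\<And>x. \<bar>\<phi> x\<bar> \<le> C * (1 + growth I e x)"
    by (rule tame_bound[OF assms(2)]) (rule that)
  obtain D where D: "D > 0" "\<And>x. \<bar>\<psi> x\<bar> \<le> D * (1 + growth I e x)"
    by (rule tame_bound[OF assms(3)]) (rule that)
  show ?thesis
  proof (rule tameI[of _ _ "C + D"])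
    show "\<bar>\<phi> x + \<psi> x\<bar> \<le> (C + D) * (1 + growth I e x)" for x
      using C(2)[of x] D(2)[of x] unfolding distrib_right[of C D] by linarith
  qed (intro bLip_add assms(1) tame_bLip[OF assms(2)] tame_bLip[OF assms(3)])
qed

lemma tame_lip:
  fixes F :: "real \<Rightarrow> real"
  assumes "finite I" "tame I e \<phi>" "\<And>s t. \<bar>F s - F t\<bar> \<le> K * \<bar>s - t\<bar>"
  shows "tame I e (\<lambda>x. F (\<phi> x))"
proof -
  obtain C where C: "C > 0" "\<And>x. \<bar>\<phi> x\<bar> \<le> C * (1 + growth I e x)"
    by (rule tame_bound[OF assms(2)]) (rule that)
  show ?thesis
  proof (rule tameI[of _ _ "\<bar>F 0\<bar> + \<bar>K\<bar> * C"])
    show "bLip I (\<lambda>x. F (\<phi> (truncv M x)))" for M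
      by (rule bLip_lip[OF assms(1) tame_bLip[OF assms(2)] assms(3)])
    fix x
    have "\<bar>F (\<phi> x)\<bar> \<le> \<bar>F 0\<bar> + K * \<bar>\<phi> x\<bar>" using assms(3)[of "\<phi> x" 0] by simp
    also have "\<dots> \<le> \<bar>F 0\<bar> * (1 + growth I e x) + \<bar>K\<bar> * (C * (1 + growth I e x))"
      using growth_nonneg[of I e x] C(2)[of x]
      by (intro add_mono mult_mono) (auto simp: algebra_simps)
    finally show "\<bar>F (\<phi> x)\<bar> \<le> (\<bar>F 0\<bar> + \<bar>K\<bar> * C) * (1 + growth I e x)"
      by (simp add: algebra_simps)
  qed
qed

lemma tame_cmult: "finite I \<Longrightarrow> tame I e \<phi> \<Longrightarrow> tame I e (\<lambda>x. c * \<phi> x)"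
  by (rule tame_lip[where F = "\<lambda>t. c * t" and K = "\<bar>c\<bar>"]) (auto simp flip: right_diff_distrib
      abs_mult)

lemma tame_diff: "finite I \<Longrightarrow> tame I e \<phi> \<Longrightarrow> tame I e \<psi> \<Longrightarrow> tame I e (\<lambda>x. \<phi> x - \<psi> x)"
  using tame_add[of I e \<phi> "\<lambda>x. -1 * \<psi> x"] tame_cmult[of I e \<psi> "-1"] by simp

lemma tame_sum:
  assumes "finite I" "\<And>a. a \<in> A \<Longrightarrow> tame I e (\<phi> a)"
  shows "tame I e (\<lambda>x. \<Sum>a\<in>A. \<phi> a x)"
  using assms(2)
  by (induction A rule: infinite_finite_induct) (simp_all add: assms(1) tame_const tame_add)

lemma tame_pospart: "finite I \<Longrightarrow> tame I e \<phi> \<Longrightarrow> tame I e (\<lambda>x. max (\<phi> x) 0)"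
  by (rule tame_lip[where F = "\<lambda>t. max t 0" and K = 1]) auto

lemma tame_growth: "finite I \<Longrightarrow> tame I e (growth I e)"
  by (rule tameI[of _ _ 1]) (auto simp: bLip_growth growth_nonneg)

lemma tame_coord:
  assumes "finite I" "i \<in> I" "e i \<ge> 1"
  shows "tame I e (\<lambda>x. x i)"
proof (rule tameI[of _ _ 1])
  show "bLip I (\<lambda>x. truncv M x i)" for M unfolding truncv_def
    by (rule bLip_trunc_coord[OF assms(1,2)])
  fix x :: "'a \<Rightarrow> real"
  have "\<bar>x i\<bar> \<le> 1 + \<bar>x i\<bar> ^ e i"
  proof (cases "\<bar>x i\<bar> \<le> 1")
    case False
    then show ?thesis using power_increasing[OF assms(3), of "\<bar>x i\<bar>"] by simp
  qed (use zero_le_power[of "\<bar>x i\<bar>" "e i"] in linarith)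
  also have "\<dots> \<le> 1 + growth I e x" using growth_member[OF assms(1,2)] by simp
  finally show "\<bar>x i\<bar> \<le> 1 * (1 + growth I e x)" by simp
qed

lemma tame_coord_prod:
  assumes "finite I" "i \<in> I" "k \<in> I" "e i = 2" "e k = 2"
  shows "tame I e (\<lambda>x. x i * x k)"
proof (rule tameI[of _ _ 1])
  show "bLip I (\<lambda>x. truncv M x i * truncv M x k)" for M
    unfolding truncv_def by (intro bLip_mult bLip_trunc_coord assms)
  fix x :: "'a \<Rightarrow> real"
  have "2 * (\<bar>x i\<bar> * \<bar>x k\<bar>) \<le> \<bar>x i\<bar>\<^sup>2 + \<bar>x k\<bar>\<^sup>2"
    using sum_squares_bound[of "\<bar>x i\<bar>" "\<bar>x k\<bar>"] by simp
  then show "\<bar>x i * x k\<bar> \<le> 1 * (1 + growth I e x)"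
    using growth_member[OF assms(1,2), of x e] growth_member[OF assms(1,3), of x e] assms
    unfolding abs_mult by simp
qed

lemma abs_sum_power_le:
  fixes a :: "'m \<Rightarrow> real"
  assumes "finite A" "p \<ge> 1"
  shows "\<bar>\<Sum>m\<in>A. a m\<bar> ^ p \<le> real (card A) ^ p * (\<Sum>m\<in>A. \<bar>a m\<bar> ^ p)"
proof (cases "A = {}")
  case False
  define B where "B = Max ((\<lambda>m. \<bar>a m\<bar>) ` A)"
  have "B \<in> (\<lambda>m. \<bar>a m\<bar>) ` A" unfolding B_def using assms False by (intro Max_in) auto
  then obtain k where k: "k \<in> A" "B = \<bar>a k\<bar>" by blast
  have "\<bar>\<Sum>m\<in>A. a m\<bar> \<le> (\<Sum>m\<in>A. \<bar>a m\<bar>)" by (rule sum_abs)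
  also have "\<dots> \<le> card A * B" unfolding B_def using assms by (intro sum_bounded_above Max_ge) auto
  finally have "\<bar>\<Sum>m\<in>A. a m\<bar> ^ p \<le> (card A * B) ^ p" by (intro power_mono) auto
  also have "\<dots> = card A ^ p * \<bar>a k\<bar> ^ p" by (simp add: power_mult_distrib k)
  also have "\<dots> \<le> card A ^ p * (\<Sum>m\<in>A. \<bar>a m\<bar> ^ p)"
    using assms k by (intro mult_left_mono member_le_sum) auto
  finally show ?thesis by simp
qed (use assms in \<open>simp add: power_0_left\<close>)

lemma growth_sums_le:
  assumes "finite I" "finite J" "finite A"
    and g: "\<And>m c. m \<in> A \<Longrightarrow> c \<in> J \<Longrightarrow> g m c \<in> I"
    and e: "\<And>m c. m \<in> A \<Longrightarrow> c \<in> J \<Longrightarrow> e (g m c) = e' c" "\<And>c. c \<in> J \<Longrightarrow> e' c \<ge> 1"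
  shows "\<exists>C\<ge>0. \<forall>x. growth J e' (\<lambda>c. \<Sum>m\<in>A. x (g m c)) \<le> C * growth I e x"
proof -
  define C where "C = (\<Sum>c\<in>J. real (card A) ^ e' c * real (card A))"
  have "C \<ge> 0" unfolding C_def by (intro sum_nonneg) auto
  moreover have "growth J e' (\<lambda>c. \<Sum>m\<in>A. x (g m c)) \<le> C * growth I e x" for x
    unfolding growth_def[of J] C_def sum_distrib_right
  proof (rule sum_mono)
    fix c assume c: "c \<in> J"
    have "\<bar>\<Sum>m\<in>A. x (g m c)\<bar> ^ e' c \<le> real (card A) ^ e' c * (\<Sum>m\<in>A. \<bar>x (g m c)\<bar> ^ e' c)"
      by (rule abs_sum_power_le[OF assms(3) e(2)[OF c]])
    also have "(\<Sum>m\<in>A. \<bar>x (g m c)\<bar> ^ e' c) \<le> card A * growth I e x"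
    proof (rule sum_bounded_above)
      fix m assume m: "m \<in> A"
      show "\<bar>x (g m c)\<bar> ^ e' c \<le> growth I e x"
        using growth_member[OF assms(1) g[OF m c], of x e] e(1)[OF m c] by simp
    qed
    finally show "\<bar>\<Sum>m\<in>A. x (g m c)\<bar> ^ e' c \<le> real (card A) ^ e' c * real (card A) * growth I e x"
      by (simp add: mult_left_mono mult.assoc)
  qed
  ultimately show ?thesis by blast
qed

lemma truncv_id: "(\<And>i. \<bar>x i\<bar> \<le> real M) \<Longrightarrow> truncv M x = x"
  unfolding truncv_def by (intro ext trunc_id)

lemma abs_sum_truncv_le: "\<bar>\<Sum>m\<in>A. truncv M x (g m)\<bar> \<le> real (card A * M)"
proof -
  have "\<bar>\<Sum>m\<in>A. truncv M x (g m)\<bar> \<le> (\<Sum>m\<in>A. \<bar>truncv M x (g m)\<bar>)" by (rule sum_abs)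
  also have "\<dots> \<le> card A * real M" unfolding truncv_def by (intro sum_bounded_above abs_trunc_le)
  finally show ?thesis by simp
qed

lemma tame_sums:
  assumes "finite I" "finite J" "finite A"
    and g: "\<And>m c. m \<in> A \<Longrightarrow> c \<in> J \<Longrightarrow> g m c \<in> I"
    and e: "\<And>m c. m \<in> A \<Longrightarrow> c \<in> J \<Longrightarrow> e (g m c) = e' c" "\<And>c. c \<in> J \<Longrightarrow> e' c \<ge> 1"
    and \<phi>: "tame J e' \<phi>"
  shows "tame I e (\<lambda>x. \<phi> (\<lambda>c. \<Sum>m\<in>A. x (g m c)))"
proof -
  obtain C where C: "C > 0" "\<And>x. \<bar>\<phi> x\<bar> \<le> C * (1 + growth J e' x)"
    by (rule tame_bound[OF \<phi>]) (rule that)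
  obtain D where D: "D \<ge> 0" "\<And>x. growth J e' (\<lambda>c. \<Sum>m\<in>A. x (g m c)) \<le> D * growth I e x"
    using growth_sums_le[of I J A g e e', OF assms(1-6)] by blast
  show ?thesis
  proof (rule tameI[of _ _ "C * (1 + D)"])
    fix M
    define K where "K = card A * M"
    \<comment> \<open>A sum of truncated coordinates is bounded, so a further truncation at a high level
      is vacuous.\<close>
    have "bLip I (\<lambda>x. \<phi> (truncv K (\<lambda>c. \<Sum>m\<in>A. truncv M x (g m c))))"
    proof (rule bLip_pre[OF assms(1,2) tame_bLip[OF \<phi>], of "\<lambda>x c. \<Sum>m\<in>A. truncv M x (g m c)"
        "card A"])
      fix x y :: "'a \<Rightarrow> real" and c assume c: "c \<in> J"
      have le: "\<bar>truncv M x (g m c) - truncv M y (g m c)\<bar> \<le> (\<Sum>i\<in>I. \<bar>x i - y i\<bar>)" if "m \<in> A" for m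
      proof -
        have "\<bar>x (g m c) - y (g m c)\<bar> \<le> (\<Sum>i\<in>I. \<bar>x i - y i\<bar>)"
          by (rule member_le_sum[where f = "\<lambda>i. \<bar>x i - y i\<bar>"]) (auto simp: assms that c)
        then show ?thesis unfolding truncv_def by (rule order_trans[OF trunc_lipschitz])
      qed
      have "\<bar>(\<Sum>m\<in>A. truncv M x (g m c)) - (\<Sum>m\<in>A. truncv M y (g m c))\<bar>
          \<le> (\<Sum>m\<in>A. \<bar>truncv M x (g m c) - truncv M y (g m c)\<bar>)"
        unfolding sum_subtractf[symmetric] by (rule sum_abs)
      also have "\<dots> \<le> card A * (\<Sum>i\<in>I. \<bar>x i - y i\<bar>)" by (intro sum_bounded_above le)
      finally show "\<bar>(\<Sum>m\<in>A. truncv M x (g m c)) - (\<Sum>m\<in>A. truncv M y (g m c))\<bar>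
          \<le> real (card A) * (\<Sum>i\<in>I. \<bar>x i - y i\<bar>)" .
    qed
    moreover have "truncv K (\<lambda>c. \<Sum>m\<in>A. truncv M x (g m c)) = (\<lambda>c. \<Sum>m\<in>A. truncv M x (g m c))"
      for x :: "'a \<Rightarrow> real"
      unfolding K_def by (intro truncv_id abs_sum_truncv_le)
    ultimately show "bLip I (\<lambda>x. \<phi> (\<lambda>c. \<Sum>m\<in>A. truncv M x (g m c)))" by simp
  next
    fix x
    have "\<bar>\<phi> (\<lambda>c. \<Sum>m\<in>A. x (g m c))\<bar> \<le> C * (1 + D * growth I e x)"
      by (rule order_trans[OF C(2)]) (use C(1) D(2)[of x] in \<open>intro mult_left_mono, auto\<close>)
    also have "\<dots> \<le> C * ((1 + D) * (1 + growth I e x))"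
      using C(1) D(1) growth_nonneg[of I e x] by (intro mult_left_mono) (auto simp: algebra_simps)
    finally show "\<bar>\<phi> (\<lambda>c. \<Sum>m\<in>A. x (g m c))\<bar> \<le> C * (1 + D) * (1 + growth I e x)"
      by (simp only: mult.assoc)
  qed
qed

lemma field_le_multiple_epsilon:
  fixes a b c :: real
  assumes "\<And>\<epsilon>. \<epsilon> > 0 \<Longrightarrow> a \<le> b + \<epsilon> * c" "c \<ge> 0"
  shows "a \<le> b"
proof (rule field_le_epsilon)
  fix \<delta> :: real assume "\<delta> > 0"
  then have "a \<le> b + \<delta> / (c + 1) * c" using assms(2) by (intro assms(1)) auto
  also have "\<delta> / (c + 1) * c \<le> \<delta>" using \<open>\<delta> > 0\<close> assms(2) by (simp add: field_simps)
  finally show "a \<le> b + \<delta>" by simp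
qed

lemma truncv_case_sum: "truncv M (case_sum x y) = case_sum (truncv M x) (truncv M y)"
  unfolding truncv_def by (auto split: sum.splits)

lemma truncv_reindex: "truncv M (\<lambda>c. x (g c)) = (\<lambda>c. truncv M x (g c))"
  unfolding truncv_def ..

lemma growth_case_sum:
  "finite I \<Longrightarrow> finite J \<Longrightarrow>
    growth (I <+> J) (case_sum e e') (case_sum x y) = growth I e x + growth J e' y"
  unfolding growth_def by (simp add: sum.Plus o_def)

lemma bLip_section:
  assumes "finite I" "finite J" "bLip (I <+> J) \<phi>"
  shows "bLip J (\<lambda>y. \<phi> (case_sum x y))"
proof (rule bLip_pre[OF assms(2) _ assms(3), of _ 1])
  fix y z :: "'b \<Rightarrow> real" and c assume c: "c \<in> I <+> J"
  have "\<bar>y b - z b\<bar> \<le> (\<Sum>i\<in>J. \<bar>y i - z i\<bar>)" if "b \<in> J" for b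
    by (rule member_le_sum[where f = "\<lambda>i. \<bar>y i - z i\<bar>"]) (auto simp: assms that)
  then show "\<bar>case_sum x y c - case_sum x z c\<bar> \<le> 1 * (\<Sum>i\<in>J. \<bar>y i - z i\<bar>)"
    using c by (auto simp: sum_nonneg)
qed (use assms in simp)

text \<open>Only sections at bounded points \<open>x\<close> are asserted to be tame, cf. the remark on
  \<open>tame\<close>.\<close>

lemma tame_section:
  assumes "finite I" "finite J" "tame (I <+> J) (case_sum e e') \<phi>"
  shows "tame J e' (\<lambda>y. \<phi> (case_sum (truncv M x) y))"
proof -
  obtain C where C: "C > 0" "\<And>x. \<bar>\<phi> x\<bar> \<le> C * (1 + growth (I <+> J) (case_sum e e') x)"
    by (rule tame_bound[OF assms(3)]) (rule that)
  show ?thesis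
  proof (rule tameI[of _ _ "C * (1 + growth I e (truncv M x))"])
    fix K
    define N where "N = max M K"
    have "bLip J (\<lambda>y. \<phi> (truncv N (case_sum (truncv M x) (truncv K y))))"
    proof (rule bLip_pre[OF assms(2) _ bLip_section[OF assms(1,2) tame_bLip[OF assms(3)], where x =
        "truncv M x"], of "\<lambda>y. truncv K y" 1])
      fix y z :: "'b \<Rightarrow> real" and c assume c: "c \<in> J"
      have "\<bar>y c - z c\<bar> \<le> (\<Sum>i\<in>J. \<bar>y i - z i\<bar>)"
        by (rule member_le_sum[where f = "\<lambda>i. \<bar>y i - z i\<bar>"]) (auto simp: assms c)
      then show "\<bar>truncv K y c - truncv K z c\<bar> \<le> 1 * (\<Sum>i\<in>J. \<bar>y i - z i\<bar>)"
        using trunc_lipschitz[of K "y c" "z c"] unfolding truncv_def by linarith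
    qed (rule assms(2))
    moreover have "truncv N (case_sum (truncv M x) (truncv K y))
        = case_sum (truncv M x) (truncv K y)" for y :: "'b \<Rightarrow> real"
      unfolding truncv_case_sum by (simp add: truncv_def N_def trunc_trunc)
    ultimately show "bLip J (\<lambda>y. \<phi> (case_sum (truncv M x) (truncv K y)))" by simp
  next
    fix y
    have "\<bar>\<phi> (case_sum (truncv M x) y)\<bar> \<le> C * (1 + (growth I e (truncv M x) + growth J e' y))"
      using C(2)[of "case_sum (truncv M x) y"] unfolding growth_case_sum[OF assms(1,2)] .
    also have "\<dots> \<le> C * ((1 + growth I e (truncv M x)) * (1 + growth J e' y))"
      using C(1) growth_nonneg[of I e "truncv M x"] growth_nonneg[of J e' y]
      by (intro mult_left_mono) (auto simp: algebra_simps)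
    finally show "\<bar>\<phi> (case_sum (truncv M x) y)\<bar>
        \<le> C * (1 + growth I e (truncv M x)) * (1 + growth J e' y)"
      by (simp only: mult.assoc)
  qed
qed

section \<open>Uniform integrability and the extension to unbounded functions\<close>

context sublin_completion
begin

lemma L1_blip_reindex:
  assumes "L1_family I Z" "finite J" "bLip J \<phi>" "\<And>c. c \<in> J \<Longrightarrow> g c \<in> I"
  shows "L1_blip H j J \<phi> (\<lambda>c. Z (g c)) = L1_blip H j I (\<lambda>x. \<phi> (\<lambda>c. x (g c))) Z"
    and "bLip I (\<lambda>x. \<phi> (\<lambda>c. x (g c)))"
  using L1_blip_sums[OF assms(1-3), of "{()}" "\<lambda>_. g"] assms(4) by simp_all

lemma law_sum_le:
  assumes "L1_family I Z" "finite A" "\<And>a. a \<in> A \<Longrightarrow> bLip I (\<phi> a)"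
  shows "law Eh I Z (\<lambda>x. \<Sum>a\<in>A. \<phi> a x) \<le> (\<Sum>a\<in>A. law Eh I Z (\<phi> a))"
  using assms(2,3)
proof (induction A rule: finite_induct)
  case (insert a A)
  have "law Eh I Z (\<lambda>x. \<phi> a x + (\<Sum>a\<in>A. \<phi> a x)) \<le> law Eh I Z (\<phi> a) + law Eh I Z (\<lambda>x. \<Sum>a\<in>A. \<phi> a x)"
    by (intro law_add_le assms(1) bLip_sum L1_family_finite[OF assms(1)] insert.prems) auto
  also have "\<dots> \<le> law Eh I Z (\<phi> a) + (\<Sum>a\<in>A. law Eh I Z (\<phi> a))"
    by (intro add_left_mono insert.IH insert.prems) auto
  finally show ?case using insert.hyps by simp
qed (simp add: law_const[OF assms(1) dom_exp_Eh])

text \<open>Uniform integrability of the truncations of \<open>\<bar>z\<bar>\<^sup>p\<close>. The single element \<open>z\<close> is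
  regarded as a family over the one-point type.\<close>

definition unif_int :: "nat \<Rightarrow> 'l \<Rightarrow> bool" where
  "unif_int p z \<longleftrightarrow> (\<forall>\<epsilon>>0. \<exists>r. \<forall>K.
     law Eh UNIV (\<lambda>_::unit. z) (\<lambda>x. max (\<bar>trunc K (x ())\<bar> ^ p - r) 0) \<le> \<epsilon>)"

text \<open>A finite family whose components satisfy this with the exponents \<open>e\<close>. Exponents are
  positive, so that outside a large box the reference function is large.\<close>

definition ui_family :: "'i set \<Rightarrow> ('i \<Rightarrow> nat) \<Rightarrow> ('i \<Rightarrow> 'l) \<Rightarrow> bool" where
  "ui_family I e Z \<longleftrightarrow> L1_family I Z \<and> (\<forall>i\<in>I. e i \<ge> 1 \<and> unif_int (e i) (Z i))"

lemma ui_familyD: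
  assumes "ui_family I e Z"
  shows "L1_family I Z" "finite I" "i \<in> I \<Longrightarrow> e i \<ge> 1" "i \<in> I \<Longrightarrow> unif_int (e i) (Z i)"
  using assms L1_family_finite unfolding ui_family_def by auto

lemma ui_growth:
  assumes ui: "ui_family I e Z" and "\<epsilon> > 0"
  obtains r where "r \<ge> 0" "\<And>K. law Eh I Z (\<lambda>x. max (growth I e (truncv K x) - r) 0) \<le> \<epsilon>"
proof -
  note D = ui_familyD[OF ui]
  define \<epsilon>' where "\<epsilon>' = \<epsilon> / (card I + 1)"
  have e': "\<epsilon>' > 0" unfolding \<epsilon>'_def using assms by simp
  have "\<exists>r. \<forall>K. law Eh UNIV (\<lambda>_::unit. Z i) (\<lambda>x. max (\<bar>trunc K (x ())\<bar> ^ e i - r) 0) \<le> \<epsilon>'"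
    if "i \<in> I" for i using D(4)[OF that] e' unfolding unif_int_def by blast
  then obtain r where r: "law Eh UNIV (\<lambda>_::unit. Z i) (\<lambda>x. max (\<bar>trunc K (x ())\<bar> ^ e i - r i) 0)
      \<le> \<epsilon>'"
    if "i \<in> I" for i K by metis
  have b1: "bLip UNIV (\<lambda>x. max (\<bar>trunc K (x ())\<bar> ^ e i - r i) 0)" for i K
    by (intro bLip_pospart_shift bLip_power bLip_abs bLip_trunc_coord) auto
  have single: "law Eh I Z (\<lambda>x. max (\<bar>truncv K x i\<bar> ^ e i - r i) 0) \<le> \<epsilon>'" if "i \<in> I" for i K
    using r[OF that, of K] L1_blip_reindex(1)[OF D(1) finite b1, of "\<lambda>_. i" K i] that
    unfolding law_def truncv_def by simp
  have b2: "bLip I (\<lambda>x. max (\<bar>truncv K x i\<bar> ^ e i - r i) 0)" if "i \<in> I" for i K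
    unfolding truncv_def using that D(2)
    by (intro bLip_pospart_shift bLip_power bLip_abs bLip_trunc_coord)
  define R where "R = (\<Sum>i\<in>I. \<bar>r i\<bar>)"
  have "law Eh I Z (\<lambda>x. max (growth I e (truncv K x) - R) 0) \<le> \<epsilon>" for K
  proof -
    have pw: "max (growth I e (truncv K x) - R) 0 \<le> (\<Sum>i\<in>I. max (\<bar>truncv K x i\<bar> ^ e i - r i) 0)"
      for x
    proof -
      have "growth I e (truncv K x) - R = (\<Sum>i\<in>I. \<bar>truncv K x i\<bar> ^ e i - \<bar>r i\<bar>)"
        unfolding growth_def R_def by (simp add: sum_subtractf)
      also have "\<dots> \<le> (\<Sum>i\<in>I. max (\<bar>truncv K x i\<bar> ^ e i - r i) 0)" by (intro sum_mono) auto
      finally show ?thesis by (simp add: sum_nonneg)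
    qed
    have "law Eh I Z (\<lambda>x. max (growth I e (truncv K x) - R) 0)
        \<le> law Eh I Z (\<lambda>x. \<Sum>i\<in>I. max (\<bar>truncv K x i\<bar> ^ e i - r i) 0)"
      by (intro law_mono D dom_exp_Eh bLip_sum b2 bLip_pospart_shift bLip_growth pw)
    also have "\<dots> \<le> (\<Sum>i\<in>I. law Eh I Z (\<lambda>x. max (\<bar>truncv K x i\<bar> ^ e i - r i) 0))"
      by (intro law_sum_le D b2)
    also have "\<dots> \<le> card I * \<epsilon>'" by (intro sum_bounded_above single)
    also have "\<dots> \<le> \<epsilon>" unfolding \<epsilon>'_def using assms(2) by (simp add: field_simps)
    finally show ?thesis .
  qed
  moreover have "R \<ge> 0" unfolding R_def by (intro sum_nonneg) auto
  ultimately show ?thesis using that by blast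
qed

text \<open>A bounded Lipschitz function that is controlled by the reference function and vanishes on a
  large box has small \<open>L1\<close> norm, uniformly in its Lipschitz constant and its supremum. All
  convergence statements about truncations rest on this.\<close>

lemma tail_small:
  assumes ui: "ui_family I e Z" and "\<epsilon> > 0"
  shows "\<exists>r. \<forall>h. bLip I h \<longrightarrow> (\<forall>x. \<bar>h x\<bar> \<le> C * (1 + growth I e x)) \<longrightarrow>
    (\<forall>x. (\<forall>i\<in>I. \<bar>x i\<bar> \<le> r) \<longrightarrow> h x = 0) \<longrightarrow> norm (L1_blip H j I h Z) \<le> \<epsilon>"
proof -
  note D = ui_familyD[OF ui]
  define C' where "C' = \<bar>C\<bar> + 1"
  have C': "C' > 0" "C \<le> C'" unfolding C'_def by auto
  define \<epsilon>' where "\<epsilon>' = \<epsilon> / (2 * C')"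
  have "\<epsilon>' > 0" unfolding \<epsilon>'_def using assms(2) C' by simp
  then obtain s where s: "s \<ge> 0" "\<And>K. law Eh I Z (\<lambda>x. max (growth I e (truncv K x) - s) 0) \<le> \<epsilon>'"
    using ui_growth[OF ui] by metis
  define r where "r = 2 * s + 1"
  show ?thesis
  proof (intro exI[of _ r] allI impI)
    fix h assume h: "bLip I h" "\<forall>x. \<bar>h x\<bar> \<le> C * (1 + growth I e x)"
      "\<forall>x. (\<forall>i\<in>I. \<bar>x i\<bar> \<le> r) \<longrightarrow> h x = 0"
    obtain b L where "b \<ge> 0" "L \<ge> 0" and b: "\<And>x. \<bar>h x\<bar> \<le> b"
      and "\<And>x y. \<bar>h x - h y\<bar> \<le> L * (\<Sum>i\<in>I. \<bar>x i - y i\<bar>)"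
      by (rule bLipE[OF D(2) h(1)]) (rule that)
    \<comment> \<open>The truncation level depends on the supremum of \<open>h\<close>, which does no harm as the
      bound by \<open>\<epsilon>'\<close> is uniform in it.\<close>
    obtain K :: nat where K: "K \<ge> r + b / (2 * C')" using real_arch_simple by blast
    have K1: "K \<ge> r" using K C' \<open>b \<ge> 0\<close> by (smt (verit) divide_nonneg_pos)
    have "b / (2 * C') \<le> K - s" using K s(1) unfolding r_def by linarith
    then have Kb: "b \<le> 2 * C' * (K - s)" using C' by (simp add: field_simps)
    have le: "\<bar>h x\<bar> \<le> 2 * C' * max (growth I e (truncv K x) - s) 0" for x
    proof (cases "\<forall>i\<in>I. \<bar>x i\<bar> \<le> r")
      case True
      then show ?thesis using h(3) C' by simp
    next
      case False
      show ?thesis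
      proof (cases "\<forall>i\<in>I. \<bar>x i\<bar> \<le> K")
        case True
        then have g: "growth I e (truncv K x) = growth I e x"
          by (intro growth_cong) (simp add: truncv_def trunc_id)
        obtain i where i: "i \<in> I" "\<bar>x i\<bar> > r" using False by force
        then have "\<bar>x i\<bar> \<le> \<bar>x i\<bar> ^ e i"
          using power_increasing[OF D(3)[OF i(1)], of "\<bar>x i\<bar>"] s(1) unfolding r_def by simp
        then have gr: "growth I e x \<ge> r" using growth_member[OF D(2) i(1), of x e] i(2) by linarith
        have "\<bar>h x\<bar> \<le> C' * (1 + growth I e x)"
          using h(2) mult_right_mono[OF C'(2), of "1 + growth I e x"] growth_nonneg[of I e x]
          by (smt (verit))
        also have "\<dots> \<le> C' * (2 * max (growth I e x - s) 0)"
          using C' gr s(1) unfolding r_def by (intro mult_left_mono) auto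
        finally show ?thesis unfolding g by simp
      next
        case False
        then obtain i where i: "i \<in> I" "\<bar>x i\<bar> > K" by force
        have "real K \<ge> 1" using K1 s(1) unfolding r_def by linarith
        then have "real K \<le> real K ^ e i" using power_increasing[OF D(3)[OF i(1)], of "real K"]
          by simp
        also have "\<dots> = \<bar>truncv K x i\<bar> ^ e i" using i(2) by (simp add: truncv_def abs_trunc_large)
        also have "\<dots> \<le> growth I e (truncv K x)" by (rule growth_member[OF D(2) i(1)])
        finally have "real K - s \<le> max (growth I e (truncv K x) - s) 0" by simp
        then have "2 * C' * (real K - s) \<le> 2 * C' * max (growth I e (truncv K x) - s) 0"
          using C' by (intro mult_left_mono) auto
        then show ?thesis using b[of x] Kb by linarith
      qed
    qed
    have bl: "bLip I (\<lambda>x. max (growth I e (truncv K x) - s) 0)"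
      by (intro bLip_pospart_shift bLip_growth D)
    have "norm (L1_blip H j I h Z) \<le> law Eh I Z (\<lambda>x. 2 * C' * max (growth I e (truncv K x) - s) 0)"
      by (intro norm_L1_blip_le D h(1) le bLip_cmult bl)
    also have "\<dots> = 2 * C' * law Eh I Z (\<lambda>x. max (growth I e (truncv K x) - s) 0)"
      using C' by (intro law_cmult D bl) auto
    also have "\<dots> \<le> 2 * C' * \<epsilon>'" using C' s(2) by (intro mult_left_mono) auto
    also have "\<dots> = \<epsilon>" unfolding \<epsilon>'_def using C' by simp
    finally show "norm (L1_blip H j I h Z) \<le> \<epsilon>" .
  qed
qed

text \<open>The element \<open>\<phi>(Z)\<close> of \<open>L1\<close> for unbounded \<open>\<phi>\<close>, as the limit along truncations of \<open>Z\<close>.\<close>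

definition val :: "'i set \<Rightarrow> ('i \<Rightarrow> 'l) \<Rightarrow> (('i \<Rightarrow> real) \<Rightarrow> real) \<Rightarrow> 'l" where
  "val I Z \<phi> = lim (\<lambda>M. L1_blip H j I (\<lambda>x. \<phi> (truncv M x)) Z)"

text \<open>The factor \<open>a\<close> makes the rate of convergence uniform over sections \<open>\<phi>(x, \<cdot>)\<close> of a function
  of two variables, whose growth constants depend on \<open>x\<close>.\<close>

lemma truncations_close:
  assumes ui: "ui_family I e Z" and "\<epsilon> > 0"
  shows "\<exists>M0. \<forall>M\<ge>M0. \<forall>K\<ge>M0. \<forall>\<phi> a. a > 0 \<longrightarrow> (\<forall>M. bLip I (\<lambda>x. \<phi> (truncv M x))) \<longrightarrow>
    (\<forall>x. \<bar>\<phi> x\<bar> \<le> C * a * (1 + growth I e x)) \<longrightarrow>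
    norm (L1_blip H j I (\<lambda>x. \<phi> (truncv K x)) Z - L1_blip H j I (\<lambda>x. \<phi> (truncv M x)) Z) \<le> \<epsilon> * a"
proof -
  note D = ui_familyD[OF ui]
  obtain r where r: "\<And>h. bLip I h \<Longrightarrow> (\<And>x. \<bar>h x\<bar> \<le> 2 * \<bar>C\<bar> * (1 + growth I e x)) \<Longrightarrow>
    (\<And>x. (\<forall>i\<in>I. \<bar>x i\<bar> \<le> r) \<Longrightarrow> h x = 0) \<Longrightarrow> norm (L1_blip H j I h Z) \<le> \<epsilon>"
    using tail_small[OF ui assms(2), of "2 * \<bar>C\<bar>"] by blast
  obtain M0 :: nat where M0: "M0 \<ge> r" using real_arch_simple by blast
  show ?thesis
  proof (intro exI[of _ M0] allI impI)
    fix M K \<phi> and a :: real assume MK: "M0 \<le> M" "M0 \<le> K" and a: "a > 0"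
      and bl: "\<forall>M. bLip I (\<lambda>x. \<phi> (truncv M x))" and C: "\<forall>x. \<bar>\<phi> x\<bar> \<le> C * a * (1 + growth I e x)"
    define h where "h x = (1 / a) * (\<phi> (truncv K x) - \<phi> (truncv M x))" for x
    have bd: "bLip I (\<lambda>x. \<phi> (truncv K x) - \<phi> (truncv M x))" using bl by (intro bLip_diff D) auto
    have "norm (L1_blip H j I h Z) \<le> \<epsilon>"
    proof (rule r)
      show "bLip I h" unfolding h_def by (intro bLip_cmult D bd)
      have t: "\<bar>\<phi> (truncv N x)\<bar> \<le> a * (\<bar>C\<bar> * (1 + growth I e x))" for N x
      proof -
        have "\<bar>\<phi> (truncv N x)\<bar> \<le> C * a * (1 + growth I e (truncv N x))" using C by blast
        also have "\<dots> \<le> \<bar>C\<bar> * a * (1 + growth I e x)"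
          using a growth_truncv_le[of I e N x] growth_nonneg[of I e "truncv N x"]
          by (intro mult_mono) auto
        finally show ?thesis by (simp add: mult_ac)
      qed
      show "\<bar>h x\<bar> \<le> 2 * \<bar>C\<bar> * (1 + growth I e x)" for x
      proof -
        have "\<bar>\<phi> (truncv K x) - \<phi> (truncv M x)\<bar> \<le> a * (2 * \<bar>C\<bar> * (1 + growth I e x))"
          using t[of K x] t[of M x] by (simp add: algebra_simps abs_le_iff)
        then show ?thesis unfolding h_def abs_mult using a by (simp add: field_simps)
      qed
      have *: "\<phi> (truncv K x) = \<phi> (truncv M x)" if x: "\<forall>i\<in>I. \<bar>x i\<bar> \<le> r" and "M0 \<le> M" "M \<le> K"
        for x M K
      proof -
        have "\<phi> (truncv K x) = \<phi> (truncv K (truncv M x))"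
          using x M0 that by (intro bLip_cong[OF D(2) bl[rule_format]]) (force simp: truncv_def
              trunc_id)
        also have "truncv K (truncv M x) = truncv M x" unfolding truncv_def using that(3)
          by (simp add: trunc_trunc)
        finally show ?thesis .
      qed
      show "h x = 0" if "\<forall>i\<in>I. \<bar>x i\<bar> \<le> r" for x
        using *[OF that, of M K] *[OF that, of K M] MK unfolding h_def by (cases "M \<le> K") auto
    qed
    moreover have "L1_blip H j I h Z
        = (1 / a) *\<^sub>R (L1_blip H j I (\<lambda>x. \<phi> (truncv K x)) Z - L1_blip H j I (\<lambda>x. \<phi> (truncv M x)) Z)"
      unfolding h_def L1_blip_cmult[OF D(1) bd]
      unfolding L1_blip_diff[OF D(1) bl[rule_format] bl[rule_format]] ..
    ultimately show "norm (L1_blip H j I (\<lambda>x. \<phi> (truncv K x)) Z - L1_blip H j I (\<lambda>x. \<phi> (truncv M x)) Z) \<le> \<epsilon> * a"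
      using a by (simp add: pos_divide_le_eq del: scaleR_right_diff_distrib)
  qed
qed

lemma val_tendsto:
  assumes ui: "ui_family I e Z" and \<phi>: "tame I e \<phi>"
  shows "(\<lambda>M. L1_blip H j I (\<lambda>x. \<phi> (truncv M x)) Z) \<longlonglongrightarrow> val I Z \<phi>"
proof -
  obtain C where C: "C > 0" "\<And>x. \<bar>\<phi> x\<bar> \<le> C * (1 + growth I e x)"
    by (rule tame_bound[OF \<phi>]) (rule that)
  have "Cauchy (\<lambda>M. L1_blip H j I (\<lambda>x. \<phi> (truncv M x)) Z)"
  proof (rule metric_CauchyI)
    fix \<epsilon> :: real assume "\<epsilon> > 0"
    then have "\<epsilon> / 2 > 0" by simp
    from truncations_close[OF ui this, of C] obtain M0 where
      "\<And>M K. M \<ge> M0 \<Longrightarrow> K \<ge> M0 \<Longrightarrow>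
        norm (L1_blip H j I (\<lambda>x. \<phi> (truncv K x)) Z - L1_blip H j I (\<lambda>x. \<phi> (truncv M x)) Z) \<le> \<epsilon> / 2 *
            1"
      using C(2) tame_bLip[OF \<phi>] by (metis mult.right_neutral zero_less_one)
    then show "\<exists>M0. \<forall>K\<ge>M0. \<forall>M\<ge>M0.
        dist (L1_blip H j I (\<lambda>x. \<phi> (truncv K x)) Z) (L1_blip H j I (\<lambda>x. \<phi> (truncv M x)) Z) < \<epsilon>"
      using \<open>\<epsilon> > 0\<close> by (intro exI[of _ M0]) (force simp: dist_norm)
  qed
  then show ?thesis unfolding val_def using Cauchy_convergent convergent_LIMSEQ_iff by blast
qed

lemma val_uniform:
  assumes ui: "ui_family I e Z" and "\<epsilon> > 0"
  shows "\<exists>M0. \<forall>M\<ge>M0. \<forall>\<phi> a. a > 0 \<longrightarrow> tame I e \<phi> \<longrightarrow>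
    (\<forall>x. \<bar>\<phi> x\<bar> \<le> C * a * (1 + growth I e x)) \<longrightarrow>
    norm (val I Z \<phi> - L1_blip H j I (\<lambda>x. \<phi> (truncv M x)) Z) \<le> \<epsilon> * a"
proof -
  obtain M0 where M0: "\<And>M K \<phi> a. M \<ge> M0 \<Longrightarrow> K \<ge> M0 \<Longrightarrow> a > 0 \<Longrightarrow> (\<And>M. bLip I (\<lambda>x. \<phi> (truncv M x))) \<Longrightarrow>
    (\<And>x. \<bar>\<phi> x\<bar> \<le> C * a * (1 + growth I e x)) \<Longrightarrow>
    norm (L1_blip H j I (\<lambda>x. \<phi> (truncv K x)) Z - L1_blip H j I (\<lambda>x. \<phi> (truncv M x)) Z) \<le> \<epsilon> * a"
    using truncations_close[OF assms, of C] by blast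
  show ?thesis
  proof (intro exI[of _ M0] allI impI)
    fix M \<phi> and a :: real
    assume h: "M \<ge> M0" "a > 0" "tame I e \<phi>" and bound: "\<forall>x. \<bar>\<phi> x\<bar> \<le> C * a * (1 + growth I e x)"
    show "norm (val I Z \<phi> - L1_blip H j I (\<lambda>x. \<phi> (truncv M x)) Z) \<le> \<epsilon> * a"
      by (rule LIMSEQ_le_const2[OF tendsto_norm[OF tendsto_diff[OF val_tendsto[OF ui h(3)]
          tendsto_const]]])
        (intro exI[of _ M0] allI impI M0 h bound[rule_format] tame_bLip[OF h(3)])
  qed
qed

text \<open>The limit is independent of the truncation: any controlled bounded Lipschitz \<open>\<psi>\<^sub>M\<close> that
  eventually agree with the truncations of \<open>\<phi>\<close> on each box lead to the same element of \<open>L1\<close>.\<close>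

lemma val_eqI:
  assumes ui: "ui_family I e Z" and \<phi>: "tame I e \<phi>"
    and \<psi>: "\<And>M. bLip I (\<psi> M)" "\<And>M x. \<bar>\<psi> M x\<bar> \<le> C * (1 + growth I e x)"
    and eq: "\<And>r::nat. \<exists>M0. \<forall>M\<ge>M0. \<forall>x. (\<forall>i\<in>I. \<bar>x i\<bar> \<le> r) \<longrightarrow> \<psi> M x = \<phi> (truncv M x)"
  shows "(\<lambda>M. L1_blip H j I (\<psi> M) Z) \<longlonglongrightarrow> val I Z \<phi>"
proof -
  note D = ui_familyD[OF ui]
  obtain B where B: "B > 0" "\<And>x. \<bar>\<phi> x\<bar> \<le> B * (1 + growth I e x)"
    by (rule tame_bound[OF \<phi>]) (rule that)
  have "(\<lambda>M. L1_blip H j I (\<psi> M) Z - L1_blip H j I (\<lambda>x. \<phi> (truncv M x)) Z) \<longlonglongrightarrow> 0"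
  proof (rule metric_LIMSEQ_I)
    fix \<epsilon> :: real assume "\<epsilon> > 0"
    then have "\<epsilon> / 2 > 0" by simp
    from tail_small[OF ui this, of "C + B"] obtain r where
      r: "\<And>h. bLip I h \<Longrightarrow> (\<And>x. \<bar>h x\<bar> \<le> (C + B) * (1 + growth I e x)) \<Longrightarrow>
        (\<And>x. (\<forall>i\<in>I. \<bar>x i\<bar> \<le> r) \<Longrightarrow> h x = 0) \<Longrightarrow> norm (L1_blip H j I h Z) \<le> \<epsilon> / 2" by blast
    obtain s :: nat where s: "r \<le> s" using real_arch_simple by blast
    obtain M0 where M0: "\<And>M x. M \<ge> M0 \<Longrightarrow> (\<forall>i\<in>I. \<bar>x i\<bar> \<le> real s) \<Longrightarrow> \<psi> M x = \<phi> (truncv M x)"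
      using eq[of s] by blast
    have "norm (L1_blip H j I (\<psi> M) Z - L1_blip H j I (\<lambda>x. \<phi> (truncv M x)) Z) \<le> \<epsilon> / 2" if "M \<ge> M0"
      for M
      unfolding L1_blip_diff[OF D(1) \<psi>(1) tame_bLip[OF \<phi>], symmetric]
    proof (rule r)
      show "bLip I (\<lambda>x. \<psi> M x - \<phi> (truncv M x))" by (intro bLip_diff D \<psi>(1) tame_bLip[OF \<phi>])
      show "\<bar>\<psi> M x - \<phi> (truncv M x)\<bar> \<le> (C + B) * (1 + growth I e x)" for x
      proof -
        have "\<bar>\<phi> (truncv M x)\<bar> \<le> B * (1 + growth I e x)"
          by (rule order_trans[OF B(2)]) (intro mult_left_mono, use B(1)
              growth_truncv_le[of I e M x] in auto)
        then show ?thesis using \<psi>(2)[of M x] unfolding distrib_right[of C B] by linarith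
      qed
      show "\<psi> M x - \<phi> (truncv M x) = 0" if "\<forall>i\<in>I. \<bar>x i\<bar> \<le> r" for x
        using M0[OF \<open>M \<ge> M0\<close>, of x] that s by fastforce
    qed
    then show "\<exists>M0. \<forall>M\<ge>M0. dist (L1_blip H j I (\<psi> M) Z - L1_blip H j I (\<lambda>x. \<phi> (truncv M x)) Z) 0 < \<epsilon>"
      using \<open>\<epsilon> > 0\<close> by (intro exI[of _ M0]) force
  qed
  from tendsto_add[OF this val_tendsto[OF ui \<phi>]] show ?thesis by simp
qed

end

section \<open>Calculus of the extended expectations\<close>

context sublin_completion
begin

lemma val_eq_lim:
  assumes "ui_family I e Z" "tame I e \<phi>" "(\<lambda>M. L1_blip H j I (\<lambda>x. \<phi> (truncv M x)) Z) \<longlonglongrightarrow> z"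
  shows "val I Z \<phi> = z"
  using LIMSEQ_unique val_tendsto[OF assms(1,2)] assms(3) by blast

lemma val_in_L1:
  assumes "ui_family I e Z" "tame I e \<phi>"
  shows "val I Z \<phi> \<in> L1 H j"
proof -
  have "\<forall>M. L1_blip H j I (\<lambda>x. \<phi> (truncv M x)) Z \<in> L1 H j"
    using L1_blip_in_L1 ui_familyD(1)[OF assms(1)] tame_bLip[OF assms(2)] by blast
  then show ?thesis using val_tendsto[OF assms] unfolding L1_def
    by (meson closed_closure closed_sequentially)
qed

lemma val_add:
  assumes "ui_family I e Z" "tame I e \<phi>" "tame I e \<psi>"
  shows "val I Z (\<lambda>x. \<phi> x + \<psi> x) = val I Z \<phi> + val I Z \<psi>"
proof (rule val_eq_lim[OF assms(1)])
  note D = ui_familyD[OF assms(1)]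
  show "tame I e (\<lambda>x. \<phi> x + \<psi> x)" by (intro tame_add D assms)
  show "(\<lambda>M. L1_blip H j I (\<lambda>x. \<phi> (truncv M x) + \<psi> (truncv M x)) Z) \<longlonglongrightarrow> val I Z \<phi> + val I Z \<psi>"
    unfolding L1_blip_add[OF D(1) tame_bLip[OF assms(2)] tame_bLip[OF assms(3)]]
    by (intro tendsto_add val_tendsto[OF assms(1)] assms)
qed

lemma val_cmult:
  assumes "ui_family I e Z" "tame I e \<phi>"
  shows "val I Z (\<lambda>x. c * \<phi> x) = c *\<^sub>R val I Z \<phi>"
proof (rule val_eq_lim[OF assms(1)])
  note D = ui_familyD[OF assms(1)]
  show "tame I e (\<lambda>x. c * \<phi> x)" by (intro tame_cmult D assms)
  show "(\<lambda>M. L1_blip H j I (\<lambda>x. c * \<phi> (truncv M x)) Z) \<longlonglongrightarrow> c *\<^sub>R val I Z \<phi>"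
    unfolding L1_blip_cmult[OF D(1) tame_bLip[OF assms(2)]]
    by (intro tendsto_scaleR tendsto_const val_tendsto[OF assms(1)] assms)
qed

lemma val_zero:
  assumes "ui_family I e Z"
  shows "val I Z (\<lambda>x. 0) = 0"
  using val_cmult[OF assms tame_const[OF ui_familyD(2)[OF assms]], of 0] by simp

lemma val_sum:
  assumes "ui_family I e Z" "\<And>a. a \<in> A \<Longrightarrow> tame I e (\<phi> a)"
  shows "val I Z (\<lambda>x. \<Sum>a\<in>A. \<phi> a x) = (\<Sum>a\<in>A. val I Z (\<phi> a))"
  using assms(2)
proof (induction A rule: infinite_finite_induct)
  case (insert a A)
  have "tame I e (\<lambda>x. \<Sum>a\<in>A. \<phi> a x)"
    using insert.prems by (intro tame_sum ui_familyD(2)[OF assms(1)]) auto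
  then show ?case using insert by (simp add: val_add[OF assms(1)])
qed (simp_all add: val_zero[OF assms(1)])

text \<open>The distribution of \<open>Z\<close> under \<open>E\<close>, extended to tame functions.\<close>

definition ev :: "(('w \<Rightarrow> real) \<Rightarrow> real) \<Rightarrow> 'i set \<Rightarrow> ('i \<Rightarrow> 'l) \<Rightarrow> (('i \<Rightarrow> real) \<Rightarrow> real) \<Rightarrow> real" where
  "ev E I Z \<phi> = L1_exp H j E (val I Z \<phi>)"

lemma ev_tendsto:
  assumes "dom_exp E" "ui_family I e Z" "tame I e \<phi>"
  shows "(\<lambda>M. law E I Z (\<lambda>x. \<phi> (truncv M x))) \<longlonglongrightarrow> ev E I Z \<phi>"
  unfolding law_def ev_def
  by (intro L1_exp_cont assms(1) val_tendsto[OF assms(2,3)] L1_blip_in_L1 ui_familyD(1)[OF assms(2)]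
      tame_bLip[OF assms(3)])

context
  fixes I :: "'i set" and e :: "'i \<Rightarrow> nat" and Z :: "'i \<Rightarrow> 'l"
  assumes ui: "ui_family I e Z"
begin

lemma ui_fam: "L1_family I Z" and ui_fin: "finite I"
  using ui_familyD[OF ui] by auto

lemma ev_mono:
  assumes "dom_exp E" "tame I e \<phi>" "tame I e \<psi>" "\<And>x. \<phi> x \<le> \<psi> x"
  shows "ev E I Z \<phi> \<le> ev E I Z \<psi>"
  by (rule LIMSEQ_le[OF ev_tendsto[OF assms(1) ui assms(2)] ev_tendsto[OF assms(1) ui assms(3)]])
    (intro exI allI impI law_mono[OF ui_fam] assms tame_bLip[OF assms(2)] tame_bLip[OF assms(3)])

lemma ev_diff_le:
  assumes "dom_exp E" "tame I e \<phi>" "tame I e \<psi>"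
  shows "ev E I Z \<phi> - ev E I Z \<psi> \<le> ev Eh I Z (\<lambda>x. \<phi> x - \<psi> x)"
  by (rule LIMSEQ_le[OF tendsto_diff[OF ev_tendsto[OF assms(1) ui assms(2)] ev_tendsto[OF assms(1)
      ui assms(3)]]
        ev_tendsto[OF dom_exp_Eh ui tame_diff[OF ui_fin assms(2,3)]]])
    (intro exI allI impI law_diff_le[OF ui_fam] assms tame_bLip[OF assms(2)] tame_bLip[OF assms(3)])

lemma ev_add_le:
  assumes "tame I e \<phi>" "tame I e \<psi>"
  shows "ev Eh I Z (\<lambda>x. \<phi> x + \<psi> x) \<le> ev Eh I Z \<phi> + ev Eh I Z \<psi>"
  using ev_diff_le[OF dom_exp_Eh tame_add[OF ui_fin assms] assms(2)] by simp

lemma ev_cmult: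
  assumes "tame I e \<phi>" "c \<ge> 0"
  shows "ev Eh I Z (\<lambda>x. c * \<phi> x) = c * ev Eh I Z \<phi>"
proof -
  have "(\<lambda>M. law Eh I Z (\<lambda>x. c * \<phi> (truncv M x))) \<longlonglongrightarrow> c * ev Eh I Z \<phi>"
    unfolding law_cmult[OF ui_fam tame_bLip[OF assms(1)] assms(2)]
    by (intro tendsto_intros ev_tendsto[OF dom_exp_Eh ui assms(1)])
  then show ?thesis using LIMSEQ_unique ev_tendsto[OF dom_exp_Eh ui tame_cmult[OF ui_fin assms(1)]]
    by blast
qed

lemma ev_const:
  assumes "dom_exp E"
  shows "ev E I Z (\<lambda>x. c) = c"
  using ev_tendsto[OF assms ui tame_const[OF ui_fin]] law_const[OF ui_fam assms, of c]
  by (simp add: LIMSEQ_const_iff)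

lemma ev_sum_le:
  assumes "finite A" "\<And>a. a \<in> A \<Longrightarrow> tame I e (\<phi> a)"
  shows "ev Eh I Z (\<lambda>x. \<Sum>a\<in>A. \<phi> a x) \<le> (\<Sum>a\<in>A. ev Eh I Z (\<phi> a))"
  using assms
proof (induction A rule: finite_induct)
  case (insert a A)
  have "ev Eh I Z (\<lambda>x. \<phi> a x + (\<Sum>a\<in>A. \<phi> a x)) \<le> ev Eh I Z (\<phi> a) + ev Eh I Z (\<lambda>x. \<Sum>a\<in>A. \<phi> a x)"
    using insert.prems by (intro ev_add_le tame_sum ui_fin) auto
  also have "\<dots> \<le> ev Eh I Z (\<phi> a) + (\<Sum>a\<in>A. ev Eh I Z (\<phi> a))"
    using insert.prems by (intro add_left_mono insert.IH) auto
  finally show ?case using insert.hyps by simp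
qed (simp add: ev_const[OF dom_exp_Eh])

text \<open>A summand whose upper expectation is nonpositive in both directions does not affect any
  dominated expectation, even if that expectation is not subadditive.\<close>

lemma ev_add_null:
  assumes "dom_exp E" "tame I e \<phi>" "tame I e \<psi>"
    "ev Eh I Z \<psi> \<le> 0" "ev Eh I Z (\<lambda>x. - \<psi> x) \<le> 0"
  shows "ev E I Z (\<lambda>x. \<phi> x + \<psi> x) = ev E I Z \<phi>"
  using ev_diff_le[OF assms(1) tame_add[OF ui_fin assms(2,3)] assms(2)]
    ev_diff_le[OF assms(1,2) tame_add[OF ui_fin assms(2,3)]] assms(4,5) by simp

lemma ev_add_const:
  assumes "dom_exp E" "tame I e \<phi>"
  shows "ev E I Z (\<lambda>x. \<phi> x + c) = ev E I Z \<phi> + c"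
  using ev_diff_le[OF assms(1) tame_add[OF ui_fin assms(2) tame_const[OF ui_fin, of _ c]] assms(2)]
    ev_diff_le[OF assms(1,2) tame_add[OF ui_fin assms(2) tame_const[OF ui_fin, of _ c]]]
    ev_const[OF dom_exp_Eh, of c] ev_const[OF dom_exp_Eh, of "-c"] by simp

end

lemma val_reindex:
  assumes "L1_family I Z" "finite J" "tame J e' \<phi>" "\<And>c. c \<in> J \<Longrightarrow> g c \<in> I"
  shows "val J (\<lambda>c. Z (g c)) \<phi> = val I Z (\<lambda>x. \<phi> (\<lambda>c. x (g c)))"
  using L1_blip_reindex(1)[OF assms(1,2) tame_bLip[OF assms(3)], where g = g] assms(4)
  unfolding val_def by (simp add: truncv_reindex)

text \<open>Truncating the sums of a family and summing its truncations lead to the same limit, so \<open>\<phi>\<close>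
  of the vector of sums can be treated as a function of the family itself.\<close>

lemma val_sums:
  assumes ui: "ui_family I e Z" and fin: "finite J" "finite A"
    and g: "\<And>m c. m \<in> A \<Longrightarrow> c \<in> J \<Longrightarrow> g m c \<in> I"
    and e: "\<And>m c. m \<in> A \<Longrightarrow> c \<in> J \<Longrightarrow> e (g m c) = e' c" "\<And>c. c \<in> J \<Longrightarrow> e' c \<ge> 1"
    and \<phi>: "tame J e' \<phi>"
  shows "(\<lambda>M. L1_blip H j J (\<lambda>y. \<phi> (truncv M y)) (\<lambda>c. \<Sum>m\<in>A. Z (g m c)))
    \<longlonglongrightarrow> val I Z (\<lambda>x. \<phi> (\<lambda>c. \<Sum>m\<in>A. x (g m c)))"
proof -
  note D = ui_familyD[OF ui]
  obtain C where C: "C > 0" "\<And>x. \<bar>\<phi> x\<bar> \<le> C * (1 + growth J e' x)"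
    by (rule tame_bound[OF \<phi>]) (rule that)
  obtain B where B: "B \<ge> 0" "\<And>x. growth J e' (\<lambda>c. \<Sum>m\<in>A. x (g m c)) \<le> B * growth I e x"
    using growth_sums_le[of I J A g e e', OF D(2) fin g e] by blast
  have s: "L1_blip H j J (\<lambda>y. \<phi> (truncv M y)) (\<lambda>c. \<Sum>m\<in>A. Z (g m c))
        = L1_blip H j I (\<lambda>x. \<phi> (truncv M (\<lambda>c. \<Sum>m\<in>A. x (g m c)))) Z"
    "bLip I (\<lambda>x. \<phi> (truncv M (\<lambda>c. \<Sum>m\<in>A. x (g m c))))" for M
    using L1_blip_sums[OF D(1) fin(1) tame_bLip[OF \<phi>], where A = A and g = g] g by auto
  show ?thesis
    unfolding s(1)
  proof (rule val_eqI[OF ui tame_sums[of I J A g e e', OF D(2) fin g e \<phi>]])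
    show "bLip I (\<lambda>x. \<phi> (truncv M (\<lambda>c. \<Sum>m\<in>A. x (g m c))))" for M by (rule s(2))
    show "\<bar>\<phi> (truncv M (\<lambda>c. \<Sum>m\<in>A. x (g m c)))\<bar> \<le> C * (1 + B) * (1 + growth I e x)" for M x
    proof -
      have "\<bar>\<phi> (truncv M (\<lambda>c. \<Sum>m\<in>A. x (g m c)))\<bar>
          \<le> C * (1 + growth J e' (truncv M (\<lambda>c. \<Sum>m\<in>A. x (g m c))))"
        by (rule C)
      also have "\<dots> \<le> C * ((1 + B) * (1 + growth I e x))"
      proof (rule mult_left_mono)
        have "growth J e' (truncv M (\<lambda>c. \<Sum>m\<in>A. x (g m c))) \<le> B * growth I e x"
          by (rule order_trans[OF growth_truncv_le B(2)])
        then show "1 + growth J e' (truncv M (\<lambda>c. \<Sum>m\<in>A. x (g m c))) \<le> (1 + B) * (1 + growth I e x)"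
          using B(1) growth_nonneg[of I e x] by (simp add: algebra_simps)
      qed (use C in simp)
      finally show ?thesis by (simp only: mult.assoc)
    qed
    show "\<exists>M0. \<forall>M\<ge>M0. \<forall>x. (\<forall>i\<in>I. \<bar>x i\<bar> \<le> real r) \<longrightarrow>
        \<phi> (truncv M (\<lambda>c. \<Sum>m\<in>A. x (g m c))) = \<phi> (\<lambda>c. \<Sum>m\<in>A. truncv M x (g m c))" for r
    proof (intro exI[of _ "max r (card A * r)"] allI impI)
      fix M x assume M: "max r (card A * r) \<le> M" and x: "\<forall>i\<in>I. \<bar>x i\<bar> \<le> real r"
      define y where "y = (\<lambda>c. \<Sum>m\<in>A. truncv M x (g m c))"
      define K where "K = max M (card A * M)"
      have "\<bar>y c\<bar> \<le> real K" for c
        using abs_sum_truncv_le[where M = M and A = A and x = x and g = "\<lambda>m. g m c"]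
        unfolding y_def K_def by linarith
      then have y: "truncv K y = y" by (intro truncv_id)
      have *: "truncv M (\<lambda>c. \<Sum>m\<in>A. x (g m c)) c = y c" if c: "c \<in> J" for c
      proof -
        have "truncv M x (g m c) = x (g m c)" if "m \<in> A" for m
          using x g[OF that c] M unfolding truncv_def by (intro trunc_id) force
        then have yc: "y c = (\<Sum>m\<in>A. x (g m c))" unfolding y_def by simp
        have "\<bar>\<Sum>m\<in>A. x (g m c)\<bar> \<le> (\<Sum>m\<in>A. \<bar>x (g m c)\<bar>)" by (rule sum_abs)
        also have "\<dots> \<le> card A * real r" using x g c by (intro sum_bounded_above) auto
        also have "\<dots> = real (card A * r)" by simp
        also have "\<dots> \<le> real M" using M by (intro of_nat_mono) simp
        finally show ?thesis unfolding yc truncv_def by (rule trunc_id)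
      qed
      have "\<phi> (truncv M (\<lambda>c. \<Sum>m\<in>A. x (g m c))) = \<phi> (truncv K (truncv M (\<lambda>c. \<Sum>m\<in>A. x (g m c))))"
        unfolding K_def truncv_def by (simp add: trunc_trunc)
      also have "\<dots> = \<phi> (truncv K y)" by (rule bLip_cong[OF fin(1) tame_bLip[OF \<phi>]]) (rule *)
      finally show "\<phi> (truncv M (\<lambda>c. \<Sum>m\<in>A. x (g m c))) = \<phi> (\<lambda>c. \<Sum>m\<in>A. truncv M x (g m c))"
        unfolding y unfolding y_def .
    qed
  qed
qed

text \<open>Convergence of \<open>\<phi>\<close> along truncations implies uniform integrability of whatever \<open>\<phi>\<close>
  dominates: the excess of \<open>\<bar>V\<^sub>c\<bar>\<^sup>p\<close> over the supremum of \<open>\<phi>\<close> at level \<open>K0\<close> is at most the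
  difference of \<open>\<phi>\<close> between the current, higher level and \<open>K0\<close>.\<close>

lemma unif_intI:
  assumes fam: "L1_family J V" and c: "c \<in> J"
    and bl: "\<And>M. bLip J (\<lambda>x. \<phi> (truncv M x))"
    and lim: "(\<lambda>M. L1_blip H j J (\<lambda>x. \<phi> (truncv M x)) V) \<longlonglongrightarrow> y"
    and le: "\<And>x. \<bar>x c\<bar> ^ p \<le> \<phi> x"
  shows "unif_int p (V c)"
  unfolding unif_int_def
proof (intro allI impI)
  note fin = L1_family_finite[OF fam]
  fix \<epsilon> :: real assume "\<epsilon> > 0"
  then obtain K0 where K0: "\<And>M K. M \<ge> K0 \<Longrightarrow> K \<ge> K0 \<Longrightarrow>
      norm (L1_blip H j J (\<lambda>x. \<phi> (truncv K x)) V - L1_blip H j J (\<lambda>x. \<phi> (truncv M x)) V) < \<epsilon>"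
    using LIMSEQ_imp_Cauchy[OF lim] unfolding Cauchy_def dist_norm by meson
  obtain r L where "r \<ge> 0" "L \<ge> 0" and r: "\<And>x. \<bar>\<phi> (truncv K0 x)\<bar> \<le> r"
    and "\<And>x y. \<bar>\<phi> (truncv K0 x) - \<phi> (truncv K0 y)\<bar> \<le> L * (\<Sum>i\<in>J. \<bar>x i - y i\<bar>)"
    by (rule bLipE[OF fin bl[of K0]]) (rule that)
  have b1: "bLip UNIV (\<lambda>x. max (\<bar>trunc K (x ())\<bar> ^ p - r) 0)" for K
    by (intro bLip_pospart_shift bLip_power bLip_abs bLip_trunc_coord) auto
  have b2: "bLip J (\<lambda>x. max (\<bar>truncv K x c\<bar> ^ p - r) 0)" for K
    unfolding truncv_def by (intro bLip_pospart_shift bLip_power bLip_abs bLip_trunc_coord fin c)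
  show "\<exists>r. \<forall>K. law Eh UNIV (\<lambda>_::unit. V c) (\<lambda>x. max (\<bar>trunc K (x ())\<bar> ^ p - r) 0) \<le> \<epsilon>"
  proof (intro exI[of _ r] allI)
    fix K
    have eq: "law Eh UNIV (\<lambda>_::unit. V c) (\<lambda>x. max (\<bar>trunc K (x ())\<bar> ^ p - r) 0)
        = law Eh J V (\<lambda>x. max (\<bar>truncv K x c\<bar> ^ p - r) 0)"
      unfolding law_def truncv_def using L1_blip_reindex(1)[OF fam finite b1, of "\<lambda>_. c"] c by simp
    show "law Eh UNIV (\<lambda>_::unit. V c) (\<lambda>x. max (\<bar>trunc K (x ())\<bar> ^ p - r) 0) \<le> \<epsilon>"
    proof (cases "K \<le> K0")
      case True
      have "\<bar>truncv K x c\<bar> ^ p \<le> r" for x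
      proof -
        have "\<bar>truncv K x c\<bar> ^ p \<le> \<bar>truncv K0 x c\<bar> ^ p"
          unfolding truncv_def by (intro power_mono abs_trunc_mono True) auto
        also have "\<dots> \<le> r" using le[of "truncv K0 x"] r[of x] by linarith
        finally show ?thesis .
      qed
      then have "(\<lambda>x. max (\<bar>truncv K x c\<bar> ^ p - r) 0) = (\<lambda>x. 0)" by (simp add: fun_eq_iff max_def)
      then show ?thesis unfolding eq using law_const[OF fam dom_exp_Eh, of 0] \<open>\<epsilon> > 0\<close> by simp
    next
      case False
      have "law Eh J V (\<lambda>x. max (\<bar>truncv K x c\<bar> ^ p - r) 0)
          \<le> law Eh J V (\<lambda>x. \<bar>\<phi> (truncv K x) - \<phi> (truncv K0 x)\<bar>)"
      proof (intro law_mono fam dom_exp_Eh b2 bLip_abs bLip_diff bl fin)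
        show "max (\<bar>truncv K x c\<bar> ^ p - r) 0 \<le> \<bar>\<phi> (truncv K x) - \<phi> (truncv K0 x)\<bar>" for x
          using le[of "truncv K x"] r[of x] by linarith
      qed
      also have "\<dots> = norm (L1_blip H j J (\<lambda>x. \<phi> (truncv K x)) V - L1_blip H j J (\<lambda>x. \<phi> (truncv K0 x)) V)"
        unfolding L1_blip_diff[OF fam bl bl, symmetric] norm_L1_blip[OF fam bLip_diff[OF fin bl bl]]
            ..
      also have "\<dots> \<le> \<epsilon>" using K0[of K0 K] False by simp
      finally show ?thesis unfolding eq .
    qed
  qed
qed

lemma ev_same_law:
  assumes "dom_exp E" "ui_family I e Z" "ui_family I e W" "same_law H j E I Z W" "tame I e \<phi>"
  shows "ev E I Z \<phi> = ev E I W \<phi>"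
proof -
  have "law E I Z (\<lambda>x. \<phi> (truncv M x)) = law E I W (\<lambda>x. \<phi> (truncv M x))" for M
    using assms(4) tame_bLip[OF assms(5)] unfolding same_law_def law_def by blast
  then show ?thesis
    using ev_tendsto[OF assms(1,2,5)] ev_tendsto[OF assms(1,3,5)] LIMSEQ_unique by simp
qed

section \<open>Independence for functions of controlled growth\<close>

lemma ui_family_case_sum:
  assumes "ui_family I e Z" "ui_family J e' W"
  shows "ui_family (I <+> J) (case_sum e e') (case_sum Z W)"
  using assms unfolding ui_family_def L1_family_def by auto

text \<open>Independence for tame \<open>\<phi>\<close>. The conditional expectation \<open>x \<mapsto> E[\<phi>(x, W)]\<close> itself need not be
  shown tame: a tame bound on either side is enough for the applications.\<close>

lemma indep_ev:
  assumes E: "dom_exp E" and ind: "indep_of H j E J W I Z"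
    and uiZ: "ui_family I e Z" and uiW: "ui_family J e' W"
    and \<phi>: "tame (I <+> J) (case_sum e e') \<phi>" and g: "tame I e g"
  shows "(\<And>x. ev E J W (\<lambda>y. \<phi> (case_sum x y)) \<le> g x) \<Longrightarrow> ev E (I <+> J) (case_sum Z W) \<phi> \<le> ev E I Z g"
    and "(\<And>x. g x \<le> ev E J W (\<lambda>y. \<phi> (case_sum x y))) \<Longrightarrow> ev E I Z g \<le> ev E (I <+> J) (case_sum Z W) \<phi>"
proof -
  note DZ = ui_familyD[OF uiZ] and DW = ui_familyD[OF uiW]
  have finIJ: "finite (I <+> J)" using DZ DW by simp
  note lim\<phi> = ev_tendsto[OF E ui_family_case_sum[OF uiZ uiW] \<phi>]
  note limg = ev_tendsto[OF E uiZ g]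
  \<comment> \<open>\<open>G M\<close> is the conditional expectation of the function truncated at level \<open>M\<close>.\<close>
  define G where "G M x = law E J W (\<lambda>y. \<phi> (truncv M (case_sum x y)))" for M x
  note bs = bLip_section[OF DZ(2) DW(2) tame_bLip[OF \<phi>]]
  have indG: "law E (I <+> J) (case_sum Z W) (\<lambda>x. \<phi> (truncv M x)) = law E I Z (G M)" for M
    using ind tame_bLip[OF \<phi>, of M] unfolding indep_of_def law_def G_def by blast
  have bG: "bLip I (G M)" for M
  proof -
    obtain C L where CL: "C \<ge> 0" "L \<ge> 0" "\<And>x. \<bar>\<phi> (truncv M x)\<bar> \<le> C"
      "\<And>x y. \<bar>\<phi> (truncv M x) - \<phi> (truncv M y)\<bar> \<le> L * (\<Sum>i\<in>I <+> J. \<bar>x i - y i\<bar>)"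
      by (rule bLipE[OF finIJ tame_bLip[OF \<phi>, of M]]) (rule that)
    show ?thesis
    proof (rule bLipI[OF DZ(2), of _ C L])
      fix x
      have "law E J W (\<lambda>y. - C) \<le> G M x" "G M x \<le> law E J W (\<lambda>y. C)"
        unfolding G_def using CL(3) by (intro law_mono DW E bs bLip_const, simp add: abs_le_iff
            minus_le_iff)+
      then show "\<bar>G M x\<bar> \<le> C" unfolding law_const[OF DW(1) E] by linarith
    next
      have *: "G M x - G M x' \<le> L * (\<Sum>i\<in>I. \<bar>x i - x' i\<bar>)" for x x'
      proof -
        have "G M x - G M x' \<le> law Eh J W (\<lambda>y. \<phi> (truncv M (case_sum x y)) - \<phi> (truncv M (case_sum x' y)))"
          unfolding G_def by (intro law_diff_le DW E bs)
        also have "\<dots> \<le> law Eh J W (\<lambda>y. L * (\<Sum>i\<in>I. \<bar>x i - x' i\<bar>))"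
        proof (intro law_mono DW dom_exp_Eh bLip_diff bLip_const bs)
          fix y
          have "(\<Sum>i\<in>I <+> J. \<bar>case_sum x y i - case_sum x' y i\<bar>) = (\<Sum>i\<in>I. \<bar>x i - x' i\<bar>)"
            using DZ(2) DW(2) by (simp add: sum.Plus o_def)
          then show "\<phi> (truncv M (case_sum x y)) - \<phi> (truncv M (case_sum x' y))
              \<le> L * (\<Sum>i\<in>I. \<bar>x i - x' i\<bar>)"
            using CL(4)[of "case_sum x y" "case_sum x' y"] by simp
        qed
        finally show ?thesis unfolding law_const[OF DW(1) dom_exp_Eh] .
      qed
      show "\<bar>G M x - G M x'\<bar> \<le> L * (\<Sum>i\<in>I. \<bar>x i - x' i\<bar>)" for x x'
        using *[of x x'] *[of x' x] by (simp add: abs_le_iff abs_minus_commute)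
    qed
  qed
  obtain C where C: "C > 0" "\<And>x. \<bar>\<phi> x\<bar> \<le> C * (1 + growth (I <+> J) (case_sum e e') x)"
    by (rule tame_bound[OF \<phi>]) (rule that)
  define k where "k x = 1 + growth I e x" for x
  have k: "tame I e k" unfolding k_def by (intro tame_add tame_const tame_growth DZ)
  have kpos: "k x > 0" for x unfolding k_def using growth_nonneg[of I e x] by linarith
  \<comment> \<open>Truncating \<open>W\<close> costs an error proportional to the growth in \<open>x\<close>, with a factor
    independent of \<open>x\<close>.\<close>
  have close: "\<exists>M0. \<forall>M\<ge>M0. \<forall>x. \<bar>G M x - ev E J W (\<lambda>y. \<phi> (case_sum (truncv M x) y))\<bar>
      \<le> \<epsilon> * k (truncv M x)"
    if \<epsilon>: "\<epsilon> > 0" for \<epsilon>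
  proof -
    obtain M0 where M0: "\<And>M \<phi> a. M \<ge> M0 \<Longrightarrow> a > 0 \<Longrightarrow> tame J e' \<phi> \<Longrightarrow>
        (\<And>x. \<bar>\<phi> x\<bar> \<le> C * a * (1 + growth J e' x)) \<Longrightarrow>
        norm (val J W \<phi> - L1_blip H j J (\<lambda>x. \<phi> (truncv M x)) W) \<le> \<epsilon> * a"
      using val_uniform[OF uiW \<epsilon>, where C = C] by blast
    have "\<bar>G M x - ev E J W (\<lambda>y. \<phi> (case_sum (truncv M x) y))\<bar> \<le> \<epsilon> * k (truncv M x)" if M: "M \<ge> M0"
      for M x
    proof -
      let ?\<psi> = "\<lambda>y. \<phi> (case_sum (truncv M x) y)"
      note t = tame_section[OF DZ(2) DW(2) \<phi>, of M x]
      have "\<bar>G M x - ev E J W ?\<psi>\<bar>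
          \<le> norm (L1_blip H j J (\<lambda>y. \<phi> (truncv M (case_sum x y))) W - val J W ?\<psi>)"
        unfolding G_def law_def ev_def
        by (intro L1_exp_lipschitz E L1_blip_in_L1 DW bs val_in_L1[OF uiW t])
      also have "\<dots> = norm (val J W ?\<psi> - L1_blip H j J (\<lambda>y. ?\<psi> (truncv M y)) W)"
        unfolding truncv_case_sum by (rule norm_minus_commute)
      also have "\<dots> \<le> \<epsilon> * k (truncv M x)"
      proof (rule M0[OF M kpos t])
        fix y
        have "\<bar>?\<psi> y\<bar> \<le> C * (1 + (growth I e (truncv M x) + growth J e' y))"
          using C(2)[of "case_sum (truncv M x) y"] unfolding growth_case_sum[OF DZ(2) DW(2)] .
        also have "\<dots> \<le> C * (k (truncv M x) * (1 + growth J e' y))"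
          unfolding k_def using C(1) growth_nonneg[of I e "truncv M x"] growth_nonneg[of J e' y]
          by (intro mult_left_mono) (auto simp: algebra_simps)
        finally show "\<bar>?\<psi> y\<bar> \<le> C * k (truncv M x) * (1 + growth J e' y)" by (simp only: mult.assoc)
      qed
      finally show ?thesis .
    qed
    then show ?thesis by blast
  qed
  have k0: "ev Eh I Z k \<ge> 0"
    using ev_mono[OF uiZ dom_exp_Eh tame_const[OF DZ(2), of e 0] k] kpos ev_const[OF uiZ dom_exp_Eh,
        of 0]
    by (simp add: less_imp_le)
  have limk: "(\<lambda>M. \<epsilon> * law Eh I Z (\<lambda>x. k (truncv M x))) \<longlonglongrightarrow> \<epsilon> * ev Eh I Z k" for \<epsilon>
    by (intro tendsto_intros ev_tendsto[OF dom_exp_Eh uiZ k])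
  have compare: "law E I Z a \<le> law E I Z b + \<epsilon> * law Eh I Z (\<lambda>x. k (truncv M x))"
    if "bLip I a" "bLip I b" "\<epsilon> > 0" "\<And>x. a x \<le> b x + \<epsilon> * k (truncv M x)" for a b \<epsilon> M
  proof -
    have "law E I Z a - law E I Z b \<le> law Eh I Z (\<lambda>x. a x - b x)"
      by (intro law_diff_le DZ E that)
    also have "\<dots> \<le> law Eh I Z (\<lambda>x. \<epsilon> * k (truncv M x))"
      using that(4) by (intro law_mono DZ dom_exp_Eh bLip_diff that bLip_cmult tame_bLip[OF k])
        (simp add: algebra_simps)
    also have "\<dots> = \<epsilon> * law Eh I Z (\<lambda>x. k (truncv M x))"
      using that(3) by (intro law_cmult DZ tame_bLip[OF k]) simp
    finally show ?thesis by simp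
  qed
  {
    assume le: "\<And>x. ev E J W (\<lambda>y. \<phi> (case_sum x y)) \<le> g x"
    have "ev E (I <+> J) (case_sum Z W) \<phi> \<le> ev E I Z g + \<epsilon> * ev Eh I Z k" if \<epsilon>: "\<epsilon> > 0" for \<epsilon>
    proof -
      obtain M0 where M0: "\<And>M x. M \<ge> M0 \<Longrightarrow>
          \<bar>G M x - ev E J W (\<lambda>y. \<phi> (case_sum (truncv M x) y))\<bar> \<le> \<epsilon> * k (truncv M x)"
        using close[OF \<epsilon>] by blast
      show ?thesis
      proof (rule LIMSEQ_le[OF lim\<phi> tendsto_add[OF limg limk]], intro exI[of _ M0] allI impI)
        fix M assume M: "M \<ge> M0"
        show "law E (I <+> J) (case_sum Z W) (\<lambda>x. \<phi> (truncv M x))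
            \<le> law E I Z (\<lambda>x. g (truncv M x)) + \<epsilon> * law Eh I Z (\<lambda>x. k (truncv M x))"
          unfolding indG
        proof (rule compare[OF bG tame_bLip[OF g] \<epsilon>])
          show "G M x \<le> g (truncv M x) + \<epsilon> * k (truncv M x)" for x
            using M0[OF M, of x] le[of "truncv M x"] by linarith
        qed
      qed
    qed
    then show "ev E (I <+> J) (case_sum Z W) \<phi> \<le> ev E I Z g"
      using k0 by (rule field_le_multiple_epsilon)
  }
  {
    assume ge: "\<And>x. g x \<le> ev E J W (\<lambda>y. \<phi> (case_sum x y))"
    have "ev E I Z g \<le> ev E (I <+> J) (case_sum Z W) \<phi> + \<epsilon> * ev Eh I Z k" if \<epsilon>: "\<epsilon> > 0" for \<epsilon>
    proof -
      obtain M0 where M0: "\<And>M x. M \<ge> M0 \<Longrightarrow>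
          \<bar>G M x - ev E J W (\<lambda>y. \<phi> (case_sum (truncv M x) y))\<bar> \<le> \<epsilon> * k (truncv M x)"
        using close[OF \<epsilon>] by blast
      show ?thesis
      proof (rule LIMSEQ_le[OF limg tendsto_add[OF lim\<phi> limk]], intro exI[of _ M0] allI impI)
        fix M assume M: "M \<ge> M0"
        show "law E I Z (\<lambda>x. g (truncv M x))
            \<le> law E (I <+> J) (case_sum Z W) (\<lambda>x. \<phi> (truncv M x)) + \<epsilon> * law Eh I Z (\<lambda>x. k
                (truncv M x))"
          unfolding indG
        proof (rule compare[OF tame_bLip[OF g] bG \<epsilon>])
          show "g (truncv M x) \<le> G M x + \<epsilon> * k (truncv M x)" for x
            using M0[OF M, of x] ge[of "truncv M x"] by linarith
        qed
      qed
    qed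
    then show "ev E I Z g \<le> ev E (I <+> J) (case_sum Z W) \<phi>"
      using k0 by (rule field_le_multiple_epsilon)
  }
qed

end

section \<open>The functions of the statement\<close>

lemma L1_val_eq:
  assumes "has_L1_val H j \<psi> X y"
  shows "L1_val H j \<psi> X = y"
  using assms LIMSEQ_unique unfolding L1_val_def has_L1_val_def by (intro the_equality) blast+

lemma L1_blip_cong:
  assumes "\<And>i. i \<in> I \<Longrightarrow> Z i = Z' i"
  shows "L1_blip H j I \<phi> Z = L1_blip H j I \<phi> Z'"
  unfolding L1_blip_def using assms by (simp cong: ball_cong)

lemma tame_half_quadratic:
  "tame UNIV (\<lambda>_. 2) (\<lambda>x. 1/2 * ((A *v (\<chi> c. x c)) \<bullet> (\<chi> c. x c)))"
    for A :: "real ^ 'd ^ 'd"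
proof -
  have "(\<lambda>x. 1/2 * ((A *v (\<chi> c. x c)) \<bullet> (\<chi> c. x c)))
      = (\<lambda>x. \<Sum>a\<in>UNIV. \<Sum>b\<in>UNIV. (A $ a $ b / 2) * (x b * x a))"
    by (rule ext) (simp add: inner_vec_def matrix_vector_mult_def sum_distrib_left sum_distrib_right
        mult_ac sum_divide_distrib)
  then show ?thesis by (simp only:) (intro tame_sum tame_cmult tame_coord_prod, auto)
qed

lemma tame_norm: "tame UNIV (\<lambda>_. 1) (\<lambda>x. norm (\<chi> c::'d::finite. x c))"
proof (rule tameI[of _ _ 1])
  have n: "norm (\<chi> c. x c) \<le> (\<Sum>c\<in>UNIV. \<bar>x c\<bar>)" for x :: "'d \<Rightarrow> real"
    using norm_le_l1_cart[of "\<chi> c. x c"] by simp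
  show "bLip UNIV (\<lambda>x. norm (\<chi> c::'d. truncv M x c))" for M
  proof (rule bLipI[of _ _ "CARD('d) * real M" 1])
    fix x y :: "'d \<Rightarrow> real"
    have "norm (\<chi> c. truncv M x c) \<le> (\<Sum>c\<in>UNIV. \<bar>truncv M x c\<bar>)" by (rule n)
    also have "\<dots> \<le> CARD('d) * real M" unfolding truncv_def by (intro sum_bounded_above abs_trunc_le)
    finally show "\<bar>norm (\<chi> c. truncv M x c)\<bar> \<le> CARD('d) * real M" by simp
    have "\<bar>norm (\<chi> c. truncv M x c) - norm (\<chi> c. truncv M y c)\<bar>
        \<le> norm ((\<chi> c. truncv M x c) - (\<chi> c. truncv M y c))"
      by (rule norm_triangle_ineq3)
    also have "\<dots> = norm (\<chi> c. truncv M x c - truncv M y c)"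
      by (rule arg_cong[where f = norm]) (simp add: vec_eq_iff)
    also have "\<dots> \<le> (\<Sum>c\<in>UNIV. \<bar>truncv M x c - truncv M y c\<bar>)" by (rule n)
    also have "\<dots> \<le> (\<Sum>c\<in>UNIV. \<bar>x c - y c\<bar>)" unfolding truncv_def by (intro sum_mono trunc_lipschitz)
    finally show "\<bar>norm (\<chi> c. truncv M x c) - norm (\<chi> c. truncv M y c)\<bar>
        \<le> 1 * (\<Sum>c\<in>UNIV. \<bar>x c - y c\<bar>)" by simp
  qed simp
  show "\<bar>norm (\<chi> c. x c)\<bar> \<le> 1 * (1 + growth UNIV (\<lambda>_. 1) x)" for x :: "'d \<Rightarrow> real"
    using n[of x] unfolding growth_def by simp
qed

lemma norm_sq_coords: "(norm (\<chi> c. x c))\<^sup>2 = (\<Sum>c\<in>UNIV. x c * x c)" for x :: "'d::finite \<Rightarrow> real"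
  by (simp add: power2_norm_eq_inner inner_vec_def)

lemma tame_norm_sq: "tame UNIV (\<lambda>_. 2) (\<lambda>x. (norm (\<chi> c::'d::finite. x c))\<^sup>2)"
  unfolding norm_sq_coords by (intro tame_sum tame_coord_prod) auto

text \<open>A smooth upper bound of \<open>m \<mapsto> (m - N/2)\<^sup>+\<close>, vanishing at \<open>0\<close>, which makes a second-order
  expansion possible.\<close>

definition smooth_pos :: "real \<Rightarrow> real \<Rightarrow> real" where
  "smooth_pos N m = sqrt ((N / 2)\<^sup>2 + m\<^sup>2) - N / 2"

lemma smooth_pos_0: "N > 0 \<Longrightarrow> smooth_pos N 0 = 0"
  by (simp add: smooth_pos_def)

lemma pos_part_le_smooth_pos:
  assumes "N > 0"
  shows "max (m - N / 2) 0 \<le> smooth_pos N m"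
proof -
  have "m \<le> sqrt ((N / 2)\<^sup>2 + m\<^sup>2)" by (rule real_le_rsqrt) simp
  moreover have "N / 2 \<le> sqrt ((N / 2)\<^sup>2 + m\<^sup>2)" by (rule real_le_rsqrt) simp
  ultimately show ?thesis unfolding smooth_pos_def by simp
qed

lemma smooth_pos_lipschitz: "\<bar>smooth_pos N s - smooth_pos N t\<bar> \<le> 1 * \<bar>s - t\<bar>"
proof -
  have eq: "smooth_pos N r = norm (N / 2, r) - N / 2" for r
    by (simp add: smooth_pos_def norm_Pair power_divide)
  have "\<bar>norm (N / 2, s) - norm (N / 2, t)\<bar> \<le> norm ((N / 2, s) - (N / 2, t))"
    by (rule norm_triangle_ineq3)
  then show ?thesis unfolding eq by (simp add: norm_Pair power_divide)
qed

text \<open>Second-order expansion; the remainder is bounded since the second derivative is at most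
  \<open>2/N\<close>. It follows from concavity of the square root, \<open>sqrt (a\<^sup>2 + r) \<le> a + r/(2a)\<close>, and \<open>a \<ge> N/2\<close>.\<close>

lemma smooth_pos_add_le:
  assumes "N > 0"
  shows "smooth_pos N (m + h) \<le> smooth_pos N m + m / sqrt ((N / 2)\<^sup>2 + m\<^sup>2) * h + h\<^sup>2 / N"
proof -
  define a where "a = sqrt ((N / 2)\<^sup>2 + m\<^sup>2)"
  have a: "a \<ge> N / 2" unfolding a_def by (rule real_le_rsqrt) simp
  then have a0: "a > 0" using assms by simp
  have a2: "a\<^sup>2 = (N / 2)\<^sup>2 + m\<^sup>2" unfolding a_def by simp
  define u where "u = (2 * m * h + h\<^sup>2) / (2 * a)"
  have u: "2 * a * u = 2 * m * h + h\<^sup>2" unfolding u_def using a0 by simp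
  have "sqrt ((N / 2)\<^sup>2 + (m + h)\<^sup>2) \<le> a + u"
  proof (rule real_le_lsqrt)
    have "2 * a * (a + u) = a\<^sup>2 + (N / 2)\<^sup>2 + (m + h)\<^sup>2"
      using u a2 by (simp add: power2_eq_square algebra_simps)
    also have "\<dots> \<ge> 0" by simp
    finally show "a + u \<ge> 0" using a0 by (simp add: zero_le_mult_iff)
    have "(N / 2)\<^sup>2 + (m + h)\<^sup>2 = a\<^sup>2 + 2 * a * u"
      unfolding u a2 by (simp add: power2_sum)
    also have "\<dots> \<le> (a + u)\<^sup>2" by (simp add: power2_sum)
    finally show "(N / 2)\<^sup>2 + (m + h)\<^sup>2 \<le> (a + u)\<^sup>2" .
  qed
  also have "\<dots> = a + m / a * h + h\<^sup>2 / (2 * a)"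
    unfolding u_def using a0 by (simp add: field_simps)
  also have "h\<^sup>2 / (2 * a) \<le> h\<^sup>2 / N" using a assms by (intro divide_left_mono) auto
  finally show ?thesis unfolding smooth_pos_def a_def by simp
qed

lemma pos_part_sum_le:
  fixes a :: "nat \<Rightarrow> real"
  assumes "k \<ge> 1"
  shows "max ((\<Sum>m=1..k. a m) - B) 0 \<le> (\<Sum>m=1..k. 1 / real k * max (real k * a m - B) 0)"
proof -
  have "(\<Sum>m=1..k. a m) - B = (\<Sum>m=1..k. 1 / real k * (real k * a m - B))"
    using assms by (simp add: sum_subtractf right_diff_distrib)
  also have "\<dots> \<le> (\<Sum>m=1..k. 1 / real k * max (real k * a m - B) 0)"
    by (intro sum_mono mult_left_mono) auto
  finally show ?thesis by (simp add: sum_nonneg)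
qed

text \<open>Quadratic exponents for the components of \<open>X\<close>, linear ones for those of \<open>Y\<close>.\<close>

definition xy_exponent :: "'d + 'd \<Rightarrow> nat" where
  "xy_exponent = case_sum (\<lambda>_. 2) (\<lambda>_. 1)"

definition row_exponent :: "nat \<times> ('d + 'd) \<Rightarrow> nat" where
  "row_exponent = (\<lambda>(m, c). xy_exponent c)"

text \<open>The components of the first \<open>k\<close> vectors \<open>(X\<^sub>m, Y\<^sub>m)\<close> of a row are indexed by pairs of \<open>m\<close>
  and a component of the \<open>2d\<close>-dimensional vector.\<close>

definition row_index :: "nat \<Rightarrow> (nat \<times> ('d + 'd)) set" where
  "row_index k = {1..k} \<times> UNIV"

text \<open>The sum of the first \<open>k\<close> vectors.\<close>

definition row_total :: "nat \<Rightarrow> (nat \<times> ('d + 'd) \<Rightarrow> real) \<Rightarrow> 'd + 'd \<Rightarrow> real" where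
  "row_total k x = (\<lambda>c. \<Sum>m=1..k. x (m, c))"

text \<open>The first \<open>k\<close> vectors from \<open>x\<close>, followed by the vector \<open>w\<close>.\<close>

definition append_row ::
  "nat \<Rightarrow> (nat \<times> ('d + 'd) \<Rightarrow> real) \<Rightarrow> ('d + 'd \<Rightarrow> real) \<Rightarrow> nat \<times> ('d + 'd) \<Rightarrow> real" where
  "append_row k x w = (\<lambda>(m, c). if m \<le> k then x (m, c) else w c)"

lemma xy_exponent_ge_1: "xy_exponent c \<ge> 1" "Suc 0 \<le> xy_exponent c" unfolding xy_exponent_def
  by (cases c; simp)+

lemma row_exponent_ge_1: "Suc 0 \<le> row_exponent i" unfolding row_exponent_def using xy_exponent_ge_1
  by (cases i) auto

lemma finite_row_index: "finite (row_index k :: (nat \<times> ('d::finite + 'd)) set)"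
  unfolding row_index_def by simp

lemma row_total_append: "row_total (Suc k) (append_row k x w) = (\<lambda>c. row_total k x c + w c)"
  unfolding row_total_def append_row_def by (auto intro!: sum.cong)

lemma tame_row_total: "tame UNIV xy_exponent \<phi> \<Longrightarrow>
    tame (row_index k) row_exponent (\<lambda>x. \<phi> (row_total k x))"
  for \<phi> :: "('d::finite + 'd \<Rightarrow> real) \<Rightarrow> real"
  unfolding row_total_def
  by (rule tame_sums[where J = UNIV and e' = xy_exponent]) (auto simp: finite_row_index
      row_index_def row_exponent_def xy_exponent_ge_1)

lemma tame_row: "tame UNIV xy_exponent \<phi> \<Longrightarrow> m \<in> {1..k} \<Longrightarrow>
    tame (row_index k) row_exponent (\<lambda>x. \<phi> (\<lambda>c. x (m, c)))"
  for \<phi> :: "('d::finite + 'd \<Rightarrow> real) \<Rightarrow> real"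
  using tame_sums[where J = UNIV and e' = xy_exponent and A = "{()}" and I = "row_index k" and e =
      row_exponent
      and g = "\<lambda>_ c. (m, c)" and \<phi> = \<phi>]
  by (auto simp: finite_row_index row_index_def row_exponent_def xy_exponent_ge_1)

lemma tame_left:
  fixes \<psi> :: "real ^ 'd \<Rightarrow> real"
  assumes "tame UNIV (\<lambda>_. 2) (\<lambda>x. \<psi> (\<chi> c. x c))"
  shows "tame UNIV xy_exponent (\<lambda>y. \<psi> (\<chi> c. y (Inl c)))"
  using tame_sums[where J = UNIV and e' = "\<lambda>_. 2" and A = "{()}" and I = UNIV and e = xy_exponent
      and g = "\<lambda>_. Inl" and \<phi> = "\<lambda>x. \<psi> (\<chi> c. x c)"] assms by (auto simp: xy_exponent_def)

lemma tame_right: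
  fixes \<psi> :: "real ^ 'd \<Rightarrow> real"
  assumes "tame UNIV (\<lambda>_. 1) (\<lambda>x. \<psi> (\<chi> c. x c))"
  shows "tame UNIV xy_exponent (\<lambda>y. \<psi> (\<chi> c. y (Inr c)))"
  using tame_sums[where J = UNIV and e' = "\<lambda>_. 1" and A = "{()}" and I = UNIV and e = xy_exponent
      and g = "\<lambda>_. Inr" and \<phi> = "\<lambda>x. \<psi> (\<chi> c. x c)"] assms by (auto simp: xy_exponent_def)

text \<open>The functions of a \<open>2d\<close>-dimensional vector that underlie \<open>quad_lin\<close>, \<open>excess\<close> and the
  second moment of \<open>X\<close>.\<close>

definition quad_fun :: "real ^ 'd ^ 'd \<Rightarrow> real ^ 'd \<Rightarrow> ('d::finite + 'd \<Rightarrow> real) \<Rightarrow> real" where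
  "quad_fun A p y = 1/2 * ((A *v (\<chi> c. y (Inl c))) \<bullet> (\<chi> c. y (Inl c)))
      + (\<Sum>c\<in>UNIV. p $ c * y (Inr c))"

definition excess_fun :: "real \<Rightarrow> real \<Rightarrow> real \<Rightarrow> ('d::finite + 'd \<Rightarrow> real) \<Rightarrow> real" where
  "excess_fun a M N y = max (a * (norm (\<chi> c. y (Inl c)))\<^sup>2 - M) 0
      + max (a * norm (\<chi> c. y (Inr c)) - N) 0"

definition sq_norm_fun :: "('d::finite + 'd \<Rightarrow> real) \<Rightarrow> real" where
  "sq_norm_fun y = (norm (\<chi> c. y (Inl c)))\<^sup>2"

lemma tame_linear: "tame UNIV xy_exponent (\<lambda>y. \<Sum>c\<in>UNIV. p $ c * y (Inr c))"
  "tame UNIV xy_exponent (\<lambda>y. \<Sum>c\<in>UNIV. p $ c * y (Inl c))" for p :: "real ^ 'd"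
  by (intro tame_sum tame_cmult tame_coord; simp add: xy_exponent_def)+

lemma tame_sq_norm_fun: "tame UNIV xy_exponent (sq_norm_fun :: ('d::finite + 'd \<Rightarrow> real) \<Rightarrow> real)"
  unfolding sq_norm_fun_def[abs_def] by (rule tame_left[OF tame_norm_sq])

lemma tame_quad_fun: "tame UNIV xy_exponent (quad_fun A p)"
  unfolding quad_fun_def[abs_def] by (intro tame_add tame_left[OF tame_half_quadratic] tame_linear
      finite)

lemma tame_excess_norm_sq: "tame UNIV (\<lambda>_. 2) (\<lambda>x. max (a * (norm (\<chi> c::'d::finite. x c))\<^sup>2 - M) 0)"
  by (intro tame_pospart tame_diff tame_cmult tame_const tame_norm_sq finite)

lemma tame_excess_norm: "tame UNIV (\<lambda>_. 1) (\<lambda>x. max (a * norm (\<chi> c::'d::finite. x c) - M) 0)"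
  by (intro tame_pospart tame_diff tame_cmult tame_const tame_norm finite)

lemma tame_excess_fun: "tame UNIV xy_exponent (excess_fun a M N :: ('d::finite + 'd \<Rightarrow> real) \<Rightarrow> real)"
  unfolding excess_fun_def[abs_def]
  by (intro tame_add tame_left[OF tame_excess_norm_sq] tame_right[OF tame_excess_norm] finite)

lemma quad_fun_add:
  assumes "transpose A = A"
  shows "quad_fun A p (\<lambda>c. y c + w c)
    = quad_fun A p w + (\<Sum>c\<in>UNIV. (A *v (\<chi> c. y (Inl c))) $ c * w (Inl c)) + quad_fun A p y"
proof -
  let ?y = "\<chi> c. y (Inl c)" and ?w = "\<chi> c. w (Inl c)"
  have v: "(\<chi> c. y (Inl c) + w (Inl c)) = ?y + ?w" by (simp add: vec_eq_iff)
  have "(A *v ?w) \<bullet> ?y = (A *v ?y) \<bullet> ?w"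
    using dot_lmul_matrix[of ?y A ?w] assms by (metis inner_commute transpose_matrix_vector)
  then have "(A *v (?y + ?w)) \<bullet> (?y + ?w) = (A *v ?y) \<bullet> ?y + 2 * ((A *v ?y) \<bullet> ?w) + (A *v ?w) \<bullet> ?w"
    by (simp add: matrix_vector_right_distrib inner_add_left inner_add_right)
  moreover have "(A *v ?y) \<bullet> ?w = (\<Sum>c\<in>UNIV. (A *v ?y) $ c * w (Inl c))" by (simp add: inner_vec_def)
  ultimately show ?thesis unfolding quad_fun_def v
    by (simp add: sum.distrib distrib_left)
qed

lemma quad_fun_2: "quad_fun (2 *\<^sub>R mat 1) 0 = sq_norm_fun"
  by (rule ext) (simp add: quad_fun_def sq_norm_fun_def power2_norm_eq_inner flip:
      scaleR_matrix_vector_assoc)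

text \<open>The off-diagonal part of \<open>\<bar>\<Sum>x\<^sub>m\<bar>\<^sup>2\<close>.\<close>

definition cross :: "nat \<Rightarrow> (nat \<times> ('d::finite + 'd) \<Rightarrow> real) \<Rightarrow> real" where
  "cross k x = sq_norm_fun (row_total k x) - (\<Sum>m=1..k. sq_norm_fun (\<lambda>c. x (m, c)))"

lemma cross_append_row: "cross (Suc k) (append_row k x w)
    = cross k x + 2 * ((\<chi> c. row_total k x (Inl c)) \<bullet> (\<chi> c. w (Inl c)))"
proof -
  have v: "(\<chi> c. row_total k x (Inl c) + w (Inl c))
      = (\<chi> c. row_total k x (Inl c)) + (\<chi> c. w (Inl c))"
    by (simp add: vec_eq_iff)
  have s: "(\<Sum>m=1..k. sq_norm_fun (\<lambda>c. append_row k x w (m, c)))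
      = (\<Sum>m=1..k. sq_norm_fun (\<lambda>c. x (m, c)))"
    by (intro sum.cong refl) (simp add: append_row_def)
  have l: "sq_norm_fun (\<lambda>c. append_row k x w (Suc k, c)) = sq_norm_fun w"
    by (simp add: append_row_def)
  show ?thesis unfolding cross_def row_total_append using s l
    by (simp add: sq_norm_fun_def v power2_norm_eq_inner inner_add_left inner_add_right
        inner_commute)
qed

lemma tame_cross: "tame (row_index k) row_exponent (cross k)"
  unfolding cross_def[abs_def]
  by (intro tame_diff tame_sum tame_row_total tame_row tame_sq_norm_fun finite_row_index)

lemma excess_fun_total_le:
  assumes "k \<ge> 1" "N > 0"
  shows "excess_fun 1 N N (row_total k x)
    \<le> (\<Sum>m=1..k. 1 / real k * excess_fun (real k) (N / 2) N (\<lambda>c. x (m, c))) + smooth_pos N (cross k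
        x)"
proof -
  let ?a = "\<lambda>m. sq_norm_fun (\<lambda>c. x (m, c))" and ?b = "\<lambda>m. norm (\<chi> c. x (m, Inr c))"
  have "max (1 * (norm (\<chi> c. row_total k x (Inl c)))\<^sup>2 - N) 0
      = max (((\<Sum>m=1..k. ?a m) - N / 2) + (cross k x - N / 2)) 0"
    unfolding cross_def sq_norm_fun_def by simp
  also have "\<dots> \<le> max ((\<Sum>m=1..k. ?a m) - N / 2) 0 + max (cross k x - N / 2) 0" by linarith
  also have "\<dots> \<le> (\<Sum>m=1..k. 1 / real k * max (real k * ?a m - N / 2) 0) + smooth_pos N (cross k x)"
    by (intro add_mono pos_part_sum_le assms pos_part_le_smooth_pos)
  finally have 1: "max (1 * (norm (\<chi> c. row_total k x (Inl c)))\<^sup>2 - N) 0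
    \<le> (\<Sum>m=1..k. 1 / real k * max (real k * ?a m - N / 2) 0) + smooth_pos N (cross k x)" .
  have "(\<chi> c. row_total k x (Inr c)) = (\<Sum>m=1..k. \<chi> c. x (m, Inr c))"
    by (simp add: vec_eq_iff row_total_def)
  then have "norm (\<chi> c. row_total k x (Inr c)) \<le> (\<Sum>m=1..k. ?b m)" by (simp add: norm_sum)
  then have "max (1 * norm (\<chi> c. row_total k x (Inr c)) - N) 0 \<le> max ((\<Sum>m=1..k. ?b m) - N) 0"
    by simp
  also have "\<dots> \<le> (\<Sum>m=1..k. 1 / real k * max (real k * ?b m - N) 0)"
    by (intro pos_part_sum_le assms)
  finally have 2: "max (1 * norm (\<chi> c. row_total k x (Inr c)) - N) 0 \<le> \<dots>" .
  show ?thesis using add_mono[OF 1 2] unfolding excess_fun_def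
    by (simp add: distrib_left sum.distrib add_divide_distrib sq_norm_fun_def)
qed

section \<open>One row of the array\<close>

text \<open>A single row of the array, \<open>n\<close> being its length. Identical distribution and independence
  are required under \<open>Eh\<close> only; other expectations with these properties are singled out by
  \<open>iid_exp\<close>.\<close>

locale iid_row = sublin_completion H Eh j
  for H :: "('w \<Rightarrow> real) set" and Eh :: "('w \<Rightarrow> real) \<Rightarrow> real"
    and j :: "('w \<Rightarrow> real) \<Rightarrow> 'l::banach" +
  fixes X Y :: "nat \<Rightarrow> 'l ^ 'd" and n :: nat
  assumes XY_L1: "\<And>i c. i \<in> {1..n} \<Longrightarrow> X i $ c \<in> L1 H j \<and> Y i $ c \<in> L1 H j"
    and XY_in: "\<And>i. i \<in> {1..n} \<Longrightarrow> in_L1 H j (\<lambda>x. (norm x)\<^sup>2) (X i) \<and> in_L1 H j norm (Y i)"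
    and same: "\<And>i. 2 \<le> i \<Longrightarrow> i \<le> n \<Longrightarrow> same_law H j Eh UNIV (joint (X i) (Y i)) (joint (X 1) (Y 1))"
    and indep: "\<And>i. 2 \<le> i \<Longrightarrow> i \<le> n \<Longrightarrow> indep_of H j Eh UNIV (joint (X i) (Y i))
             ({1..<i} \<times> UNIV) (\<lambda>(m, c). joint (X m) (Y m) c)"
    and centred: "\<And>c. n \<ge> 1 \<Longrightarrow> L1_exp H j Eh (X 1 $ c) = 0 \<and> L1_exp H j Eh (- X 1 $ c) = 0"
begin

abbreviation W :: "nat \<Rightarrow> 'd + 'd \<Rightarrow> 'l" where
  "W i \<equiv> joint (X i) (Y i)"

text \<open>All components of the row as one family.\<close>

definition Z :: "nat \<times> ('d + 'd) \<Rightarrow> 'l" where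
  "Z = (\<lambda>(m, c). W m c)"

text \<open>The dominated expectations under which the row is identically distributed and each vector
  is independent of its predecessors.\<close>

definition iid_exp :: "(('w \<Rightarrow> real) \<Rightarrow> real) \<Rightarrow> bool" where
  "iid_exp E \<longleftrightarrow> dom_exp E \<and>
    (\<forall>i. 2 \<le> i \<longrightarrow> i \<le> n \<longrightarrow> same_law H j E UNIV (W i) (W 1) \<and>
      indep_of H j E UNIV (W i) ({1..<i} \<times> UNIV) (\<lambda>(m, c). W m c))"

lemma iid_exp_Eh: "iid_exp Eh"
  unfolding iid_exp_def using dom_exp_Eh same indep by blast

lemma iid_exp_dom: "iid_exp E \<Longrightarrow> dom_exp E"
  unfolding iid_exp_def by blast

lemma fam_W: "i \<in> {1..n} \<Longrightarrow> L1_family UNIV (W i)"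
  unfolding L1_family_def joint_def using XY_L1 by (auto split: sum.split)

lemma ui_W:
  assumes i: "i \<in> {1..n}"
  shows "ui_family UNIV xy_exponent (W i)"
proof -
  have fX: "L1_family UNIV (\<lambda>c. X i $ c)" and fY: "L1_family UNIV (\<lambda>c. Y i $ c)"
    using XY_L1[OF i] unfolding L1_family_def by auto
  obtain y where y: "(\<lambda>M. L1_blip H j UNIV (\<lambda>x. (norm (\<chi> c. trunc M (x c)))\<^sup>2) (\<lambda>c. X i $ c)) \<longlonglongrightarrow> y"
    using XY_in[OF i] unfolding in_L1_def has_L1_val_def by blast
  then have y': "(\<lambda>M. L1_blip H j UNIV (\<lambda>x. (norm (\<chi> c. truncv M x c))\<^sup>2) (\<lambda>c. X i $ c)) \<longlonglongrightarrow> y"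
    unfolding truncv_def .
  have "\<bar>x c\<bar> \<le> norm (\<chi> c. x c)" for x :: "'d \<Rightarrow> real" and c
    using component_le_norm_cart[of "\<chi> c. x c" c] by simp
  then have le: "\<bar>x c\<bar> ^ 2 \<le> (norm (\<chi> c. x c))\<^sup>2" "\<bar>x c\<bar> ^ 1 \<le> norm (\<chi> c. x c)"
    for x :: "'d \<Rightarrow> real" and c
    by (intro power_mono, auto)
  have uX: "unif_int 2 (X i $ c)" for c
    by (rule unif_intI[OF fX UNIV_I tame_bLip[OF tame_norm_sq] y' le(1)])
  obtain z where z: "(\<lambda>M. L1_blip H j UNIV (\<lambda>x. norm (\<chi> c. trunc M (x c))) (\<lambda>c. Y i $ c)) \<longlonglongrightarrow> z"
    using XY_in[OF i] unfolding in_L1_def has_L1_val_def by blast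
  then have z': "(\<lambda>M. L1_blip H j UNIV (\<lambda>x. norm (\<chi> c. truncv M x c)) (\<lambda>c. Y i $ c)) \<longlonglongrightarrow> z"
    unfolding truncv_def .
  have uY: "unif_int 1 (Y i $ c)" for c
    by (rule unif_intI[OF fY UNIV_I tame_bLip[OF tame_norm] z' le(2)])
  show ?thesis unfolding ui_family_def using fam_W[OF i] uX uY
    by (auto simp: xy_exponent_def joint_def split: sum.split)
qed

lemma ui_Z: "k \<le> n \<Longrightarrow> ui_family (row_index k) row_exponent Z"
  using ui_W fam_W unfolding ui_family_def L1_family_def
  by (auto simp: row_index_def row_exponent_def Z_def xy_exponent_ge_1)

lemma val_row:
  assumes "k \<le> n" "m \<in> {1..k}" "tame UNIV xy_exponent \<phi>"
  shows "val (row_index k) Z (\<lambda>x. \<phi> (\<lambda>c. x (m, c))) = val UNIV (W m) \<phi>"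
  using val_reindex[OF ui_familyD(1)[OF ui_Z[OF assms(1)]] finite assms(3), of "Pair m"] assms(2)
  by (simp add: row_index_def Z_def)

lemma val_coord_W:
  assumes i: "i \<in> {1..n}"
  shows "val UNIV (W i) (\<lambda>x. x c) = W i c"
proof (rule val_eq_lim[OF ui_W[OF i]])
  show "tame UNIV xy_exponent (\<lambda>x. x c)" by (intro tame_coord xy_exponent_ge_1(1)) auto
  show "(\<lambda>M. L1_blip H j UNIV (\<lambda>x. truncv M x c) (W i)) \<longlonglongrightarrow> W i c"
  proof (cases c)
    case (Inl a)
    have "(\<lambda>M. L1_blip H j UNIV (\<lambda>x. trunc M (x a)) (\<lambda>c. W i (Inl c))) \<longlonglongrightarrow> W i (Inl a)"
      using XY_in[OF i] unfolding in_L1_def has_L1_val_def joint_def by auto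
    then show ?thesis unfolding Inl truncv_def
      using L1_blip_reindex(1)[OF fam_W[OF i] finite bLip_trunc_coord[OF finite UNIV_I], where g =
          Inl]
      by simp
  next
    case (Inr a)
    have "(\<lambda>M. L1_blip H j UNIV (\<lambda>x. trunc M (x a)) (\<lambda>c. W i (Inr c))) \<longlonglongrightarrow> W i (Inr a)"
      using XY_in[OF i] unfolding in_L1_def has_L1_val_def joint_def by auto
    then show ?thesis unfolding Inr truncv_def
      using L1_blip_reindex(1)[OF fam_W[OF i] finite bLip_trunc_coord[OF finite UNIV_I], where g =
          Inr]
      by simp
  qed
qed

lemma val_row_total_coord:
  assumes "k \<le> n"
  shows "val (row_index k) Z (\<lambda>x. row_total k x c) = (\<Sum>m=1..k. W m c)"
proof -
  have t: "tame UNIV xy_exponent (\<lambda>x. x c)" by (intro tame_coord xy_exponent_ge_1(1)) auto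
  have "val (row_index k) Z (\<lambda>x. row_total k x c) = (\<Sum>m=1..k. val (row_index k) Z (\<lambda>x. x (m, c)))"
    unfolding row_total_def by (rule val_sum[OF ui_Z[OF assms]]) (rule tame_row[OF t])
  also have "\<dots> = (\<Sum>m=1..k. W m c)"
    using assms by (intro sum.cong refl) (subst val_row[OF assms _ t], auto simp: val_coord_W)
  finally show ?thesis .
qed

text \<open>The map \<open>emb\<close> selects the half of the \<open>2d\<close> components to which \<open>\<psi>\<close> is applied; it is \<open>Inl\<close>
  for \<open>X\<close> and \<open>Inr\<close> for \<open>Y\<close>.\<close>

lemma L1_val_row_total:
  fixes emb :: "'d \<Rightarrow> 'd + 'd"
  assumes k: "k \<le> n" and p: "\<And>c. xy_exponent (emb c) = p" "p \<ge> 1"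
    and V: "\<And>c. V $ c = (\<Sum>m=1..k. W m (emb c))"
    and \<psi>: "tame UNIV (\<lambda>_. p) (\<lambda>x. \<psi> (\<chi> c. x c))"
  shows "L1_val H j \<psi> V = val (row_index k) Z (\<lambda>x. \<psi> (\<chi> c. row_total k x (emb c)))"
proof (rule L1_val_eq)
  have VZ: "(\<lambda>c. V $ c) = (\<lambda>c. \<Sum>m\<in>{1..k}. Z (m, emb c))" by (simp add: V Z_def)
  have sums: "(\<lambda>M. L1_blip H j UNIV (\<lambda>y. \<phi> (truncv M y)) (\<lambda>c. V $ c))
      \<longlonglongrightarrow> val (row_index k) Z (\<lambda>x. \<phi> (\<lambda>c. row_total k x (emb c)))" if "tame UNIV (\<lambda>_. p) \<phi>" for \<phi>
    unfolding VZ row_total_def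
    by (rule val_sums[OF ui_Z[OF k], where e' = "\<lambda>_. p" and g = "\<lambda>m c. (m, emb c)"])
      (use p that in \<open>auto simp: row_index_def row_exponent_def\<close>)
  show "has_L1_val H j \<psi> V (val (row_index k) Z (\<lambda>x. \<psi> (\<chi> c. row_total k x (emb c))))"
    unfolding has_L1_val_def
  proof (intro conjI allI)
    fix c
    have "tame UNIV (\<lambda>_. p) (\<lambda>x::'d \<Rightarrow> real. x c)" using p by (intro tame_coord) auto
    from sums[OF this] show "(\<lambda>M. L1_blip H j UNIV (\<lambda>x. trunc M (x c)) (\<lambda>i. V $ i)) \<longlonglongrightarrow> V $ c"
      unfolding val_row_total_coord[OF k] V[symmetric] truncv_def .
  next
    show "(\<lambda>M. L1_blip H j UNIV (\<lambda>x. \<psi> (\<chi> i. trunc M (x i))) (\<lambda>i. V $ i))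
      \<longlonglongrightarrow> val (row_index k) Z (\<lambda>x. \<psi> (\<chi> c. row_total k x (emb c)))"
      using sums[OF \<psi>] unfolding truncv_def .
  qed
qed

lemma L1_val_sum_X:
  assumes "k \<le> n" "tame UNIV (\<lambda>_. 2) (\<lambda>x. \<psi> (\<chi> c. x c))"
  shows "L1_val H j \<psi> (\<Sum>i=1..k. X i) = val (row_index k) Z (\<lambda>x. \<psi> (\<chi> c. row_total k x (Inl c)))"
  by (rule L1_val_row_total[OF assms(1) _ _ _ assms(2)]) (auto simp: xy_exponent_def joint_def)

lemma L1_val_sum_Y:
  assumes "k \<le> n" "tame UNIV (\<lambda>_. 1) (\<lambda>x. \<psi> (\<chi> c. x c))"
  shows "L1_val H j \<psi> (\<Sum>i=1..k. Y i) = val (row_index k) Z (\<lambda>x. \<psi> (\<chi> c. row_total k x (Inr c)))"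
  by (rule L1_val_row_total[OF assms(1) _ _ _ assms(2)]) (auto simp: xy_exponent_def joint_def)

lemma quad_lin_eq_val:
  assumes k: "k \<le> n"
  shows "quad_lin H j A p (\<Sum>i=1..k. X i) (\<Sum>i=1..k. Y i)
      = val (row_index k) Z (\<lambda>x. quad_fun A p (row_total k x))"
proof -
  have tc: "tame UNIV xy_exponent (\<lambda>y. y (Inr c))" for c :: 'd
    by (intro tame_coord xy_exponent_ge_1(1)) auto
  have "(\<Sum>c\<in>UNIV. p $ c *\<^sub>R (\<Sum>i=1..k. Y i) $ c)
      = (\<Sum>c\<in>UNIV. val (row_index k) Z (\<lambda>x. p $ c * row_total k x (Inr c)))"
    by (intro sum.cong refl)
      (simp add: val_cmult[OF ui_Z[OF k] tame_row_total[OF tc]] val_row_total_coord[OF k] joint_def)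
  also have "\<dots> = val (row_index k) Z (\<lambda>x. \<Sum>c\<in>UNIV. p $ c * row_total k x (Inr c))"
    by (rule val_sum[OF ui_Z[OF k], symmetric]) (intro tame_cmult finite_row_index
        tame_row_total[OF tc])
  finally have lin: "(\<Sum>c\<in>UNIV. p $ c *\<^sub>R (\<Sum>i=1..k. Y i) $ c)
      = val (row_index k) Z (\<lambda>x. \<Sum>c\<in>UNIV. p $ c * row_total k x (Inr c))" .
  show ?thesis
    unfolding quad_lin_def L1_val_sum_X[OF k tame_half_quadratic] quad_fun_def lin
    by (rule val_add[OF ui_Z[OF k] tame_row_total[OF tame_left[OF tame_half_quadratic]]
          tame_row_total[OF tame_linear(1)], symmetric])
qed

lemma excess_eq_val:
  assumes k: "k \<le> n"
  shows "excess H j a M N (\<Sum>i=1..k. X i) (\<Sum>i=1..k. Y i)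
      = val (row_index k) Z (\<lambda>x. excess_fun a M N (row_total k x))"
  unfolding excess_def L1_val_sum_X[OF k tame_excess_norm_sq] L1_val_sum_Y[OF k tame_excess_norm]
      excess_fun_def
  by (rule val_add[OF ui_Z[OF k] tame_row_total[OF tame_left[OF tame_excess_norm_sq]]
        tame_row_total[OF tame_right[OF tame_excess_norm]], symmetric])

lemma val_row_total_1: "n \<ge> 1 \<Longrightarrow> tame UNIV xy_exponent \<phi> \<Longrightarrow>
    val (row_index 1) Z (\<lambda>x. \<phi> (row_total 1 x)) = val UNIV (W 1) \<phi>"
  using val_row[of 1 1 \<phi>] unfolding row_total_def by simp

lemma ev_W:
  assumes "iid_exp E" "i \<in> {1..n}" "tame UNIV xy_exponent \<phi>"
  shows "ev E UNIV (W i) \<phi> = ev E UNIV (W 1) \<phi>"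
proof (cases "i = 1")
  case False
  then have "same_law H j E UNIV (W i) (W 1)" using assms(1,2) unfolding iid_exp_def by auto
  then show ?thesis
    using assms(2) by (intro ev_same_law[OF iid_exp_dom[OF assms(1)] ui_W ui_W _ assms(3)]) auto
qed simp

text \<open>One conditioning step along the row.\<close>

lemma ev_append_row:
  assumes E: "iid_exp E" and k: "k \<ge> 1" "k < n"
    and \<phi>: "tame (row_index (Suc k)) row_exponent \<phi>" and g: "tame (row_index k) row_exponent g"
  shows "(\<And>x. ev E UNIV (W (Suc k)) (\<lambda>w. \<phi> (append_row k x w)) \<le> g x) \<Longrightarrow>
      ev E (row_index (Suc k)) Z \<phi> \<le> ev E (row_index k) Z g"
    and "(\<And>x. g x \<le> ev E UNIV (W (Suc k)) (\<lambda>w. \<phi> (append_row k x w))) \<Longrightarrow>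
        ev E (row_index k) Z g \<le> ev E (row_index (Suc k)) Z \<phi>"
proof -
  \<comment> \<open>The independence hypothesis lives on a disjoint sum of index sets, with which \<open>h\<close>
    identifies the pairs.\<close>
  define h :: "nat \<times> ('d + 'd) \<Rightarrow> (nat \<times> ('d + 'd)) + ('d + 'd)"
    where "h = (\<lambda>(m, c). if m \<le> k then Inl (m, c) else Inr c)"
  define \<phi>' where "\<phi>' u = \<phi> (\<lambda>i. u (h i))" for u
  have uiZ: "ui_family (row_index k) row_exponent Z"
      and uiW: "ui_family UNIV xy_exponent (W (Suc k))"
    using ui_Z ui_W k by auto
  have h: "h i \<in> row_index k <+> UNIV" if "i \<in> row_index (Suc k)" for i
    using that unfolding h_def row_index_def by auto
  have eh: "case_sum row_exponent xy_exponent (h i) = row_exponent i" for i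
    unfolding h_def row_exponent_def by (auto split: prod.split)
  have \<phi>': "tame (row_index k <+> UNIV) (case_sum row_exponent xy_exponent) \<phi>'"
    using tame_sums[where J = "row_index (Suc k)" and e' = row_exponent and A = "{()}" and I =
        "row_index k <+> UNIV"
        and e = "case_sum row_exponent xy_exponent" and g = "\<lambda>_. h" and \<phi> = \<phi>] h eh \<phi>
    unfolding \<phi>'_def by (simp add: finite_row_index row_exponent_ge_1)
  have "val (row_index (Suc k)) Z \<phi> = val (row_index (Suc k)) (\<lambda>i. case_sum Z (W (Suc k)) (h i)) \<phi>"
  proof -
    have "Z i = case_sum Z (W (Suc k)) (h i)" if "i \<in> row_index (Suc k)" for i
      using that unfolding h_def Z_def row_index_def by (auto simp: le_Suc_eq)
    then show ?thesis unfolding val_def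
      by (intro arg_cong[where f = lim] ext L1_blip_cong)
  qed
  also have "\<dots> = val (row_index k <+> UNIV) (case_sum Z (W (Suc k))) \<phi>'"
    unfolding \<phi>'_def
    by (rule val_reindex[OF ui_familyD(1)[OF ui_family_case_sum[OF uiZ uiW]] finite_row_index \<phi>])
        (rule h)
  finally have ev: "ev E (row_index (Suc k)) Z \<phi>
      = ev E (row_index k <+> UNIV) (case_sum Z (W (Suc k))) \<phi>'"
    unfolding ev_def by simp
  have sec: "\<phi>' (case_sum x w) = \<phi> (append_row k x w)" for x w
    unfolding \<phi>'_def h_def append_row_def by (rule arg_cong[where f = \<phi>]) (auto split: prod.split)
  have "indep_of H j E UNIV (W (Suc k)) ({1..<Suc k} \<times> UNIV) (\<lambda>(m, c). W m c)"
    using E k unfolding iid_exp_def by auto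
  then have ind: "indep_of H j E UNIV (W (Suc k)) (row_index k) Z"
    unfolding row_index_def Z_def atLeastLessThanSuc_atLeastAtMost .
  note i = indep_ev[OF iid_exp_dom[OF E] ind uiZ uiW \<phi>' g, unfolded sec, folded ev]
  show "(\<And>x. ev E UNIV (W (Suc k)) (\<lambda>w. \<phi> (append_row k x w)) \<le> g x) \<Longrightarrow>
      ev E (row_index (Suc k)) Z \<phi> \<le> ev E (row_index k) Z g"
    and "(\<And>x. g x \<le> ev E UNIV (W (Suc k)) (\<lambda>w. \<phi> (append_row k x w))) \<Longrightarrow>
        ev E (row_index k) Z g \<le> ev E (row_index (Suc k)) Z \<phi>"
    by (fact i)+
qed

lemma linear_null:
  fixes v :: "real ^ 'd"
  assumes i: "i \<in> {1..n}"
  shows "ev Eh UNIV (W i) (\<lambda>w. \<Sum>c\<in>UNIV. v $ c * w (Inl c)) \<le> 0"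
proof -
  have n: "1 \<in> {1..n}" "n \<ge> 1" using i by auto
  have tc: "tame UNIV xy_exponent (\<lambda>w. w (Inl c))" for c :: 'd
    by (intro tame_coord xy_exponent_ge_1(1)) auto
  have 1: "ev Eh UNIV (W 1) (\<lambda>w. w (Inl c)) = 0" for c
    unfolding ev_def val_coord_W[OF n(1)] using centred[OF n(2)] by (simp add: joint_def)
  have 2: "ev Eh UNIV (W 1) (\<lambda>w. - 1 * w (Inl c)) = 0" for c
    unfolding ev_def val_cmult[OF ui_W[OF n(1)] tc] val_coord_W[OF n(1)] using centred[OF n(2)]
    by (simp add: joint_def)
  have 3: "ev Eh UNIV (W i) (\<lambda>w. a * w (Inl c)) = 0" for a c
  proof -
    have "ev Eh UNIV (W i) (\<lambda>w. a * w (Inl c)) = ev Eh UNIV (W 1) (\<lambda>w. a * w (Inl c))"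
      by (intro ev_W iid_exp_Eh i tame_cmult tc finite)
    also have "\<dots> = 0"
    proof (cases "a \<ge> 0")
      case True
      then show ?thesis using ev_cmult[OF ui_W[OF n(1)] tc True] 1 by simp
    next
      case False
      then show ?thesis
        using ev_cmult[OF ui_W[OF n(1)] tame_cmult[OF finite tc, of "-1" c], of "- a"] 2 by simp
    qed
    finally show ?thesis .
  qed
  have "ev Eh UNIV (W i) (\<lambda>w. \<Sum>c\<in>UNIV. v $ c * w (Inl c))
      \<le> (\<Sum>c\<in>UNIV. ev Eh UNIV (W i) (\<lambda>w. v $ c * w (Inl c)))"
    by (intro ev_sum_le[OF ui_W[OF i]] finite tame_cmult tc)
  then show ?thesis unfolding 3 by simp
qed

lemma ev_add_linear:
  fixes v :: "real ^ 'd"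
  assumes "dom_exp E" "i \<in> {1..n}" "tame UNIV xy_exponent \<phi>"
  shows "ev E UNIV (W i) (\<lambda>w. \<phi> w + (\<Sum>c\<in>UNIV. v $ c * w (Inl c))) = ev E UNIV (W i) \<phi>"
proof (rule ev_add_null[OF ui_W[OF assms(2)] assms(1,3) tame_linear(2) linear_null[OF assms(2)]])
  show "ev Eh UNIV (W i) (\<lambda>w. - (\<Sum>c\<in>UNIV. v $ c * w (Inl c))) \<le> 0"
    using linear_null[OF assms(2), of "- v"] by (simp add: sum_negf)
qed

lemma ev_quad_fun_total:
  assumes E: "iid_exp E" and A: "transpose A = A"
  shows "k \<ge> 1 \<Longrightarrow> k \<le> n \<Longrightarrow> ev E (row_index k) Z (\<lambda>x. quad_fun A p (row_total k x))
      = real k * ev E UNIV (W 1) (quad_fun A p)"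
proof (induction k rule: nat_induct_at_least)
  case base
  then show ?case unfolding ev_def by (simp add: val_row_total_1[OF _ tame_quad_fun] del:
      One_nat_def)
next
  case (Suc k)
  note D = iid_exp_dom[OF E]
  have k: "k < n" "k \<le> n" "Suc k \<in> {1..n}" using Suc.prems by auto
  define c where "c = ev E UNIV (W 1) (quad_fun A p)"
  define g where "g x = quad_fun A p (row_total k x) + c" for x
  have tg: "tame (row_index k) row_exponent g"
    unfolding g_def[abs_def] by (intro tame_add tame_row_total tame_quad_fun tame_const
        finite_row_index)
  have eq: "ev E UNIV (W (Suc k)) (\<lambda>w. quad_fun A p (row_total (Suc k) (append_row k x w))) = g x"
    for x
  proof -
    let ?v = "A *v (\<chi> c. row_total k x (Inl c))"
    have "ev E UNIV (W (Suc k)) (\<lambda>w. quad_fun A p (row_total (Suc k) (append_row k x w)))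
        = ev E UNIV (W (Suc k)) (\<lambda>w. (quad_fun A p w + (\<Sum>c\<in>UNIV. ?v $ c * w (Inl c))) + quad_fun A p
            (row_total k x))"
      unfolding row_total_append quad_fun_add[OF A] ..
    also have "\<dots> = ev E UNIV (W (Suc k)) (\<lambda>w. quad_fun A p w + (\<Sum>c\<in>UNIV. ?v $ c * w (Inl c)))
        + quad_fun A p (row_total k x)"
      by (intro ev_add_const[OF ui_W[OF k(3)] D] tame_add tame_quad_fun tame_linear finite)
    also have "\<dots> = c + quad_fun A p (row_total k x)"
      unfolding ev_add_linear[OF D k(3) tame_quad_fun] ev_W[OF E k(3) tame_quad_fun] c_def ..
    finally show ?thesis unfolding g_def by simp
  qed
  have "ev E (row_index (Suc k)) Z (\<lambda>x. quad_fun A p (row_total (Suc k) x))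
      = ev E (row_index k) Z g"
    by (intro antisym ev_append_row[OF E Suc.hyps k(1) tame_row_total[OF tame_quad_fun] tg])
        (simp_all only: eq order_refl)
  also have "\<dots> = ev E (row_index k) Z (\<lambda>x. quad_fun A p (row_total k x)) + c"
    unfolding g_def[abs_def] by (rule
        ev_add_const[OF ui_Z[OF k(2)] D tame_row_total[OF tame_quad_fun]])
  also have "\<dots> = real (Suc k) * c"
    using Suc.IH k(2) unfolding c_def by (simp add: algebra_simps)
  finally show ?case unfolding c_def .
qed

text \<open>The upper second moment of \<open>X\<^sub>1\<close>.\<close>

definition second_moment :: real where
  "second_moment = ev Eh UNIV (W 1) sq_norm_fun"

lemma ev_sq_norm_fun_total:
  assumes "k \<ge> 1" "k \<le> n"
  shows "ev Eh (row_index k) Z (\<lambda>x. sq_norm_fun (row_total k x)) = real k * second_moment"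
proof -
  \<comment> \<open>The square norm is the quadratic form of twice the identity matrix.\<close>
  have "transpose (2 *\<^sub>R mat 1 :: real ^ 'd ^ 'd) = 2 *\<^sub>R mat 1"
    by (simp add: vec_eq_iff transpose_def mat_def)
  from ev_quad_fun_total[OF iid_exp_Eh this assms, where p = 0] show ?thesis
    unfolding quad_fun_2 second_moment_def .
qed

lemma second_moment_nonneg: "n \<ge> 1 \<Longrightarrow> second_moment \<ge> 0"
  using ev_mono[OF ui_W[of 1] dom_exp_Eh tame_const[OF finite, where c = 0] tame_sq_norm_fun]
    ev_const[OF ui_W[of 1] dom_exp_Eh, of 0] unfolding second_moment_def
      by (simp add: sq_norm_fun_def)

lemma tame_smooth_cross: "tame (row_index k) row_exponent (\<lambda>x. smooth_pos N (cross k x))"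
  by (rule tame_lip[OF finite_row_index tame_cross smooth_pos_lipschitz])

text \<open>Each step adds \<open>(4/N) \<sigma>\<^sup>2 \<cdot> k\<sigma>\<^sup>2\<close>, and \<open>2k\<^sup>2 + 4k \<le> 2(k + 1)\<^sup>2\<close>.\<close>

lemma ev_smooth_cross:
  assumes N: "N > 0"
  shows "k \<ge> 1 \<Longrightarrow> k \<le> n \<Longrightarrow> ev Eh (row_index k) Z (\<lambda>x. smooth_pos N (cross k x))
      \<le> 2 * (real k * second_moment)\<^sup>2 / N"
proof (induction k rule: nat_induct_at_least)
  case base
  have "cross 1 x = 0" for x :: "nat \<times> ('d + 'd) \<Rightarrow> real" unfolding cross_def row_total_def by simp
  then have "ev Eh (row_index 1) Z (\<lambda>x. smooth_pos N (cross 1 x)) = 0"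
    using smooth_pos_0[OF N] ev_const[OF ui_Z[OF base] dom_exp_Eh, of 0] by simp
  then show ?case using N by simp
next
  case (Suc k)
  have k: "k < n" "k \<le> n" "Suc k \<in> {1..n}" "n \<ge> 1" using Suc.prems by auto
  define g where "g x = smooth_pos N (cross k x)
      + 4 * second_moment / N * sq_norm_fun (row_total k x)" for x :: "nat \<times> ('d + 'd) \<Rightarrow> real"
  have tg: "tame (row_index k) row_exponent g" unfolding g_def[abs_def]
    by (intro tame_add tame_smooth_cross tame_cmult tame_row_total tame_sq_norm_fun
        finite_row_index)
  have le: "ev Eh UNIV (W (Suc k)) (\<lambda>w. smooth_pos N (cross (Suc k) (append_row k x w))) \<le> g x"
    for x
  proof -
    let ?s = "\<chi> c. row_total k x (Inl c)"
    \<comment> \<open>The first-order term is linear in \<open>w\<close> with coefficients \<open>v\<close>; the remainder is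
      bounded by Cauchy-Schwarz.\<close>
    define d where "d = cross k x / sqrt ((N / 2)\<^sup>2 + (cross k x)\<^sup>2)"
    define v where "v = (2 * d) *\<^sub>R ?s"
    define a where "a = 4 * sq_norm_fun (row_total k x) / N"
    have a: "a \<ge> 0" unfolding a_def sq_norm_fun_def using N by simp
    have lin: "(\<Sum>c\<in>UNIV. v $ c * w (Inl c)) = d * (2 * (?s \<bullet> (\<chi> c. w (Inl c))))"
      for w :: "'d + 'd \<Rightarrow> real"
      unfolding v_def by (simp add: inner_vec_def sum_distrib_left mult_ac)
    have pw: "smooth_pos N (cross (Suc k) (append_row k x w))
        \<le> (a * sq_norm_fun w + smooth_pos N (cross k x)) + (\<Sum>c\<in>UNIV. v $ c * w (Inl c))" for w
    proof -
      let ?h = "2 * (?s \<bullet> (\<chi> c. w (Inl c)))"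
      have "(?s \<bullet> (\<chi> c. w (Inl c)))\<^sup>2 \<le> sq_norm_fun (row_total k x) * sq_norm_fun w"
        using Cauchy_Schwarz_ineq[of ?s "\<chi> c. w (Inl c)"] unfolding sq_norm_fun_def
        by (simp add: power2_norm_eq_inner)
      then have "?h\<^sup>2 / N \<le> a * sq_norm_fun w" unfolding a_def using N
        by (simp add: power_mult_distrib divide_right_mono)
      then show ?thesis
        using smooth_pos_add_le[OF N, of "cross k x" ?h] unfolding cross_append_row lin d_def
        by linarith
    qed
    have t: "tame UNIV xy_exponent (\<lambda>w. a * sq_norm_fun w + smooth_pos N (cross k x))"
      by (intro tame_add tame_cmult tame_sq_norm_fun tame_const finite)
    have t': "tame UNIV xy_exponent (\<lambda>w. smooth_pos N (cross (Suc k) (append_row k x w)))"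
    proof (rule tame_lip[OF finite _ smooth_pos_lipschitz])
      have "cross (Suc k) (append_row k x w) = cross k x + (\<Sum>c\<in>UNIV. (2 *\<^sub>R ?s) $ c * w (Inl c))"
        for w
        unfolding cross_append_row by (simp add: inner_vec_def sum_distrib_left mult_ac)
      then show "tame UNIV xy_exponent (\<lambda>w. cross (Suc k) (append_row k x w))"
        by (simp only:) (intro tame_add tame_const tame_linear finite)
    qed
    have "ev Eh UNIV (W (Suc k)) (\<lambda>w. smooth_pos N (cross (Suc k) (append_row k x w)))
        \<le> ev Eh UNIV (W (Suc k)) (\<lambda>w. (a * sq_norm_fun w + smooth_pos N (cross k x)) +
            (\<Sum>c\<in>UNIV. v $ c * w (Inl c)))"
      by (intro ev_mono[OF ui_W[OF k(3)] dom_exp_Eh] t' tame_add t tame_linear finite pw)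
    also have "\<dots> = ev Eh UNIV (W (Suc k)) (\<lambda>w. a * sq_norm_fun w + smooth_pos N (cross k x))"
      by (rule ev_add_linear[OF dom_exp_Eh k(3) t])
    also have "\<dots> = ev Eh UNIV (W (Suc k)) (\<lambda>w. a * sq_norm_fun w) + smooth_pos N (cross k x)"
      by (intro ev_add_const[OF ui_W[OF k(3)] dom_exp_Eh] tame_cmult tame_sq_norm_fun finite)
    also have "ev Eh UNIV (W (Suc k)) (\<lambda>w. a * sq_norm_fun w) = a * second_moment"
      unfolding ev_cmult[OF ui_W[OF k(3)] tame_sq_norm_fun a] ev_W[OF iid_exp_Eh k(3)
          tame_sq_norm_fun] second_moment_def ..
    finally show ?thesis unfolding g_def a_def by (simp add: mult_ac)
  qed
  have "ev Eh (row_index (Suc k)) Z (\<lambda>x. smooth_pos N (cross (Suc k) x)) \<le> ev Eh (row_index k) Z g"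
    by (rule ev_append_row(1)[OF iid_exp_Eh Suc.hyps k(1) tame_smooth_cross tg le])
  also have "\<dots> \<le> ev Eh (row_index k) Z (\<lambda>x. smooth_pos N (cross k x))
      + ev Eh (row_index k) Z (\<lambda>x. 4 * second_moment / N * sq_norm_fun (row_total k x))"
    unfolding g_def[abs_def]
    by (intro ev_add_le[OF ui_Z[OF k(2)]] tame_smooth_cross tame_cmult tame_row_total
        tame_sq_norm_fun finite_row_index)
  also have "ev Eh (row_index k) Z (\<lambda>x. 4 * second_moment / N * sq_norm_fun (row_total k x))
      = 4 * second_moment / N * (real k * second_moment)"
    using ev_cmult[OF ui_Z[OF k(2)] tame_row_total[OF tame_sq_norm_fun], of "4 * second_moment / N"]
        N second_moment_nonneg[OF k(4)]
      ev_sq_norm_fun_total[OF Suc.hyps k(2)] by simp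
  also have "ev Eh (row_index k) Z (\<lambda>x. smooth_pos N (cross k x))
      \<le> 2 * (real k * second_moment)\<^sup>2 / N"
    by (rule Suc.IH[OF k(2)])
  also have "2 * (real k * second_moment)\<^sup>2 / N + 4 * second_moment / N * (real k * second_moment)
      = (2 * (real k)\<^sup>2 + 4 * real k) * second_moment\<^sup>2 / N"
    by (simp add: power2_eq_square algebra_simps add_divide_distrib)
  also have "\<dots> \<le> (2 * (real (Suc k))\<^sup>2) * second_moment\<^sup>2 / N"
    using N by (intro divide_right_mono mult_right_mono) (auto simp: power2_eq_square algebra_simps)
  finally show ?case by (simp add: power_mult_distrib)
qed

lemma ev_excess_fun_total:
  assumes N: "N > 0" and k: "k \<ge> 1" "k \<le> n"
  shows "ev Eh (row_index k) Z (\<lambda>x. excess_fun 1 N N (row_total k x))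
    \<le> ev Eh UNIV (W 1) (excess_fun (real k) (N / 2) N) + 4 * (real k * second_moment)\<^sup>2 / N"
proof -
  note ui = ui_Z[OF k(2)]
  let ?r = "excess_fun (real k) (N / 2) N :: ('d + 'd \<Rightarrow> real) \<Rightarrow> real"
  have trow: "tame (row_index k) row_exponent (\<lambda>x. 1 / real k * ?r (\<lambda>c. x (m, c)))" if "m \<in> {1..k}"
    for m
    by (intro tame_cmult finite_row_index tame_row tame_excess_fun that)
  have ts: "tame (row_index k) row_exponent (\<lambda>x. \<Sum>m=1..k. 1 / real k * ?r (\<lambda>c. x (m, c)))"
    by (intro tame_sum finite_row_index trow)
  have each: "ev Eh (row_index k) Z (\<lambda>x. 1 / real k * ?r (\<lambda>c. x (m, c)))
      = 1 / real k * ev Eh UNIV (W 1) ?r"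
    if m: "m \<in> {1..k}" for m
  proof -
    have "ev Eh (row_index k) Z (\<lambda>x. 1 / real k * ?r (\<lambda>c. x (m, c)))
        = 1 / real k * ev Eh (row_index k) Z (\<lambda>x. ?r (\<lambda>c. x (m, c)))"
      by (intro ev_cmult[OF ui tame_row[OF tame_excess_fun m]]) simp
    also have "ev Eh (row_index k) Z (\<lambda>x. ?r (\<lambda>c. x (m, c))) = ev Eh UNIV (W m) ?r"
      unfolding ev_def val_row[OF k(2) m tame_excess_fun] ..
    also have "\<dots> = ev Eh UNIV (W 1) ?r" using m k by (intro ev_W iid_exp_Eh tame_excess_fun) auto
    finally show ?thesis .
  qed
  have "ev Eh (row_index k) Z (\<lambda>x. excess_fun 1 N N (row_total k x))
      \<le> ev Eh (row_index k) Z (\<lambda>x. (\<Sum>m=1..k. 1 / real k * ?r (\<lambda>c. x (m, c))) + smooth_pos N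
          (cross k x))"
    by (intro ev_mono[OF ui dom_exp_Eh] tame_row_total tame_excess_fun tame_add finite_row_index ts
        tame_smooth_cross
        excess_fun_total_le k(1) N)
  also have "\<dots> \<le> ev Eh (row_index k) Z (\<lambda>x. \<Sum>m=1..k. 1 / real k * ?r (\<lambda>c. x (m, c)))
      + ev Eh (row_index k) Z (\<lambda>x. smooth_pos N (cross k x))"
    by (intro ev_add_le[OF ui] ts tame_smooth_cross)
  also have "ev Eh (row_index k) Z (\<lambda>x. \<Sum>m=1..k. 1 / real k * ?r (\<lambda>c. x (m, c)))
      \<le> (\<Sum>m=1..k. ev Eh (row_index k) Z (\<lambda>x. 1 / real k * ?r (\<lambda>c. x (m, c))))"
    by (intro ev_sum_le[OF ui] trow) auto
  also have "\<dots> = ev Eh UNIV (W 1) ?r" using each k(1) by simp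
  also have "ev Eh (row_index k) Z (\<lambda>x. smooth_pos N (cross k x))
      \<le> 2 * (real k * second_moment)\<^sup>2 / N"
    by (rule ev_smooth_cross[OF N k])
  also have "\<dots> \<le> 4 * (real k * second_moment)\<^sup>2 / N" using N
    by (intro divide_right_mono mult_right_mono) auto
  finally show ?thesis by simp
qed

lemma quad_lin_1: "n \<ge> 1 \<Longrightarrow> quad_lin H j A p (X 1) (Y 1) = val UNIV (W 1) (quad_fun A p)"
  using quad_lin_eq_val[of 1 A p] val_row_total_1[OF _ tame_quad_fun, of A p] by simp

lemma excess_1: "n \<ge> 1 \<Longrightarrow> excess H j a M N (X 1) (Y 1) = val UNIV (W 1) (excess_fun a M N)"
  using excess_eq_val[of 1 a M N] val_row_total_1[OF _ tame_excess_fun, of a M N] by simp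

lemma second_moment_eq: "n \<ge> 1 \<Longrightarrow> L1_exp H j Eh (L1_val H j (\<lambda>x. (norm x)\<^sup>2) (X 1)) = second_moment"
  using L1_val_sum_X[OF _ tame_norm_sq, of 1] val_row_total_1[OF _ tame_sq_norm_fun]
  unfolding second_moment_def ev_def sq_norm_fun_def by simp

lemma quad_lin_sum:
  assumes "iid_exp E" "transpose A = A" "k \<in> {1..n}"
  shows "L1_exp H j E (quad_lin H j A p (\<Sum>i=1..k. X i) (\<Sum>i=1..k. Y i))
    = real k * L1_exp H j E (quad_lin H j A p (X 1) (Y 1))"
  using ev_quad_fun_total[OF assms(1,2), where k = k and p = p] assms(3) unfolding ev_def
  by (simp add: quad_lin_eq_val quad_lin_1 del: One_nat_def)

lemma excess_sum:
  assumes "N > 0" "k \<in> {1..n}"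
  shows "L1_exp H j Eh (excess H j 1 N N (\<Sum>i=1..k. X i) (\<Sum>i=1..k. Y i)) \<le>
       L1_exp H j Eh (excess H j (real k) (N / 2) N (X 1) (Y 1)) +
       4 * (real k * L1_exp H j Eh (L1_val H j (\<lambda>x. (norm x)\<^sup>2) (X 1)))\<^sup>2 / N"
  using ev_excess_fun_total[OF assms(1), of k] assms(2) unfolding ev_def
  by (simp add: excess_eq_val excess_1 second_moment_eq del: One_nat_def)

end

theorem lemma3p3:
  fixes H :: "('w \<Rightarrow> real) set"
    and Eh Et :: "('w \<Rightarrow> real) \<Rightarrow> real"
    and j :: "('w \<Rightarrow> real) \<Rightarrow> 'l::banach"
    and X Y :: "nat \<Rightarrow> nat \<Rightarrow> 'l ^ 'd"
  assumes "rv_space H"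
    and "sublinear_expectation H Eh"
    and "nonlinear_expectation H Et"
    and "dominated_by H Et Eh"
    and "completion_map H Eh j"
    and "\<And>n i c. 1 \<le> i \<Longrightarrow> i \<le> n \<Longrightarrow> X n i $ c \<in> L1 H j \<and> Y n i $ c \<in> L1 H j"
    and "\<And>n i. 1 \<le> i \<Longrightarrow> i \<le> n \<Longrightarrow>
           in_L1 H j (\<lambda>x. (norm x)\<^sup>2) (X n i) \<and> in_L1 H j norm (Y n i)"
    and "\<And>E n i. E \<in> {Et, Eh} \<Longrightarrow> 2 \<le> i \<Longrightarrow> i \<le> n \<Longrightarrow>
           same_law H j E UNIV (joint (X n i) (Y n i)) (joint (X n 1) (Y n 1))"
    and "\<And>E n i. E \<in> {Et, Eh} \<Longrightarrow> 2 \<le> i \<Longrightarrow> i \<le> n \<Longrightarrow>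
           indep_of H j E UNIV (joint (X n i) (Y n i))
             ({1..<i} \<times> UNIV) (\<lambda>(m, c). joint (X n m) (Y n m) c)"
    and "\<And>n c. 1 \<le> n \<Longrightarrow> L1_exp H j Eh (X n 1 $ c) = 0 \<and> L1_exp H j Eh (- X n 1 $ c) = 0"
    and "((\<lambda>N::real. SUP n\<in>{1..}.
             ereal (L1_exp H j Eh (excess H j (real n) N N (X n 1) (Y n 1)))) \<longlongrightarrow> 0) at_top"
    and "\<And>A p. transpose A = A \<Longrightarrow>
           convergent (\<lambda>n. real n * L1_exp H j Et (quad_lin H j A p (X n 1) (Y n 1)))"
  shows "\<forall>A p. transpose A = A \<longrightarrow> (\<forall>N>0. \<forall>n\<ge>1. \<forall>k\<in>{1..n}.
     L1_exp H j Eh (quad_lin H j A p (\<Sum>i=1..k. X n i) (\<Sum>i=1..k. Y n i)) =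
       real k * L1_exp H j Eh (quad_lin H j A p (X n 1) (Y n 1)) \<and>
     L1_exp H j Et (quad_lin H j A p (\<Sum>i=1..k. X n i) (\<Sum>i=1..k. Y n i)) =
       real k * L1_exp H j Et (quad_lin H j A p (X n 1) (Y n 1)) \<and>
     L1_exp H j Eh (excess H j 1 N N (\<Sum>i=1..k. X n i) (\<Sum>i=1..k. Y n i)) \<le>
       L1_exp H j Eh (excess H j (real k) (N / 2) N (X n 1) (Y n 1)) +
       4 * (real k * L1_exp H j Eh (L1_val H j (\<lambda>x. (norm x)\<^sup>2) (X n 1)))\<^sup>2 / N)"
proof (intro allI impI ballI)
  fix A :: "real ^ 'd ^ 'd" and p :: "real ^ 'd" and N :: real and n k :: nat
  assume A: "transpose A = A" and N: "N > 0" and n: "n \<ge> 1" and k: "k \<in> {1..n}"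
  interpret iid_row H Eh j "X n" "Y n" n
  proof unfold_locales
    show "rv_space H" "sublinear_expectation H Eh" "completion_map H Eh j" by fact+
    show "X n i $ c \<in> L1 H j \<and> Y n i $ c \<in> L1 H j"
      "in_L1 H j (\<lambda>x. (norm x)\<^sup>2) (X n i) \<and> in_L1 H j norm (Y n i)" if "i \<in> {1..n}" for i c
      using assms(6,7) that by auto
    show "same_law H j Eh UNIV (joint (X n i) (Y n i)) (joint (X n 1) (Y n 1))"
      "indep_of H j Eh UNIV (joint (X n i) (Y n i)) ({1..<i} \<times> UNIV) (\<lambda>(m, c). joint (X n m) (Y n m) c)"
      if "2 \<le> i" "i \<le> n" for i
      by (rule assms(8,9)[OF _ that], simp)+
    show "L1_exp H j Eh (X n 1 $ c) = 0 \<and> L1_exp H j Eh (- X n 1 $ c) = 0" if "n \<ge> 1" for c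
      using assms(10)[OF that] .
  qed
  have Et: "iid_exp Et"
    unfolding iid_exp_def dom_exp_def using assms(3,4,8,9) by blast
  show "L1_exp H j Eh (quad_lin H j A p (\<Sum>i=1..k. X n i) (\<Sum>i=1..k. Y n i)) =
       real k * L1_exp H j Eh (quad_lin H j A p (X n 1) (Y n 1)) \<and>
     L1_exp H j Et (quad_lin H j A p (\<Sum>i=1..k. X n i) (\<Sum>i=1..k. Y n i)) =
       real k * L1_exp H j Et (quad_lin H j A p (X n 1) (Y n 1)) \<and>
     L1_exp H j Eh (excess H j 1 N N (\<Sum>i=1..k. X n i) (\<Sum>i=1..k. Y n i)) \<le>
       L1_exp H j Eh (excess H j (real k) (N / 2) N (X n 1) (Y n 1)) +
       4 * (real k * L1_exp H j Eh (L1_val H j (\<lambda>x. (norm x)\<^sup>2) (X n 1)))\<^sup>2 / N"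
    by (intro conjI quad_lin_sum[OF iid_exp_Eh A k] quad_lin_sum[OF Et A k] excess_sum[OF N k])
qed

end
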